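(* Let $k$ be a field and let $\Delta$ be a quasi-forest on the vertex set $\{1,\ldots,n\}$ with at least two facets. Let $F_1,\ldots,F_m$ ($m\ge 2$) be its facets listed in an order witnessing that $\Delta$ is a quasi-forest. For $2\le i\le m$ let $r_i=\dim\big((F_1\cup\cdots\cup F_{i-1})\cap F_i\big)$, and let $r=\min_{2\le i\le m} r_i$. Let $G=\overline{G(\Delta)}$ be the complement of the 1-skeleton of $\Delta$, so that $k[\Delta]=k[G]$. Then the equality $$\mathrm{pd}(k[\Delta])=\max\{\deg_G(v) : v\in V(G)\}$$ holds if and only if there is a facet $F$ of $\Delta$ with $\dim F=r+1$ such that $F$ contains a free vertex of $\Delta$ and the intersection of $F$ with the union of the other facets of $\Delta$ is a simplex of dimension $r$.
   Context: For a simplicial complex $\Delta$ on vertex set $\{1,\ldots,n\}$ (every vertex is a face), the Stanley-Reisner ring is $k[\Delta]=S/I(\Delta)$ with $S=k[x_1,\ldots,x_n]$, where $I(\Delta)$ is generated by the squarefree monomials $x_{i_1}\cdots x_{i_j}$ such that $\{i_1,\ldots,i_j\}$ is not a face of $\Delta$. $\mathrm{pd}$ denotes projective dimension over $S$. For a finite simple graph $G$ on $\{1,\ldots,n\}$ the edge ring is $k[G]=S/I(G)$, where $I(G)$ is generated by the $x_ix_j$ with $\{i,j\}$ an edge of $G$. The complement graph $\overline{H}$ of a graph $H$ has the same vertices, and $\{i,j\}$ (with $i\neq j$) is an edge of $\overline H$ iff it is not an edge of $H$. $G(\Delta)$ denotes the 1-skeleton (graph) of $\Delta$. $\deg_G(v)$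 is the number of neighbours of $v$ in $G$. Quasi-forests are defined recursively. A simplex $F_1$ (a full simplex on its vertex set) is a quasi-forest. If $F_1\cup\cdots\cup F_{i-1}$ (each $F_j$ a simplex) is a quasi-forest and $F_i$ is a simplex such that $(F_1\cup\cdots\cup F_{i-1})\cap F_i$ is a simplex (possibly empty), then $F_1\cup\cdots\cup F_i$ is a quasi-forest. Here the $F_j$ are taken to be the distinct facets (maximal faces) of the resulting complex, and the order $F_1,\ldots,F_m$ is one for which every intersection $(F_1\cup\cdots\cup F_{i-1})\cap F_i$ is a simplex. Unions and intersections are of simplicial complexes, identifying a face with the full simplex on it. The empty simplex has dimension $-1$. A vertex is free if it belongs to exactly one facet. *)

theory Defs
  imports
    "HOL-Algebra.QuotRing"
    "HOL-Algebra.Module"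
    "HOL-Library.Poly_Mapping"
    "HOL-Library.Extended_Nat"
begin

definition linear_maps ::
    "('r, 'x) ring_scheme \<Rightarrow> ('r, 'a, 'y) module_scheme \<Rightarrow> ('r, 'b, 'z) module_scheme \<Rightarrow> ('a \<Rightarrow> 'b) set"
  where "linear_maps R M N =
    {f. f \<in> carrier M \<rightarrow> carrier N \<and>
        (\<forall>x\<in>carrier M. \<forall>y\<in>carrier M. f (x \<oplus>\<^bsub>M\<^esub> y) = f x \<oplus>\<^bsub>N\<^esub> f y) \<and>
        (\<forall>a\<in>carrier R. \<forall>x\<in>carrier M. f (a \<odot>\<^bsub>M\<^esub> x) = a \<odot>\<^bsub>N\<^esub> f x)}"

text \<open>
  The free module on a set \<open>B\<close>: finitely supported families of scalars indexed by \<open>B\<close>, extended by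
  zero outside \<open>B\<close>. The fields \<open>mult\<close> and \<open>one\<close>, which a module record inherits from the ring record,
  have no meaning for a module.
\<close>

definition free_module :: "('r, 'x) ring_scheme \<Rightarrow> 'b set \<Rightarrow> ('r, 'b \<Rightarrow> 'r) module"
  where "free_module R B =
    \<lparr>carrier = {f. (\<forall>b\<in>B. f b \<in> carrier R) \<and> (\<forall>b. b \<notin> B \<longrightarrow> f b = \<zero>\<^bsub>R\<^esub>) \<and> finite {b. f b \<noteq> \<zero>\<^bsub>R\<^esub>}},
     mult = undefined, one = undefined,
     zero = (\<lambda>_. \<zero>\<^bsub>R\<^esub>),
     add = (\<lambda>f g b. f b \<oplus>\<^bsub>R\<^esub> g b),
     smult = (\<lambda>a f b. a \<otimes>\<^bsub>R\<^esub> f b)\<rparr>"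

text \<open>
  A module is projective iff it is a direct summand (a retract) of a free module. If \<open>P\<close> is a retract
  of any free module, it is already one of the free module on the set \<open>carrier P\<close>, so taking bases
  from the type of elements of \<open>P\<close> is no restriction.
\<close>

definition projective_module :: "('r, 'x) ring_scheme \<Rightarrow> ('r, 'a, 'y) module_scheme \<Rightarrow> bool"
  where "projective_module R P \<longleftrightarrow> Module.module R P \<and>
    (\<exists>(B :: 'a set) i p. i \<in> linear_maps R P (free_module R B) \<and> p \<in> linear_maps R (free_module R B) P \<and>
       (\<forall>x\<in>carrier P. p (i x) = x))"

text \<open>
  \<open>0 \<leftarrow> M \<leftarrow> P 0 \<leftarrow> P 1 \<leftarrow> \<dots> \<leftarrow> P d \<leftarrow> 0\<close> is exact with projective \<open>P i\<close>;
  the map \<open>P 0 \<rightarrow> M\<close> is \<open>e\<close> and the map \<open>P (i + 1) \<rightarrow> P i\<close> is \<open>D i\<close>.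
\<close>

definition projective_resolution ::
    "('r, 'x) ring_scheme \<Rightarrow> ('r, 'm, 'y) module_scheme \<Rightarrow> nat \<Rightarrow>
     (nat \<Rightarrow> ('r, 'p) module) \<Rightarrow> (nat \<Rightarrow> 'p \<Rightarrow> 'p) \<Rightarrow> ('p \<Rightarrow> 'm) \<Rightarrow> bool"
  where "projective_resolution R M d P D e \<longleftrightarrow>
    (\<forall>i. projective_module R (P i)) \<and>
    (\<forall>i>d. carrier (P i) = {\<zero>\<^bsub>P i\<^esub>}) \<and>
    (\<forall>i. D i \<in> linear_maps R (P (Suc i)) (P i)) \<and>
    e \<in> linear_maps R (P 0) M \<and>
    e ` carrier (P 0) = carrier M \<and>
    D 0 ` carrier (P 1) = {x \<in> carrier (P 0). e x = \<zero>\<^bsub>M\<^esub>} \<and>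
    (\<forall>i. D (Suc i) ` carrier (P (Suc (Suc i))) = {x \<in> carrier (P (Suc i)). D i x = \<zero>\<^bsub>P i\<^esub>})"

text \<open>
  The infimum of the lengths of projective resolutions, \<open>\<infinity>\<close> if there is no finite one (and \<open>0\<close> for the
  zero module). HOL cannot quantify over types inside a definition, so the modules in the resolutions
  have elements of type \<open>nat \<times> 'm \<Rightarrow> 'r\<close>. This loses nothing: it suffices to consider resolutions whose
  members other than the last are free on sets of cardinality at most the maximum of \<open>|M|\<close>, \<open>|R|\<close> and
  \<open>\<aleph>\<^sub>0\<close> (by Schanuel's lemma the last kernel is then projective as soon as \<open>M\<close> has some projective
  resolution of that length), and for \<open>|R| \<ge> 2\<close> modules of that size have isomorphic copies on this
  type; over the zero ring every module is zero.
\<close>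

definition proj_dim :: "('r, 'x) ring_scheme \<Rightarrow> ('r, 'm, 'y) module_scheme \<Rightarrow> enat"
  where "proj_dim R M =
    Inf {enat d |d. \<exists>(P :: nat \<Rightarrow> ('r, nat \<times> 'm \<Rightarrow> 'r) module) D e. projective_resolution R M d P D e}"

type_synonym ('v, 'k) mpoly = "('v \<Rightarrow>\<^sub>0 nat) \<Rightarrow>\<^sub>0 'k"

definition mpoly_ring :: "'v set \<Rightarrow> ('v, 'k::comm_ring_1) mpoly ring"
  where "mpoly_ring V =
    \<lparr>carrier = {p. \<forall>t\<in>Poly_Mapping.keys p. Poly_Mapping.keys t \<subseteq> V}, mult = (*), one = 1, zero = 0, add = (+)\<rparr>"

definition var :: "'v \<Rightarrow> ('v, 'k::comm_ring_1) mpoly"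
  where "var v = Poly_Mapping.single (Poly_Mapping.single v 1) 1"

text \<open>The ring \<open>R Quot I\<close> together with its \<open>R\<close>-module structure.\<close>

definition quot_algebra :: "('r, 'x) ring_scheme \<Rightarrow> 'r set \<Rightarrow> ('r, 'r set) module"
  where "quot_algebra R I =
    \<lparr>carrier = carrier (R Quot I), mult = mult (R Quot I), one = one (R Quot I),
     zero = zero (R Quot I), add = add (R Quot I),
     smult = (\<lambda>a X. (I +>\<^bsub>R\<^esub> a) \<otimes>\<^bsub>R Quot I\<^esub> X)\<rparr>"

definition simplicial_complex :: "'v set \<Rightarrow> 'v set set \<Rightarrow> bool"
  where "simplicial_complex V \<Delta> \<longleftrightarrow>
    finite V \<and> \<Delta> \<subseteq> Pow V \<and> {} \<in> \<Delta> \<and> (\<forall>v\<in>V. {v} \<in> \<Delta>) \<and>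
    (\<forall>F\<in>\<Delta>. \<forall>H. H \<subseteq> F \<longrightarrow> H \<in> \<Delta>)"

abbreviation simplex :: "'v set \<Rightarrow> 'v set set"
  where "simplex F \<equiv> Pow F"

definition is_simplex :: "'v set set \<Rightarrow> bool"
  where "is_simplex K \<longleftrightarrow> (\<exists>W. finite W \<and> K = simplex W)"

definition complex_dim :: "'v set set \<Rightarrow> int"
  where "complex_dim K = Max ((\<lambda>F. int (card F) - 1) ` K)"

definition facets :: "'v set set \<Rightarrow> 'v set set"
  where "facets \<Delta> = {F \<in> \<Delta>. \<forall>H\<in>\<Delta>. F \<subseteq> H \<longrightarrow> H = F}"

definition free_vertex :: "'v set set \<Rightarrow> 'v \<Rightarrow> bool"
  where "free_vertex \<Delta> v \<longleftrightarrow> (\<exists>!F. F \<in> facets \<Delta> \<and> v \<in> F)"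

definition complex_of :: "'v set set \<Rightarrow> 'v set set"
  where "complex_of \<F> = (\<Union>F\<in>\<F>. simplex F)"

inductive quasi_forest_seq :: "'v set list \<Rightarrow> bool"
  where
    "finite F \<Longrightarrow> quasi_forest_seq [F]"
  | "quasi_forest_seq Fs \<Longrightarrow> finite F \<Longrightarrow> is_simplex (complex_of (set Fs) \<inter> simplex F)
      \<Longrightarrow> quasi_forest_seq (Fs @ [F])"

definition quasi_forest_order :: "'v set set \<Rightarrow> 'v set list \<Rightarrow> bool"
  where "quasi_forest_order \<Delta> Fs \<longleftrightarrow>
    quasi_forest_seq Fs \<and> \<Delta> = complex_of (set Fs) \<and> distinct Fs \<and> set Fs = facets \<Delta>"

definition quasi_forest :: "'v set set \<Rightarrow> bool"
  where "quasi_forest \<Delta> \<longleftrightarrow> (\<exists>Fs. quasi_forest_order \<Delta> Fs)"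

text \<open>
  List positions start at \<open>0\<close>: \<open>attach_dim Fs i\<close> concerns the facet \<open>Fs ! i\<close>, the \<open>(i + 1)\<close>-st one,
  and is of interest for \<open>1 \<le> i < length Fs\<close>.
\<close>

definition attach_dim :: "'v set list \<Rightarrow> nat \<Rightarrow> int"
  where "attach_dim Fs i = complex_dim (complex_of (set (take i Fs)) \<inter> simplex (Fs ! i))"

text \<open>A graph with vertex set \<open>V\<close> is given by its edges, which are two-element subsets of \<open>V\<close>.\<close>

definition skeleton_edges :: "'v set set \<Rightarrow> 'v set set"
  where "skeleton_edges \<Delta> = {e \<in> \<Delta>. card e = 2}"

definition complement_edges :: "'v set \<Rightarrow> 'v set set \<Rightarrow> 'v set set"
  where "complement_edges V E = {{i, j} |i j. i \<in> V \<and> j \<in> V \<and> i \<noteq> j \<and> {i, j} \<notin> E}"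

definition graph_degree :: "'v set set \<Rightarrow> 'v \<Rightarrow> nat"
  where "graph_degree E v = card {w. {v, w} \<in> E}"

definition stanley_reisner_ideal :: "'v set \<Rightarrow> 'v set set \<Rightarrow> ('v, 'k::field) mpoly set"
  where "stanley_reisner_ideal V \<Delta> =
    Idl\<^bsub>mpoly_ring V\<^esub> {\<Prod>v\<in>\<sigma>. var v |\<sigma>. \<sigma> \<subseteq> V \<and> \<sigma> \<notin> \<Delta>}"

definition stanley_reisner_ring ::
    "'v set \<Rightarrow> 'v set set \<Rightarrow> (('v, 'k::field) mpoly, ('v, 'k) mpoly set) module"
  where "stanley_reisner_ring V \<Delta> = quot_algebra (mpoly_ring V) (stanley_reisner_ideal V \<Delta>)"

definition edge_ideal :: "'v set \<Rightarrow> 'v set set \<Rightarrow> ('v, 'k::field) mpoly set"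
  where "edge_ideal V E = Idl\<^bsub>mpoly_ring V\<^esub> {var i * var j |i j. {i, j} \<in> E}"

definition edge_ring ::
    "'v set \<Rightarrow> 'v set set \<Rightarrow> (('v, 'k::field) mpoly, ('v, 'k) mpoly set) module"
  where "edge_ring V E = quot_algebra (mpoly_ring V) (edge_ideal V E)"

lemma mpoly_ring_cring: "cring (mpoly_ring V :: ('v, 'k::comm_ring_1) mpoly ring)"
proof (rule cringI)
  show "abelian_group (mpoly_ring V :: ('v, 'k) mpoly ring)"
  proof (rule abelian_groupI)
    fix p assume "p \<in> carrier (mpoly_ring V :: ('v, 'k) mpoly ring)"
    then show "\<exists>q\<in>carrier (mpoly_ring V). q \<oplus>\<^bsub>mpoly_ring V\<^esub> p = \<zero>\<^bsub>mpoly_ring V\<^esub>"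
      by (intro bexI[of _ "- p"]) (auto simp: mpoly_ring_def)
  qed (use keys_add in \<open>fastforce simp: mpoly_ring_def ac_simps\<close>)+
  show "comm_monoid (mpoly_ring V :: ('v, 'k) mpoly ring)"
  proof (rule comm_monoidI)
    fix p q :: "('v, 'k) mpoly"
    assume *: "p \<in> carrier (mpoly_ring V)" "q \<in> carrier (mpoly_ring V)"
    have "Poly_Mapping.keys t \<subseteq> V" if t: "t \<in> Poly_Mapping.keys (p * q)" for t
    proof -
      obtain a b where "a \<in> Poly_Mapping.keys p" "b \<in> Poly_Mapping.keys q" "t = a + b"
        using keys_mult[of p q] t by blast
      then show ?thesis
        using * keys_add[of a b] by (fastforce simp: mpoly_ring_def)
    qed
    then show "p \<otimes>\<^bsub>mpoly_ring V\<^esub> q \<in> carrier (mpoly_ring V)"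
      by (simp add: mpoly_ring_def)
  qed (auto simp: mpoly_ring_def ac_simps)
qed (auto simp: mpoly_ring_def algebra_simps)

lemma free_module_module:
  fixes R (structure) and B :: "'b set"
  assumes "cring R"
  shows "Module.module R (free_module R B)"
proof -
  interpret cring R by fact
  have carr: "f b \<in> carrier R" if "f \<in> carrier (free_module R B)" for f and b :: 'b
    using that by (cases "b \<in> B") (auto simp: free_module_def)
  have supp: "finite {b. h b \<noteq> \<zero>}"
    if "finite {b. f b \<noteq> \<zero>}" "finite {b. g b \<noteq> \<zero>}" "\<And>b. f b = \<zero> \<Longrightarrow> g b = \<zero> \<Longrightarrow> h b = \<zero>"
    for f g h :: "'b \<Rightarrow> _"
    by (rule finite_subset[OF _ finite_UnI[OF that(1,2)]]) (use that(3) in auto)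
  show ?thesis
  proof (rule moduleI)
    show "abelian_group (free_module R B)"
    proof (rule abelian_groupI)
      fix f assume f: "f \<in> carrier (free_module R B)"
      have "(\<lambda>b. \<ominus> f b) \<in> carrier (free_module R B)"
        using f supp[of f f "\<lambda>b. \<ominus> f b"] by (auto simp: free_module_def)
      moreover have "(\<lambda>b. \<ominus> f b) \<oplus>\<^bsub>free_module R B\<^esub> f = \<zero>\<^bsub>free_module R B\<^esub>"
        using carr[OF f] by (auto simp: free_module_def l_neg)
      ultimately show "\<exists>g\<in>carrier (free_module R B). g \<oplus>\<^bsub>free_module R B\<^esub> f = \<zero>\<^bsub>free_module R B\<^esub>"
        by blast
    next
      fix f g assume fg: "f \<in> carrier (free_module R B)" "g \<in> carrier (free_module R B)"
      show "f \<oplus>\<^bsub>free_module R B\<^esub> g \<in> carrier (free_module R B)"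
        using fg supp[of f g "\<lambda>b. f b \<oplus> g b"] by (auto simp: free_module_def)
      show "f \<oplus>\<^bsub>free_module R B\<^esub> g = g \<oplus>\<^bsub>free_module R B\<^esub> f"
        using carr[OF fg(1)] carr[OF fg(2)] by (auto simp: free_module_def a_comm)
      fix h assume h: "h \<in> carrier (free_module R B)"
      show "f \<oplus>\<^bsub>free_module R B\<^esub> g \<oplus>\<^bsub>free_module R B\<^esub> h = f \<oplus>\<^bsub>free_module R B\<^esub> (g \<oplus>\<^bsub>free_module R B\<^esub> h)"
        using carr[OF fg(1)] carr[OF fg(2)] carr[OF h] by (auto simp: free_module_def a_assoc)
    next
      show "\<zero>\<^bsub>free_module R B\<^esub> \<in> carrier (free_module R B)"
        by (auto simp: free_module_def)
      fix f assume f: "f \<in> carrier (free_module R B)"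
      show "\<zero>\<^bsub>free_module R B\<^esub> \<oplus>\<^bsub>free_module R B\<^esub> f = f"
        using carr[OF f] by (auto simp: free_module_def)
    qed
  next
    fix a f
    assume a: "a \<in> carrier R" and f: "f \<in> carrier (free_module R B)"
    show "a \<odot>\<^bsub>free_module R B\<^esub> f \<in> carrier (free_module R B)"
      using a f supp[of f f "\<lambda>b. a \<otimes> f b"] by (auto simp: free_module_def)
  next
    fix a b f
    assume "a \<in> carrier R" "b \<in> carrier R" and f: "f \<in> carrier (free_module R B)"
    then show "(a \<oplus> b) \<odot>\<^bsub>free_module R B\<^esub> f
        = a \<odot>\<^bsub>free_module R B\<^esub> f \<oplus>\<^bsub>free_module R B\<^esub> b \<odot>\<^bsub>free_module R B\<^esub> f"
      using carr[OF f] by (auto simp: free_module_def l_distr)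
  next
    fix a f g
    assume "a \<in> carrier R" and f: "f \<in> carrier (free_module R B)"
      and g: "g \<in> carrier (free_module R B)"
    then show "a \<odot>\<^bsub>free_module R B\<^esub> (f \<oplus>\<^bsub>free_module R B\<^esub> g)
        = a \<odot>\<^bsub>free_module R B\<^esub> f \<oplus>\<^bsub>free_module R B\<^esub> a \<odot>\<^bsub>free_module R B\<^esub> g"
      using carr[OF f] carr[OF g] by (auto simp: free_module_def r_distr)
  next
    fix a b f
    assume "a \<in> carrier R" "b \<in> carrier R" and f: "f \<in> carrier (free_module R B)"
    then show "(a \<otimes> b) \<odot>\<^bsub>free_module R B\<^esub> f
        = a \<odot>\<^bsub>free_module R B\<^esub> (b \<odot>\<^bsub>free_module R B\<^esub> f)"
      using carr[OF f] by (auto simp: free_module_def m_assoc)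
  next
    fix f
    assume f: "f \<in> carrier (free_module R B)"
    then show "\<one> \<odot>\<^bsub>free_module R B\<^esub> f = f"
      using carr[OF f] by (auto simp: free_module_def)
  qed fact
qed

lemma quot_algebra_module:
  fixes R (structure)
  assumes "ideal I R" "cring R"
  shows "Module.module R (quot_algebra R I)"
proof -
  interpret ideal I R by fact
  interpret cring R by fact
  interpret Q: cring "R Quot I" by (rule quotient_is_cring) fact
  have hom: "(+>) I \<in> ring_hom R (R Quot I)"
    by (rule rcos_ring_hom)
  note [simp] = quot_algebra_def ring_hom_closed[OF hom] ring_hom_add[OF hom] ring_hom_mult[OF hom]
      ring_hom_one[OF hom]
  show ?thesis
  proof (rule moduleI)
    show "abelian_group (quot_algebra R I)"
    proof (rule abelian_groupI)
      fix x assume "x \<in> carrier (quot_algebra R I)"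
      then show "\<exists>y\<in>carrier (quot_algebra R I). y \<oplus>\<^bsub>quot_algebra R I\<^esub> x = \<zero>\<^bsub>quot_algebra R I\<^esub>"
        using Q.l_neg by (auto intro!: bexI[of _ "\<ominus>\<^bsub>R Quot I\<^esub> x"])
    qed (auto simp: Q.a_ac)
  qed (auto simp: Q.l_distr Q.r_distr Q.m_assoc intro: assms)
qed

end

theory Submission
  imports Defs "HOL-Library.Function_Algebras"
begin

text \<open>
  Let \<open>w = r + 1\<close> be the least number of vertices of an attaching simplex
  \<open>W i = (F 1 \<union> \<dots> \<union> F (i - 1)) \<inter> F i\<close>. The heart of the matter is that \<open>pd k[\<Delta>] = n - w - 1\<close>
  (\<open>proj_dim_part\<close>). The degree of \<open>v\<close> in \<open>G\<close> is \<open>n\<close> minus the number of vertices in the closed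
  neighbourhood of \<open>v\<close> in the 1-skeleton, so the equality in question says that some closed
  neighbourhood has exactly \<open>w + 1\<close> vertices. Every facet has at least \<open>w + 1\<close> vertices; hence such a
  neighbourhood is the only facet through \<open>v\<close>, and an attaching simplex contained in it, which
  misses \<open>v\<close>, must consist of all its other vertices. This is the facet of the statement
  (\<open>minimal_nbhd_iff_leaf\<close>). The identity \<open>k[\<Delta>] = k[G]\<close> holds because a quasi-forest contains every
  simplex whose edges it contains (\<open>flag\<close>).

  Upper bound for the projective dimension. A module with a filtration is resolved by gluing
  resolutions of the factors (\<open>pd_less_extension\<close>). After a facet \<open>F\<close> has been attached along \<open>W\<close>, the
  vertices of \<open>F - W\<close> can be deleted one by one. While \<open>v\<close> is deleted, the faces through \<open>v\<close> are
  those of a single simplex \<open>F'\<close> with \<open>W \<subset> F' \<subseteq> F\<close>, and the corresponding factor is the ideal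
  generated by \<open>v\<close> in the face ring, a copy of \<open>k[F']\<close>. That is \<open>S\<close> modulo \<open>n - |F'| < n - w\<close>
  variables, and modulo variables the projective dimension grows by one for each of them
  (\<open>pd_less_simplex\<close>, \<open>pd_less_attach_simplex\<close>).

  Lower bound. Removing the vertices of a smallest \<open>W i\<close> leaves two nonempty sets \<open>A\<close> and \<open>B\<close> of
  vertices without edges between them (\<open>separation\<close>). If \<open>M\<close> has a projective resolution of length
  \<open>d\<close>, then its Koszul cohomology with respect to \<open>s\<close> variables vanishes in degrees below \<open>s - d\<close>,
  since this holds for \<open>d = 0\<close> and the degree drops by one with each syzygy
  (\<open>koszul_vanishes_resolution\<close>). For \<open>k[\<Delta>]\<close> and the \<open>s = n - w\<close> variables of \<open>A \<union> B\<close> the degree one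
  cohomology is nonzero: the cochain that is \<open>x\<^sub>a\<close> at \<open>a \<in> A\<close> and \<open>0\<close> on \<open>B\<close> is a cocycle because
  \<open>x\<^sub>a x\<^sub>b = 0\<close>, while an element \<open>m\<close> with \<open>x\<^sub>a m = x\<^sub>a\<close> and \<open>x\<^sub>b m = 0\<close> would have constant
  coefficient both \<open>1\<close> and \<open>0\<close> (\<open>proj_dim_ge_separated\<close>). So \<open>d \<ge> s - 1\<close>.
\<close>

section \<open>Polynomials without monomials supported on faces\<close>

text \<open>
  For a simplicial complex \<open>\<Gamma>\<close> this is its Stanley-Reisner ideal, as an explicit set. With \<open>\<Gamma> = {}\<close>
  it is the whole polynomial ring in the variables \<open>V\<close>, so that ring and ideals share their lemmas.
\<close>

definition nonface_polys :: "'v set \<Rightarrow> 'v set set \<Rightarrow> ('v, 'k::comm_ring_1) mpoly set" where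
  "nonface_polys V \<Gamma> =
    {p. \<forall>t\<in>Poly_Mapping.keys p. Poly_Mapping.keys t \<subseteq> V \<and> Poly_Mapping.keys t \<notin> \<Gamma>}"

lemma carrier_mpoly_ring: "carrier (mpoly_ring V) = nonface_polys V {}"
  by (simp add: mpoly_ring_def nonface_polys_def)

lemma keys_single_plus:
  "Poly_Mapping.keys (Poly_Mapping.single v (1::nat) + t) = insert v (Poly_Mapping.keys t)"
  by (auto simp: in_keys_iff lookup_add lookup_single when_def split: if_splits)

lemma mpoly_sum_induct [case_names zero monomial sum]:
  fixes p :: "('v, 'k::comm_ring_1) mpoly"
  assumes "P 0" and mono: "\<And>t c. t \<in> Poly_Mapping.keys p \<Longrightarrow> P (Poly_Mapping.single t c)"
    and sum: "\<And>q q'. P q \<Longrightarrow> P q' \<Longrightarrow> P (q + q')"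
  shows "P p"
  using mono
proof (induction p rule: Poly_Mapping.update_induct)
  case const
  show ?case by (rule \<open>P 0\<close>)
next
  case (update f t c)
  have "Poly_Mapping.update t c f = f + Poly_Mapping.single t c"
    using update.hyps by (intro poly_mapping_eqI)
      (auto simp: lookup_update lookup_add lookup_single in_keys_iff)
  moreover have "P f" using update by (intro update.IH) (auto simp: keys_update)
  moreover have "P (Poly_Mapping.single t c)" using update by (auto simp: keys_update)
  ultimately show ?case by (simp add: sum)
qed

text \<open>
  Addition of exponents is cancellative, so multiplying by a monomial merely shifts coefficients.
\<close>

lemma lookup_monomial_times:
  fixes q :: "('v, 'k::comm_ring_1) mpoly"
  shows "Poly_Mapping.lookup (Poly_Mapping.single s 1 * q) t =
    (if \<exists>u. t = s + u then Poly_Mapping.lookup q (t - s) else 0)"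
proof (induction q rule: mpoly_sum_induct)
  case zero
  show ?case by simp
next
  case (monomial u c)
  then show ?case
    by (cases "t = s + u") (auto simp: mult_single lookup_single when_def)
next
  case (sum p q)
  then show ?case by (auto simp: distrib_left lookup_add)
qed

lemma keys_var_times:
  fixes q :: "('v, 'k::comm_ring_1) mpoly"
  shows "Poly_Mapping.keys (var v * q) = (\<lambda>t. Poly_Mapping.single v 1 + t) ` Poly_Mapping.keys q"
  by (auto simp: var_def in_keys_iff lookup_monomial_times image_iff split: if_splits)

text \<open>
  The terms of a polynomial can be sorted by any property of their exponents; this is how membership
  in monomial ideals is decided one monomial at a time.
\<close>

lemma keys_restrict_split:
  fixes p :: "('v, 'k::comm_ring_1) mpoly"
  obtains p1 p2 where "p = p1 + p2" "Poly_Mapping.keys p1 = {t \<in> Poly_Mapping.keys p. P t}"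
    "Poly_Mapping.keys p2 = {t \<in> Poly_Mapping.keys p. \<not> P t}"
proof -
  define f where "f P = Abs_poly_mapping (\<lambda>t. if P t then Poly_Mapping.lookup p t else 0)" for P
  have lookup_f: "Poly_Mapping.lookup (f P) t = (if P t then Poly_Mapping.lookup p t else 0)" for P t
  proof -
    have "finite {t. (if P t then Poly_Mapping.lookup p t else 0) \<noteq> 0}"
      by (rule finite_subset[OF _ finite_keys[of p]]) (auto simp: in_keys_iff split: if_splits)
    then show ?thesis unfolding f_def by (subst lookup_Abs_poly_mapping) auto
  qed
  show thesis
    by (rule that[of "f P" "f (\<lambda>t. \<not> P t)"])
      (auto simp: poly_mapping_eq_iff fun_eq_iff lookup_f lookup_add in_keys_iff split: if_splits)
qed

lemma var_dvd:
  fixes p :: "('v, 'k::comm_ring_1) mpoly"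
  assumes "\<And>t. t \<in> Poly_Mapping.keys p \<Longrightarrow> v \<in> Poly_Mapping.keys t"
  obtains q where "p = var v * q"
proof -
  define e where "e = Poly_Mapping.single v (1::nat)"
  define q where "q = Abs_poly_mapping (\<lambda>t. Poly_Mapping.lookup p (e + t))"
  have "finite {t. Poly_Mapping.lookup p (e + t) \<noteq> 0}"
    using finite_vimageI[OF finite_keys[of p], of "\<lambda>t. e + t"]
    by (simp add: inj_def vimage_def in_keys_iff)
  then have q: "Poly_Mapping.lookup q t = Poly_Mapping.lookup p (e + t)" for t
    unfolding q_def by (subst lookup_Abs_poly_mapping) auto
  have no_e: "Poly_Mapping.lookup p t = 0" if "\<nexists>u. t = e + u" for t
  proof (rule ccontr)
    assume "Poly_Mapping.lookup p t \<noteq> 0"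
    then have "v \<in> Poly_Mapping.keys t" using assms by (simp add: in_keys_iff)
    then have "t = e + (t - e)"
      by (intro poly_mapping_eqI)
        (auto simp: e_def lookup_add lookup_minus lookup_single when_def in_keys_iff)
    with that show False by blast
  qed
  have "p = Poly_Mapping.single e 1 * q"
  proof (rule poly_mapping_eqI)
    fix t show "Poly_Mapping.lookup p t = Poly_Mapping.lookup (Poly_Mapping.single e 1 * q) t"
    proof (cases "\<exists>u. t = e + u")
      case True
      then obtain u where "t = e + u" by blast
      then show ?thesis unfolding lookup_monomial_times q by simp
    next
      case False
      then show ?thesis unfolding lookup_monomial_times using no_e by simp
    qed
  qed
  then have "p = var v * q" by (simp only: var_def e_def)
  then show thesis by (rule that)
qed

lemma nonface_polys_add:
  "p \<in> nonface_polys V \<Gamma> \<Longrightarrow> q \<in> nonface_polys V \<Gamma> \<Longrightarrow> p + q \<in> nonface_polys V \<Gamma>"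
  using keys_add[of p q] unfolding nonface_polys_def by blast

lemma nonface_polys_mult:
  assumes down: "\<And>\<sigma> \<tau>. \<sigma> \<in> \<Gamma> \<Longrightarrow> \<tau> \<subseteq> \<sigma> \<Longrightarrow> \<tau> \<in> \<Gamma>"
    and p: "p \<in> nonface_polys V {}" and q: "q \<in> nonface_polys V \<Gamma>"
  shows "p * q \<in> nonface_polys V \<Gamma>"
  unfolding nonface_polys_def
proof (intro CollectI ballI conjI)
  fix t assume "t \<in> Poly_Mapping.keys (p * q)"
  then obtain a b where ab: "a \<in> Poly_Mapping.keys p" "b \<in> Poly_Mapping.keys q" "t = a + b"
    using keys_mult[of p q] by blast
  have "Poly_Mapping.keys t = Poly_Mapping.keys a \<union> Poly_Mapping.keys b"
    unfolding ab(3) by (auto simp: in_keys_iff lookup_add)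
  moreover have "Poly_Mapping.keys a \<subseteq> V" "Poly_Mapping.keys b \<subseteq> V" "Poly_Mapping.keys b \<notin> \<Gamma>"
    using ab p q by (auto simp: nonface_polys_def)
  ultimately show "Poly_Mapping.keys t \<subseteq> V" "Poly_Mapping.keys t \<notin> \<Gamma>"
    using down[of "Poly_Mapping.keys t" "Poly_Mapping.keys b"] by auto
qed

lemma nonface_polys_basic [simp]: "0 \<in> nonface_polys V \<Gamma>" "1 \<in> nonface_polys V {}"
  "-p \<in> nonface_polys V \<Gamma> \<longleftrightarrow> p \<in> nonface_polys V \<Gamma>"
  by (auto simp: nonface_polys_def)

lemma nonface_polys_diff:
  "p \<in> nonface_polys V \<Gamma> \<Longrightarrow> q \<in> nonface_polys V \<Gamma> \<Longrightarrow> p - q \<in> nonface_polys V \<Gamma>"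
  using nonface_polys_add[of p V \<Gamma> "-q"] by simp

lemma nonface_polys_antimono: "\<Gamma>' \<subseteq> \<Gamma> \<Longrightarrow> nonface_polys V \<Gamma> \<subseteq> nonface_polys V \<Gamma>'"
  unfolding nonface_polys_def by blast

text \<open>
  The colon ideal of \<open>nonface_polys V \<Gamma>\<close> by a variable: multiplication by \<open>v\<close> adds \<open>v\<close> to the support
  of each monomial.
\<close>

lemma var_times_in_nonface_polys:
  assumes "v \<in> V"
  shows "var v * q \<in> nonface_polys V \<Gamma> \<longleftrightarrow>
    (\<forall>t\<in>Poly_Mapping.keys q. Poly_Mapping.keys t \<subseteq> V \<and> insert v (Poly_Mapping.keys t) \<notin> \<Gamma>)"
  using assms by (simp add: nonface_polys_def keys_var_times keys_single_plus del: One_nat_def)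

lemma var_times_in_polysD:
  assumes "var v * q \<in> nonface_polys V {}"
  shows "q \<in> nonface_polys V {}"
proof -
  have "Poly_Mapping.keys t \<subseteq> V" if "t \<in> Poly_Mapping.keys q" for t
  proof -
    have "Poly_Mapping.single v 1 + t \<in> Poly_Mapping.keys (var v * q)" using that by (simp add: keys_var_times)
    then have "insert v (Poly_Mapping.keys t) \<subseteq> V"
      using assms keys_single_plus[of v t] by (auto simp: nonface_polys_def)
    then show ?thesis by simp
  qed
  then show ?thesis by (simp add: nonface_polys_def)
qed

section \<open>Bounding projective dimension by iterated syzygies\<close>

text \<open>
  Modules over a subring \<open>R\<close> are represented as quotients \<open>N / L\<close> of sets of sequences. Sequences
  that vanish from position \<open>k\<close> on form the free module of rank \<open>k\<close>; thus all syzygies live in one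
  type, and induction over them is possible.
\<close>

definition rank_free :: "'a::comm_ring_1 set \<Rightarrow> nat \<Rightarrow> (nat \<Rightarrow> 'a) set" where
  "rank_free R k = {c. (\<forall>j. c j \<in> R) \<and> (\<forall>j\<ge>k. c j = 0)}"

definition lincomb :: "nat \<Rightarrow> (nat \<Rightarrow> nat \<Rightarrow> 'a) \<Rightarrow> (nat \<Rightarrow> 'a) \<Rightarrow> nat \<Rightarrow> 'a::comm_ring_1" where
  "lincomb k g c = (\<lambda>i. \<Sum>j<k. c j * g j i)"

definition fun_scale :: "'a::comm_ring_1 \<Rightarrow> (nat \<Rightarrow> 'a) \<Rightarrow> nat \<Rightarrow> 'a" where
  "fun_scale a f = (\<lambda>i. a * f i)"

text \<open>
  Linearity over the whole ambient ring and on all sequences: the maps between modules that occur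
  below, namely shifts, multiplication by a variable and \<open>lincomb k g\<close>, are restrictions of such maps.
\<close>

definition fun_linear :: "((nat \<Rightarrow> 'a) \<Rightarrow> nat \<Rightarrow> 'a::comm_ring_1) \<Rightarrow> bool" where
  "fun_linear \<phi> \<longleftrightarrow> (\<forall>x y. \<phi> (x + y) = \<phi> x + \<phi> y) \<and> (\<forall>a x. \<phi> (fun_scale a x) = fun_scale a (\<phi> x))"

definition fun_submodule :: "'a::comm_ring_1 set \<Rightarrow> (nat \<Rightarrow> 'a) set \<Rightarrow> bool" where
  "fun_submodule R N \<longleftrightarrow> 0 \<in> N \<and> (\<forall>x\<in>N. \<forall>y\<in>N. x + y \<in> N) \<and> (\<forall>a\<in>R. \<forall>x\<in>N. fun_scale a x \<in> N)"

text \<open>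
  \<open>pd_less R d N L\<close> says that \<open>N / L\<close> has a resolution by \<open>d\<close> finitely generated free modules, i.e.
  one of length \<open>d - 1\<close>. Counting modules instead of the length makes the zero module, with no free
  module at all, the base of every induction.
\<close>

fun pd_less :: "'a::comm_ring_1 set \<Rightarrow> nat \<Rightarrow> (nat \<Rightarrow> 'a) set \<Rightarrow> (nat \<Rightarrow> 'a) set \<Rightarrow> bool" where
  "pd_less R 0 N L \<longleftrightarrow> N \<subseteq> L"
| "pd_less R (Suc d) N L \<longleftrightarrow> (\<exists>k g. (\<forall>j<k. g j \<in> N) \<and>
     (\<forall>y\<in>N. \<exists>c\<in>rank_free R k. y - lincomb k g c \<in> L) \<and>
     pd_less R d {c \<in> rank_free R k. lincomb k g c \<in> L} {0})"

lemma pd_less_SucI: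
  assumes "\<And>j. j < k \<Longrightarrow> g j \<in> N" "\<And>y. y \<in> N \<Longrightarrow> \<exists>c\<in>rank_free R k. y - lincomb k g c \<in> L"
    and "pd_less R d {c \<in> rank_free R k. lincomb k g c \<in> L} {0}"
  shows "pd_less R (Suc d) N L"
  unfolding pd_less.simps(2)
  by (rule exI[of _ k], rule exI[of _ g]) (intro conjI allI impI ballI assms)

locale unital_subring =
  fixes R :: "'a::comm_ring_1 set"
  assumes zero: "0 \<in> R" and one: "1 \<in> R" and minus: "\<And>a. a \<in> R \<Longrightarrow> - a \<in> R"
    and add: "\<And>a b. a \<in> R \<Longrightarrow> b \<in> R \<Longrightarrow> a + b \<in> R" and mult: "\<And>a b. a \<in> R \<Longrightarrow> b \<in> R \<Longrightarrow> a * b \<in> R"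
begin

lemma submodule_minus:
  assumes "fun_submodule R N" "x \<in> N"
  shows "- x \<in> N"
proof -
  have "fun_scale (- 1) x \<in> N" using assms minus[OF one] by (auto simp: fun_submodule_def)
  also have "fun_scale (- 1) x = - x" by (auto simp: fun_scale_def)
  finally show ?thesis .
qed

lemma submodule_diff: "fun_submodule R N \<Longrightarrow> x \<in> N \<Longrightarrow> y \<in> N \<Longrightarrow> x - y \<in> N"
  using submodule_minus[of N y] by (auto simp: fun_submodule_def simp flip: add_uminus_conv_diff)

lemma lincomb_0: "lincomb 0 g c = 0"
  by (auto simp: lincomb_def)

lemma lincomb_Suc: "lincomb (Suc k) g c = lincomb k g c + fun_scale (c k) (g k)"
  by (auto simp: lincomb_def fun_scale_def)

lemma submodule_lincomb:
  assumes N: "fun_submodule R N" and "\<And>j. j < k \<Longrightarrow> g j \<in> N" and c: "\<And>j. c j \<in> R"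
  shows "lincomb k g c \<in> N"
  using assms(2)
proof (induction k)
  case 0
  show ?case using N by (simp only: lincomb_0 fun_submodule_def)
next
  case (Suc k)
  then have "lincomb k g c \<in> N" "fun_scale (c k) (g k) \<in> N"
    using N c by (auto simp: fun_submodule_def)
  then show ?case using N unfolding fun_submodule_def lincomb_Suc by blast
qed

lemma rank_free_submodule: "fun_submodule R (rank_free R k)"
  using zero add mult by (auto simp: fun_submodule_def rank_free_def fun_scale_def)

lemma lincomb_linear: "fun_linear (lincomb k g)"
  by (auto simp: fun_linear_def lincomb_def fun_scale_def sum.distrib sum_distrib_left algebra_simps)

lemma linear_zero: "fun_linear \<phi> \<Longrightarrow> \<phi> 0 = 0"
  unfolding fun_linear_def by (metis add_cancel_left_left)

lemma linear_minus: "fun_linear \<phi> \<Longrightarrow> \<phi> (- x) = - \<phi> x"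
  using linear_zero unfolding fun_linear_def
  by (metis add.right_inverse add_eq_0_iff)

lemma linear_diff: "fun_linear \<phi> \<Longrightarrow> \<phi> (x - y) = \<phi> x - \<phi> y"
  using linear_minus[of \<phi> y] unfolding fun_linear_def by (metis add_uminus_conv_diff)

lemma linear_lincomb:
  assumes "fun_linear \<phi>"
  shows "\<phi> (lincomb k g c) = lincomb k (\<lambda>j. \<phi> (g j)) c"
proof (induction k)
  case 0
  show ?case by (simp only: lincomb_0 linear_zero[OF assms])
next
  case (Suc k)
  then show ?case using assms by (simp only: lincomb_Suc fun_linear_def)
qed

lemma linear_vimage_submodule:
  assumes "fun_linear \<phi>" "fun_submodule R N" "fun_submodule R L"
  shows "fun_submodule R {c \<in> N. \<phi> c \<in> L}"
  using assms linear_zero[OF assms(1)] unfolding fun_submodule_def fun_linear_def by auto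

lemma zero_submodule: "fun_submodule R {0}"
  by (auto simp: fun_submodule_def fun_scale_def)

lemma lincomb_zero: "lincomb k g 0 = 0"
  by (auto simp: lincomb_def)

lemma lincomb_cong_mod:
  assumes L: "fun_submodule R L" and gh: "\<And>j. j < k \<Longrightarrow> g j - h j \<in> L" and c: "\<And>j. c j \<in> R"
  shows "lincomb k g c \<in> L \<longleftrightarrow> lincomb k h c \<in> L"
proof -
  have "lincomb k (\<lambda>j. g j - h j) c \<in> L" by (rule submodule_lincomb) (use assms in auto)
  also have "lincomb k (\<lambda>j. g j - h j) c = lincomb k g c - lincomb k h c"
    by (auto simp: lincomb_def sum_subtractf algebra_simps)
  finally have *: "lincomb k g c - lincomb k h c \<in> L" .
  show ?thesis
  proof
    assume "lincomb k g c \<in> L"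
    from submodule_diff[OF L this *] show "lincomb k h c \<in> L" by simp
  next
    assume "lincomb k h c \<in> L"
    then have "(lincomb k g c - lincomb k h c) + lincomb k h c \<in> L"
      using L * unfolding fun_submodule_def by blast
    then show "lincomb k g c \<in> L" by simp
  qed
qed

text \<open>
  Together with the converse \<open>pd_less_pull\<close> this is invariance under isomorphism: the hypotheses say
  that \<open>\<phi>\<close> induces an isomorphism \<open>N / L \<rightarrow> N' / L'\<close>. Images of generators have the same syzygies as
  the generators, so the remaining part of the resolution can be kept unchanged.
\<close>

lemma pd_less_push:
  assumes \<phi>: "fun_linear \<phi>" and N: "fun_submodule R N" and L': "fun_submodule R L'"
    and into: "\<And>y. y \<in> N \<Longrightarrow> \<phi> y \<in> N'"
    and onto: "\<And>z. z \<in> N' \<Longrightarrow> \<exists>y\<in>N. z - \<phi> y \<in> L'"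
    and inj: "\<And>y. y \<in> N \<Longrightarrow> \<phi> y \<in> L' \<longleftrightarrow> y \<in> L"
    and pd: "pd_less R d N L"
  shows "pd_less R d N' L'"
proof (cases d)
  case 0
  have "z \<in> L'" if z: "z \<in> N'" for z
  proof -
    obtain y where y: "y \<in> N" "z - \<phi> y \<in> L'" using onto z by blast
    then have "\<phi> y \<in> L'" using inj pd 0 by auto
    then have "(z - \<phi> y) + \<phi> y \<in> L'" using L' y unfolding fun_submodule_def by blast
    then show ?thesis by simp
  qed
  then show ?thesis using 0 by auto
next
  case (Suc d')
  then obtain k g where g: "\<And>j. j < k \<Longrightarrow> g j \<in> N"
    and gen: "\<And>y. y \<in> N \<Longrightarrow> \<exists>c\<in>rank_free R k. y - lincomb k g c \<in> L"
    and syz: "pd_less R d' {c \<in> rank_free R k. lincomb k g c \<in> L} {0}"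
    using pd unfolding Suc pd_less.simps by blast
  have lin: "lincomb k g c \<in> N" if "c \<in> rank_free R k" for c
    by (rule submodule_lincomb[OF N]) (use g that in \<open>auto simp: rank_free_def\<close>)
  have "\<exists>c\<in>rank_free R k. z - lincomb k (\<lambda>j. \<phi> (g j)) c \<in> L'" if z: "z \<in> N'" for z
  proof -
    obtain y where y: "y \<in> N" "z - \<phi> y \<in> L'" using onto z by blast
    obtain c where c: "c \<in> rank_free R k" "y - lincomb k g c \<in> L" using gen y by blast
    have "\<phi> (y - lincomb k g c) \<in> L'" using inj submodule_diff[OF N y(1) lin] c by auto
    then have "(z - \<phi> y) + \<phi> (y - lincomb k g c) \<in> L'" using L' y unfolding fun_submodule_def by blast
    then show ?thesis using c by (auto simp: linear_diff[OF \<phi>] linear_lincomb[OF \<phi>])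
  qed
  moreover have "{c \<in> rank_free R k. lincomb k (\<lambda>j. \<phi> (g j)) c \<in> L'} = {c \<in> rank_free R k. lincomb k g c \<in> L}"
    using inj lin by (auto simp flip: linear_lincomb[OF \<phi>])
  ultimately show ?thesis unfolding Suc pd_less.simps
    using g into syz by (intro exI[of _ k] exI[of _ "\<lambda>j. \<phi> (g j)"]) auto
qed

text \<open>
  Generators of \<open>N'\<close> are lifted to \<open>N\<close> modulo \<open>L'\<close>, which again does not change their syzygies.
\<close>

lemma pd_less_pull:
  assumes \<phi>: "fun_linear \<phi>" and N: "fun_submodule R N" and L': "fun_submodule R L'"
    and into: "\<And>y. y \<in> N \<Longrightarrow> \<phi> y \<in> N'"
    and onto: "\<And>z. z \<in> N' \<Longrightarrow> \<exists>y\<in>N. z - \<phi> y \<in> L'"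
    and inj: "\<And>y. y \<in> N \<Longrightarrow> \<phi> y \<in> L' \<longleftrightarrow> y \<in> L"
    and pd: "pd_less R d N' L'"
  shows "pd_less R d N L"
proof (cases d)
  case 0
  then show ?thesis using pd into inj by auto
next
  case (Suc d')
  then obtain k g' where g': "\<And>j. j < k \<Longrightarrow> g' j \<in> N'"
    and gen: "\<And>y. y \<in> N' \<Longrightarrow> \<exists>c\<in>rank_free R k. y - lincomb k g' c \<in> L'"
    and syz: "pd_less R d' {c \<in> rank_free R k. lincomb k g' c \<in> L'} {0}"
    using pd unfolding Suc pd_less.simps by blast
  have "\<exists>y\<in>N. j < k \<longrightarrow> g' j - \<phi> y \<in> L'" for j
    using onto[OF g', of j] N unfolding fun_submodule_def by blast
  then obtain g where g: "\<And>j. g j \<in> N" "\<And>j. j < k \<Longrightarrow> g' j - \<phi> (g j) \<in> L'" by metis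
  have lin: "lincomb k g c \<in> N" if "c \<in> rank_free R k" for c
    by (rule submodule_lincomb[OF N]) (use g that in \<open>auto simp: rank_free_def\<close>)
  have mem: "lincomb k g c \<in> L \<longleftrightarrow> lincomb k g' c \<in> L'" if c: "c \<in> rank_free R k" for c
    using lincomb_cong_mod[OF L', of k g' "\<lambda>j. \<phi> (g j)" c] g c inj[OF lin[OF c]]
    by (auto simp: linear_lincomb[OF \<phi>] rank_free_def)
  have "\<exists>c\<in>rank_free R k. y - lincomb k g c \<in> L" if y: "y \<in> N" for y
  proof -
    obtain c where c: "c \<in> rank_free R k" "\<phi> y - lincomb k g' c \<in> L'" using gen into y by blast
    have "lincomb k (\<lambda>j. g' j - \<phi> (g j)) c \<in> L'"
      by (rule submodule_lincomb[OF L']) (use g c in \<open>auto simp: rank_free_def\<close>)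
    then have "(\<phi> y - lincomb k g' c) + lincomb k (\<lambda>j. g' j - \<phi> (g j)) c \<in> L'"
      using L' c unfolding fun_submodule_def by blast
    also have "(\<phi> y - lincomb k g' c) + lincomb k (\<lambda>j. g' j - \<phi> (g j)) c = \<phi> (y - lincomb k g c)"
      unfolding linear_diff[OF \<phi>] linear_lincomb[OF \<phi>]
      by (auto simp: lincomb_def sum_subtractf algebra_simps)
    finally show ?thesis using c inj submodule_diff[OF N y lin] by blast
  qed
  moreover have "{c \<in> rank_free R k. lincomb k g c \<in> L} = {c \<in> rank_free R k. lincomb k g' c \<in> L'}"
    using mem by auto
  ultimately show ?thesis unfolding Suc pd_less.simps using g syz by (intro exI[of _ k] exI[of _ g]) auto
qed

text \<open>
  The horseshoe lemma. Generators of \<open>N / L\<close> are listed before lifts of generators of \<open>Q / N\<close>. The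
  syzygies with only zeros in the second block are those of \<open>N / L\<close>, and forgetting the first block
  maps onto the syzygies of \<open>Q / N\<close>; so the module of syzygies is again an extension.
\<close>

lemma pd_less_extension:
  assumes "fun_submodule R L" "fun_submodule R N" "fun_submodule R Q" "L \<subseteq> N" "N \<subseteq> Q"
    and "pd_less R d N L" "pd_less R d Q N"
  shows "pd_less R d Q L"
  using assms
proof (induction d arbitrary: L N Q)
  case 0
  then show ?case by auto
next
  case (Suc d)
  note L = Suc.prems(1) and N = Suc.prems(2) and Q = Suc.prems(3)
  obtain k g where g: "\<And>j. j < k \<Longrightarrow> g j \<in> N"
    and gen: "\<And>y. y \<in> N \<Longrightarrow> \<exists>c\<in>rank_free R k. y - lincomb k g c \<in> L"
    and syz: "pd_less R d {c \<in> rank_free R k. lincomb k g c \<in> L} {0}"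
    using Suc.prems(6) unfolding pd_less.simps by blast
  obtain l h where h: "\<And>j. j < l \<Longrightarrow> h j \<in> Q"
    and hgen: "\<And>y. y \<in> Q \<Longrightarrow> \<exists>c\<in>rank_free R l. y - lincomb l h c \<in> N"
    and hsyz: "pd_less R d {c \<in> rank_free R l. lincomb l h c \<in> N} {0}"
    using Suc.prems(7) unfolding pd_less.simps by blast
  \<comment> \<open>Coefficient vectors of length \<open>k + l\<close> are pairs of vectors of length \<open>k\<close> and \<open>l\<close>.\<close>
  define f where "f j = (if j < k then g j else h (j - k))" for j
  define tl where "tl c = (\<lambda>j. c (j + k))" for c :: "nat \<Rightarrow> 'a"
  define cat where "cat c c' = (\<lambda>j. if j < k then c j else c' (j - k))" for c c' :: "nat \<Rightarrow> 'a"
  have split: "lincomb (k + l) f c = lincomb k g c + lincomb l h (tl c)" for c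
  proof -
    have "(\<Sum>j<k+l. c j * f j i) = (\<Sum>j<k. c j * f j i) + (\<Sum>j<l. c (j + k) * f (j + k) i)" for i
      using sum.atLeastLessThan_concat[of 0 k "k + l" "\<lambda>j. c j * f j i"]
        sum.shift_bounds_nat_ivl[of "\<lambda>j. c j * f j i" 0 k l]
      by (simp add: lessThan_atLeast0 add.commute)
    then show ?thesis by (auto simp: lincomb_def f_def tl_def)
  qed
  have cat: "cat c c' \<in> rank_free R (k + l)" "tl (cat c c') = c'" "lincomb k g (cat c c') = lincomb k g c"
    if "c \<in> rank_free R k" "c' \<in> rank_free R l" for c c'
    using that by (auto simp: cat_def tl_def rank_free_def lincomb_def)
  have tl_free: "tl c \<in> rank_free R l" if "c \<in> rank_free R (k + l)" for c
    using that by (auto simp: tl_def rank_free_def)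
  have linN: "lincomb k g c \<in> N" if "\<And>j. c j \<in> R" for c
    by (rule submodule_lincomb[OF N]) (use g that in auto)
  define Z where "Z = {c \<in> rank_free R (k + l). lincomb (k + l) f c \<in> L}"
  define Z1 where "Z1 = {c \<in> rank_free R k. lincomb k g c \<in> L}"
  define Z2 where "Z2 = {c \<in> rank_free R l. lincomb l h c \<in> N}"
  have subs: "fun_submodule R Z" "fun_submodule R Z1" "fun_submodule R Z2"
    unfolding Z_def Z1_def Z2_def
    by (intro linear_vimage_submodule lincomb_linear rank_free_submodule L N)+
  have tl_lin: "fun_linear tl" by (auto simp: fun_linear_def tl_def fun_scale_def)
  have Z1: "c \<in> Z \<and> tl c = 0 \<longleftrightarrow> c \<in> Z1" for c
  proof -
    have "tl c = 0 \<longleftrightarrow> (\<forall>j. c (j + k) = 0)"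
      by (auto simp: tl_def fun_eq_iff)
    also have "\<dots> \<longleftrightarrow> (\<forall>j\<ge>k. c j = 0)"
      by (metis le_add2 le_add_diff_inverse2)
    finally have tl0: "tl c = 0 \<longleftrightarrow> (\<forall>j\<ge>k. c j = 0)" .
    have "lincomb (k + l) f c = lincomb k g c" if "tl c = 0"
      using that by (simp add: split lincomb_zero)
    then show ?thesis
      unfolding Z_def Z1_def using tl0 by (auto simp: rank_free_def)
  qed
  have into: "tl c \<in> Z2" if "c \<in> Z" for c
  proof -
    have "lincomb k g c + lincomb l h (tl c) \<in> N" using that Suc.prems(4) by (auto simp: Z_def split)
    moreover have "lincomb k g c \<in> N" using that linN by (auto simp: Z_def rank_free_def)
    ultimately have "lincomb k g c + lincomb l h (tl c) - lincomb k g c \<in> N"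
      by (rule submodule_diff[OF N])
    then have "lincomb l h (tl c) \<in> N" by (simp only: add_diff_cancel_left')
    then show ?thesis using that tl_free by (simp add: Z_def Z2_def)
  qed
  have onto: "\<exists>y\<in>Z. z - tl y \<in> {0}" if z: "z \<in> Z2" for z
  proof -
    have "- lincomb l h z \<in> N" using z submodule_minus[OF N] by (auto simp: Z2_def)
    then obtain c where c: "c \<in> rank_free R k" "- lincomb l h z - lincomb k g c \<in> L" using gen by blast
    have "- (- lincomb l h z - lincomb k g c) \<in> L" using submodule_minus[OF L c(2)] .
    then have "cat c z \<in> Z" using cat[OF c(1), of z] z by (auto simp: Z_def Z2_def split algebra_simps)
    moreover have "z - tl (cat c z) \<in> {0}" using cat(2)[OF c(1), of z] z by (simp add: Z2_def)
    ultimately show ?thesis by blast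
  qed
  have inj: "tl c \<in> {0} \<longleftrightarrow> c \<in> Z1" if "c \<in> Z" for c
    using Z1[of c] that by simp
  have "pd_less R d Z Z1"
    by (rule pd_less_pull[OF tl_lin subs(1) zero_submodule into onto inj hsyz[folded Z2_def]])
  moreover have "{0} \<subseteq> Z1" using subs(2) by (simp add: fun_submodule_def)
  moreover have "Z1 \<subseteq> Z" using Z1 by blast
  ultimately have Z: "pd_less R d Z {0}"
    using Suc.IH[OF zero_submodule subs(2,1) _ _ syz[folded Z1_def]] by blast
  have fgen: "\<exists>c\<in>rank_free R (k + l). y - lincomb (k + l) f c \<in> L" if y: "y \<in> Q" for y
  proof -
    obtain c' where c': "c' \<in> rank_free R l" "y - lincomb l h c' \<in> N" using hgen y by blast
    obtain c where c: "c \<in> rank_free R k" "y - lincomb l h c' - lincomb k g c \<in> L" using gen c' by blast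
    have "y - lincomb (k + l) f (cat c c') \<in> L"
      using c(2) by (simp only: split cat(2,3)[OF c(1) c'(1)]) (simp only: diff_diff_eq add.commute)
    then show ?thesis using cat(1)[OF c(1) c'(1)] by blast
  qed
  have f: "f j \<in> Q" if "j < k + l" for j
    using g h that Suc.prems(5) by (auto simp: f_def)
  show ?case by (rule pd_less_SucI[OF f fgen Z[unfolded Z_def]])
qed

lemma pd_less_Suc:
  assumes "fun_submodule R L" "pd_less R d N L"
  shows "pd_less R (Suc d) N L"
  using assms
proof (induction d arbitrary: N L)
  case 0
  have "lincomb 0 g c = 0" for g and c :: "nat \<Rightarrow> 'a" by (auto simp: lincomb_def)
  then show ?case using 0 zero
    by (auto intro!: exI[of _ 0] bexI[of _ 0] simp: rank_free_def fun_submodule_def)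
next
  case (Suc d)
  obtain k g where g: "\<forall>j<k. g j \<in> N" "\<forall>y\<in>N. \<exists>c\<in>rank_free R k. y - lincomb k g c \<in> L"
    and syz: "pd_less R d {c \<in> rank_free R k. lincomb k g c \<in> L} {0}"
    using Suc.prems(2) unfolding pd_less.simps(2) by blast
  show ?case by (rule pd_less_SucI[OF _ _ Suc.IH[OF zero_submodule syz]]) (use g in auto)
qed

lemma pd_less_mono:
  assumes "fun_submodule R L" "pd_less R d N L" "d \<le> e"
  shows "pd_less R e N L"
  using assms(3,2) by (induction rule: dec_induct) (use pd_less_Suc[OF assms(1)] in auto)

text \<open>
  A quotient needs one step more than the submodule that is divided out: the generators of \<open>N / L\<close>
  also generate \<open>N / L'\<close>, and their syzygies over \<open>L'\<close> are an extension of \<open>L' / L\<close> by those over \<open>L\<close>.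
\<close>

lemma pd_less_quotient:
  assumes L: "fun_submodule R L" and L': "fun_submodule R L'" and N: "fun_submodule R N"
    and sub: "L \<subseteq> L'" "L' \<subseteq> N" and pdN: "pd_less R (Suc d) N L" and pdL: "pd_less R d L' L"
  shows "pd_less R (Suc d) N L'"
proof -
  obtain k g where g: "\<And>j. j < k \<Longrightarrow> g j \<in> N"
    and gen: "\<And>y. y \<in> N \<Longrightarrow> \<exists>c\<in>rank_free R k. y - lincomb k g c \<in> L"
    and syz: "pd_less R d {c \<in> rank_free R k. lincomb k g c \<in> L} {0}"
    using pdN unfolding pd_less.simps by blast
  define Z where "Z = {c \<in> rank_free R k. lincomb k g c \<in> L}"
  define Z' where "Z' = {c \<in> rank_free R k. lincomb k g c \<in> L'}"
  have subs: "fun_submodule R Z" "fun_submodule R Z'"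
    unfolding Z_def Z'_def
    by (intro linear_vimage_submodule lincomb_linear rank_free_submodule L L')+
  have onto: "\<exists>c\<in>Z'. z - lincomb k g c \<in> L" if z: "z \<in> L'" for z
  proof -
    obtain c where c: "c \<in> rank_free R k" "z - lincomb k g c \<in> L" using gen z sub by blast
    have "z - (z - lincomb k g c) \<in> L'" using submodule_diff[OF L' z] c sub by blast
    then show ?thesis using c by (auto simp: Z'_def)
  qed
  have "pd_less R d Z' Z"
    by (rule pd_less_pull[OF lincomb_linear subs(2) L _ onto _ pdL]) (auto simp: Z_def Z'_def)
  then have "pd_less R d Z' {0}"
    using pd_less_extension[OF zero_submodule subs _ _ syz[folded Z_def]] sub subs
    by (auto simp: Z_def Z'_def fun_submodule_def)
  then show ?thesis
    unfolding Z'_def by (rule pd_less_SucI[rotated 2]) (use g gen sub in blast)+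
qed

lemma pd_less_one_free:
  shows "pd_less R 1 {\<lambda>_. a |a. a \<in> R} {0}"
proof -
  define g where "g j = (\<lambda>_::nat. 1::'a)" for j :: nat
  have lin: "lincomb 1 g c = (\<lambda>_. c 0)" for c :: "nat \<Rightarrow> 'a" by (auto simp: lincomb_def g_def)
  have syz: "{c \<in> rank_free R 1. lincomb 1 g c \<in> {0}} \<subseteq> {0}"
  proof
    fix c assume "c \<in> {c \<in> rank_free R 1. lincomb 1 g c \<in> {0}}"
    then have c: "c \<in> rank_free R 1" "lincomb 1 g c = 0" by auto
    have "c j = 0 j" for j
      using c(1) fun_cong[OF c(2)[unfolded lin], of 0] by (cases j) (auto simp: rank_free_def)
    then show "c \<in> {0}" by (simp add: fun_eq_iff)
  qed
  have gen: "\<exists>c\<in>rank_free R 1. y - lincomb 1 g c \<in> {0}" if y: "y \<in> {\<lambda>_. a |a. a \<in> R}" for y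
  proof -
    obtain a where a: "y = (\<lambda>_. a)" "a \<in> R" using y by blast
    have "(\<lambda>j. if j = 0 then a else 0) \<in> rank_free R 1" using a zero by (auto simp: rank_free_def)
    moreover have "y - lincomb 1 g (\<lambda>j. if j = 0 then a else 0) \<in> {0}"
      unfolding lin by (simp add: a fun_eq_iff)
    ultimately show ?thesis by blast
  qed
  have "g j \<in> {\<lambda>_. a |a. a \<in> R}" for j using one by (auto simp: g_def)
  then show ?thesis
    unfolding One_nat_def
    by (rule pd_less_SucI[OF _ gen[unfolded One_nat_def]]) (use syz in simp_all)
qed

end

section \<open>Filtrations of face rings\<close>

text \<open>
  Ideals enter the world of sequences as sets of constant sequences.
\<close>

definition const_seqs :: "'a set \<Rightarrow> (nat \<Rightarrow> 'a) set" where
  "const_seqs J = {\<lambda>_. a |a. a \<in> J}"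

lemma const_seqs_mem [simp]: "(\<lambda>_. a) \<in> const_seqs J \<longleftrightarrow> a \<in> J"
  by (auto simp: const_seqs_def fun_eq_iff)

lemma const_seqsE:
  assumes "f \<in> const_seqs J"
  obtains a where "f = (\<lambda>_. a)" "a \<in> J"
  using assms by (auto simp: const_seqs_def)

lemma const_seqs_mono: "J \<subseteq> J' \<Longrightarrow> const_seqs J \<subseteq> const_seqs J'"
  by (auto simp: const_seqs_def)

lemma unital_subring_polys: "unital_subring (nonface_polys V {})"
  by unfold_locales (auto intro: nonface_polys_add nonface_polys_mult)

definition down_closed :: "'v set set \<Rightarrow> bool" where
  "down_closed \<Gamma> \<longleftrightarrow> (\<forall>\<sigma>\<in>\<Gamma>. \<forall>\<tau>. \<tau> \<subseteq> \<sigma> \<longrightarrow> \<tau> \<in> \<Gamma>)"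

lemma down_closedD: "down_closed \<Gamma> \<Longrightarrow> \<sigma> \<in> \<Gamma> \<Longrightarrow> \<tau> \<subseteq> \<sigma> \<Longrightarrow> \<tau> \<in> \<Gamma>"
  by (auto simp: down_closed_def)

lemma const_seqs_submodule:
  assumes "down_closed \<Gamma>"
  shows "fun_submodule (nonface_polys V {}) (const_seqs (nonface_polys V \<Gamma>))"
proof -
  have "f + g \<in> const_seqs (nonface_polys V \<Gamma>)"
    if fg: "f \<in> const_seqs (nonface_polys V \<Gamma>)" "g \<in> const_seqs (nonface_polys V \<Gamma>)"
    for f g :: "nat \<Rightarrow> ('a, 'b) mpoly"
  proof -
    obtain p q where "f = (\<lambda>_. p)" "g = (\<lambda>_. q)" "p \<in> nonface_polys V \<Gamma>" "q \<in> nonface_polys V \<Gamma>"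
      using fg by (elim const_seqsE)
    then show ?thesis using nonface_polys_add[of p V \<Gamma> q] by (simp add: plus_fun_def)
  qed
  moreover have "fun_scale a f \<in> const_seqs (nonface_polys V \<Gamma>)"
    if "a \<in> nonface_polys V {}" "f \<in> const_seqs (nonface_polys V \<Gamma>)"
    for a and f :: "nat \<Rightarrow> ('a, 'b) mpoly"
    using that(2) nonface_polys_mult[OF down_closedD[OF assms] that(1)]
    by (elim const_seqsE) (simp add: fun_scale_def)
  moreover have "0 \<in> const_seqs (nonface_polys V \<Gamma>)" by (simp add: zero_fun_def)
  ultimately show ?thesis unfolding fun_submodule_def by blast
qed

text \<open>
  Hypothesis \<open>star\<close> says that the star of \<open>v\<close> in \<open>\<Gamma>\<close> is the simplex on \<open>F\<close>. The polynomials that vanish in the face ring after deletion of \<open>v\<close> are then, modulo those that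
  vanish in the face ring of \<open>\<Gamma>\<close>, the multiples of the variable \<open>v\<close>, and multiplication by \<open>v\<close> has
  kernel generated by the variables outside \<open>F\<close>. Hence this factor of the filtration is isomorphic to
  the face ring of \<open>F\<close>.
\<close>

lemma pd_less_star:
  fixes V :: "'v set" and \<Gamma> :: "'v set set"
  defines "R \<equiv> nonface_polys V {} :: ('v, 'k::comm_ring_1) mpoly set"
  assumes v: "v \<in> F" "F \<subseteq> V" and \<Gamma>: "down_closed \<Gamma>"
    and star: "\<And>\<sigma>. \<sigma> \<subseteq> V \<Longrightarrow> insert v \<sigma> \<in> \<Gamma> \<longleftrightarrow> \<sigma> \<subseteq> F"
    and pd: "pd_less R d (const_seqs R) (const_seqs (nonface_polys V (Pow F)))"
  shows "pd_less R d (const_seqs (nonface_polys V {\<sigma> \<in> \<Gamma>. v \<notin> \<sigma>})) (const_seqs (nonface_polys V \<Gamma>))"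
proof -
  interpret unital_subring R unfolding R_def by (rule unital_subring_polys)
  define \<phi> where "\<phi> f = (\<lambda>i. var v * f i)" for f :: "nat \<Rightarrow> ('v, 'k) mpoly"
  have vV: "v \<in> V" using v by auto
  have \<phi>: "fun_linear \<phi>"
    by (auto simp: fun_linear_def \<phi>_def fun_scale_def algebra_simps fun_eq_iff)
  have R: "fun_submodule R (const_seqs R)"
    unfolding R_def by (rule const_seqs_submodule) (simp add: down_closed_def)
  have L': "fun_submodule R (const_seqs (nonface_polys V \<Gamma>))"
    unfolding R_def by (rule const_seqs_submodule[OF \<Gamma>])
  have into: "\<phi> f \<in> const_seqs (nonface_polys V {\<sigma> \<in> \<Gamma>. v \<notin> \<sigma>})" if f: "f \<in> const_seqs R" for f
  proof -
    obtain a where "f = (\<lambda>_. a)" "a \<in> R" using f by (rule const_seqsE)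
    moreover from this have "var v * a \<in> nonface_polys V {\<sigma> \<in> \<Gamma>. v \<notin> \<sigma>}"
      unfolding var_times_in_nonface_polys[OF vV] by (simp add: R_def nonface_polys_def)
    ultimately show ?thesis by (simp add: \<phi>_def)
  qed
  have inj: "\<phi> f \<in> const_seqs (nonface_polys V \<Gamma>) \<longleftrightarrow> f \<in> const_seqs (nonface_polys V (Pow F))"
    if f: "f \<in> const_seqs R" for f
  proof -
    obtain a where a: "f = (\<lambda>_. a)" "a \<in> R" using f by (rule const_seqsE)
    have "var v * a \<in> nonface_polys V \<Gamma> \<longleftrightarrow> a \<in> nonface_polys V (Pow F)"
      unfolding var_times_in_nonface_polys[OF vV]
      using a(2) star by (simp add: R_def nonface_polys_def)
    then show ?thesis by (simp add: \<phi>_def a(1))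
  qed
  have onto: "\<exists>f\<in>const_seqs R. z - \<phi> f \<in> const_seqs (nonface_polys V \<Gamma>)"
    if "z \<in> const_seqs (nonface_polys V {\<sigma> \<in> \<Gamma>. v \<notin> \<sigma>})" for z
  proof -
    obtain y where y: "z = (\<lambda>_. y)" "y \<in> nonface_polys V {\<sigma> \<in> \<Gamma>. v \<notin> \<sigma>}"
      using \<open>z \<in> _\<close> by (rule const_seqsE)
    obtain y1 y2 where split: "y = y1 + y2"
      "Poly_Mapping.keys y1 = {t \<in> Poly_Mapping.keys y. Poly_Mapping.keys t \<in> \<Gamma>}"
      "Poly_Mapping.keys y2 = {t \<in> Poly_Mapping.keys y. Poly_Mapping.keys t \<notin> \<Gamma>}"
      by (rule keys_restrict_split)
    have "v \<in> Poly_Mapping.keys t" if "t \<in> Poly_Mapping.keys y1" for t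
      using that split(2) y(2) by (auto simp: nonface_polys_def)
    then obtain q where q: "y1 = var v * q" by (rule var_dvd)
    have "var v * q \<in> nonface_polys V {}" using split(2) y(2) q by (auto simp: nonface_polys_def)
    then have "q \<in> R" unfolding R_def by (rule var_times_in_polysD)
    moreover have "y2 \<in> nonface_polys V \<Gamma>" using split(3) y(2) by (auto simp: nonface_polys_def)
    moreover have "z - \<phi> (\<lambda>_. q) = (\<lambda>_. y2)" by (auto simp: y(1) \<phi>_def split(1) q)
    ultimately show ?thesis by (intro bexI[of _ "\<lambda>_. q"]) simp_all
  qed
  show ?thesis by (rule pd_less_push[OF \<phi> R L' into onto inj pd])
qed

text \<open>
  The face ring of a simplex is the polynomial ring modulo the variables outside it. Dividing out one
  more variable is a quotient by a submodule that is isomorphic to the module itself, since that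
  variable is not a zero divisor; this is \<open>pd_less_star\<close> for a full simplex.
\<close>

lemma pd_less_simplex:
  fixes V :: "'v set"
  defines "R \<equiv> nonface_polys V {} :: ('v, 'k::comm_ring_1) mpoly set"
  assumes V: "finite V" and F: "F \<subseteq> V"
  shows "pd_less R (Suc (card V - card F)) (const_seqs R) (const_seqs (nonface_polys V (Pow F)))"
proof -
  interpret unital_subring R unfolding R_def by (rule unital_subring_polys)
  have sub: "fun_submodule R (const_seqs (nonface_polys V \<Gamma>))" if "down_closed \<Gamma>" for \<Gamma>
    unfolding R_def by (rule const_seqs_submodule[OF that])
  have dc: "down_closed (Pow X)" "down_closed {}" for X :: "'v set" by (auto simp: down_closed_def)
  have "pd_less R (Suc (card U)) (const_seqs R) (const_seqs (nonface_polys V (Pow (V - U))))"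
    if "finite U" "U \<subseteq> V" for U
    using that
  proof (induction rule: finite_induct)
    case empty
    have "nonface_polys V (Pow V) = ({0} :: ('v, 'k) mpoly set)"
    proof -
      have "p = 0" if "p \<in> nonface_polys V (Pow V)" for p :: "('v, 'k) mpoly"
        using that by (subst keys_eq_empty[symmetric]) (auto simp: nonface_polys_def)
      then show ?thesis by auto
    qed
    moreover have "const_seqs {0} = ({0} :: (nat \<Rightarrow> ('v, 'k) mpoly) set)"
      by (auto simp: const_seqs_def zero_fun_def)
    ultimately show ?case using pd_less_one_free by (simp add: const_seqs_def)
  next
    case (insert v U)
    have eq: "{\<sigma> \<in> Pow (V - U). v \<notin> \<sigma>} = Pow (V - insert v U)" by auto
    have IH: "pd_less R (Suc (card U)) (const_seqs R) (const_seqs (nonface_polys V (Pow (V - U))))"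
      using insert by simp
    \<comment> \<open>In the full simplex on \<open>V - U\<close> the star of \<open>v\<close> is everything, and its deletion is \<open>V - insert v U\<close>.\<close>
    have "pd_less R (Suc (card U)) (const_seqs (nonface_polys V (Pow (V - insert v U))))
        (const_seqs (nonface_polys V (Pow (V - U))))"
      using pd_less_star[of v "V - U" V "Pow (V - U)" "Suc (card U)"] IH insert dc(1)
      unfolding eq R_def by auto
    moreover have "const_seqs (nonface_polys V (Pow (V - U))) \<subseteq> const_seqs (nonface_polys V (Pow (V - insert v U)))"
      by (intro const_seqs_mono nonface_polys_antimono) auto
    moreover have "const_seqs (nonface_polys V (Pow (V - insert v U))) \<subseteq> const_seqs R"
      unfolding R_def by (intro const_seqs_mono nonface_polys_antimono) auto
    moreover have "fun_submodule R (const_seqs R)" using sub[OF dc(2)] by (simp add: R_def)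
    moreover have "pd_less R (Suc (Suc (card U))) (const_seqs R) (const_seqs (nonface_polys V (Pow (V - U))))"
      using pd_less_Suc[OF sub[OF dc(1)] IH] .
    ultimately have "pd_less R (Suc (Suc (card U))) (const_seqs R)
        (const_seqs (nonface_polys V (Pow (V - insert v U))))"
      using pd_less_quotient[OF sub[OF dc(1)] sub[OF dc(1)]] by blast
    then show ?case using insert by simp
  qed
  from this[of "V - F"] show ?thesis
    using V F by (simp add: double_diff card_Diff_subset finite_subset[OF F V])
qed

text \<open>
  The vertices of \<open>F - W\<close> are adjoined to \<open>W\<close> one at a time. Each step adds the star of the new vertex,
  a simplex with more vertices than \<open>W\<close>, so its face ring obeys the bound \<open>d\<close>.
\<close>

lemma pd_less_attach_simplex:
  fixes V :: "'v set" and \<Gamma> :: "'v set set"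
  defines "R \<equiv> nonface_polys V {} :: ('v, 'k::comm_ring_1) mpoly set"
  assumes V: "finite V" and F: "F \<subseteq> V" and \<Gamma>: "down_closed \<Gamma>" and W: "\<Gamma> \<inter> Pow F = Pow W"
    and d: "card V - card W \<le> d"
    and pd: "pd_less R d (const_seqs R) (const_seqs (nonface_polys V \<Gamma>))"
  shows "pd_less R d (const_seqs R) (const_seqs (nonface_polys V (\<Gamma> \<union> Pow F)))"
proof -
  interpret unital_subring R unfolding R_def by (rule unital_subring_polys)
  have sub: "fun_submodule R (const_seqs (nonface_polys V \<Gamma>))" if "down_closed \<Gamma>" for \<Gamma>
    unfolding R_def by (rule const_seqs_submodule[OF that])
  have WF: "W \<subseteq> F" using W by auto
  have dc: "down_closed (\<Gamma> \<union> Pow X)" "down_closed (Pow X)" "down_closed {}" for X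
    using \<Gamma> unfolding down_closed_def by blast+
  have "pd_less R d (const_seqs R) (const_seqs (nonface_polys V (\<Gamma> \<union> Pow (W \<union> X))))"
    if "finite X" "X \<subseteq> F - W" for X
    using that
  proof (induction rule: finite_induct)
    case empty
    have "\<Gamma> \<union> Pow (W \<union> {}) = \<Gamma>" using W by auto
    then show ?case using pd by simp
  next
    case (insert v X)
    define F' where "F' = W \<union> insert v X"
    have F': "F' \<subseteq> V" "v \<in> F'" using insert WF F by (auto simp: F'_def)
    have v: "\<sigma> \<notin> \<Gamma>" if "v \<in> \<sigma>" for \<sigma>
    proof
      assume "\<sigma> \<in> \<Gamma>"
      then have "{v} \<in> \<Gamma> \<inter> Pow F" using that insert down_closedD[OF \<Gamma>, of \<sigma> "{v}"] by auto
      then show False using insert by (simp add: W)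
    qed
    have eq: "{\<sigma> \<in> \<Gamma> \<union> Pow F'. v \<notin> \<sigma>} = \<Gamma> \<union> Pow (W \<union> X)"
      using v insert by (auto simp: F'_def)
    have "card W < card F'"
      by (rule psubset_card_mono) (use insert F' V in \<open>auto simp: F'_def intro: finite_subset\<close>)
    moreover have "card F' \<le> card V" using F' V by (simp add: card_mono)
    ultimately have le: "Suc (card V - card F') \<le> d" using d by simp
    have "pd_less R d (const_seqs R) (const_seqs (nonface_polys V (Pow F')))"
      using pd_less_mono[OF sub[OF dc(2)] _ le] pd_less_simplex[OF V F'(1)] unfolding R_def by blast
    then have "pd_less R d (const_seqs (nonface_polys V (\<Gamma> \<union> Pow (W \<union> X))))
        (const_seqs (nonface_polys V (\<Gamma> \<union> Pow F')))"
      using pd_less_star[of v F' V "\<Gamma> \<union> Pow F'" d, OF F'(2,1) dc(1)] v F'(2)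
      unfolding eq R_def by auto
    moreover have "const_seqs (nonface_polys V (\<Gamma> \<union> Pow F')) \<subseteq> const_seqs (nonface_polys V (\<Gamma> \<union> Pow (W \<union> X)))"
      by (intro const_seqs_mono nonface_polys_antimono) (auto simp: F'_def)
    moreover have "const_seqs (nonface_polys V (\<Gamma> \<union> Pow (W \<union> X))) \<subseteq> const_seqs R"
      unfolding R_def by (intro const_seqs_mono nonface_polys_antimono) auto
    moreover have "fun_submodule R (const_seqs R)" using sub[OF dc(3)] by (simp add: R_def)
    ultimately have "pd_less R d (const_seqs R) (const_seqs (nonface_polys V (\<Gamma> \<union> Pow F')))"
      using pd_less_extension[OF sub[OF dc(1)] sub[OF dc(1)]] insert by blast
    then show ?case by (simp add: F'_def)
  qed
  from this[of "F - W"] show ?thesis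
    using WF finite_subset[OF F V] by (simp add: Un_absorb1)
qed

section \<open>Projective resolutions from iterated syzygies\<close>

context unital_subring
begin

text \<open>
  Unrolling the recursion: \<open>K i\<close> is the rank of the \<open>i\<close>-th free module and \<open>G i\<close> lists the images of its
  basis.
\<close>

lemma pd_less_free_resolution:
  assumes "fun_submodule R N" "fun_submodule R L" "L \<subseteq> N" "pd_less R d N L"
  shows "\<exists>K G. (\<forall>j<K 0. G 0 j \<in> N) \<and>
    (\<forall>y\<in>N. \<exists>c\<in>rank_free R (K 0). y - lincomb (K 0) (G 0) c \<in> L) \<and>
    lincomb (K 1) (G 1) ` rank_free R (K 1) = {c \<in> rank_free R (K 0). lincomb (K 0) (G 0) c \<in> L} \<and>
    (\<forall>i. lincomb (K (Suc (Suc i))) (G (Suc (Suc i))) ` rank_free R (K (Suc (Suc i))) =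
      {c \<in> rank_free R (K (Suc i)). lincomb (K (Suc i)) (G (Suc i)) c = 0}) \<and>
    (\<forall>i\<ge>d. K i = (0::nat))"
  using assms
proof (induction d arbitrary: N L)
  case 0
  have free0: "rank_free R 0 = {0}" using zero by (auto simp: rank_free_def)
  have L0: "0 \<in> L" using 0 by (simp add: fun_submodule_def)
  show ?case
  proof (rule exI[of _ "\<lambda>_. 0"], rule exI[of _ "\<lambda>_ _. 0"], intro conjI allI impI ballI)
    fix y assume "y \<in> N"
    then have "y - lincomb 0 (\<lambda>_. 0) 0 \<in> L" using 0(4) by (simp only: lincomb_0 diff_zero) auto
    then show "\<exists>c\<in>rank_free R 0. y - lincomb 0 (\<lambda>_. 0) c \<in> L" by (simp only: free0 bex_simps simp_thms)
  next
    show "lincomb 0 (\<lambda>_. 0) ` rank_free R 0 = {c \<in> rank_free R 0. lincomb 0 (\<lambda>_. 0) c \<in> L}"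
      unfolding free0 lincomb_0 using L0 by auto
    show "lincomb 0 (\<lambda>_. 0) ` rank_free R 0 = {c \<in> rank_free R 0. lincomb 0 (\<lambda>_. 0) c = 0}"
      unfolding free0 lincomb_0 by auto
  qed auto
next
  case (Suc d)
  obtain k g where g: "\<And>j. j < k \<Longrightarrow> g j \<in> N"
    and gen: "\<And>y. y \<in> N \<Longrightarrow> \<exists>c\<in>rank_free R k. y - lincomb k g c \<in> L"
    and syz: "pd_less R d {c \<in> rank_free R k. lincomb k g c \<in> L} {0}"
    using Suc.prems(4) unfolding pd_less.simps by blast
  define Z where "Z = {c \<in> rank_free R k. lincomb k g c \<in> L}"
  have Z: "fun_submodule R Z"
    unfolding Z_def by (intro linear_vimage_submodule lincomb_linear rank_free_submodule Suc.prems)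
  have "{0} \<subseteq> Z" using Z by (simp add: fun_submodule_def)
  from Suc.IH[OF Z zero_submodule this syz[folded Z_def]] obtain K G where
    h: "(\<forall>j<K 0. G 0 j \<in> Z) \<and> (\<forall>y\<in>Z. \<exists>c\<in>rank_free R (K 0). y - lincomb (K 0) (G 0) c \<in> {0}) \<and>
    lincomb (K 1) (G 1) ` rank_free R (K 1) = {c \<in> rank_free R (K 0). lincomb (K 0) (G 0) c \<in> {0}} \<and>
    (\<forall>i. lincomb (K (Suc (Suc i))) (G (Suc (Suc i))) ` rank_free R (K (Suc (Suc i))) =
      {c \<in> rank_free R (K (Suc i)). lincomb (K (Suc i)) (G (Suc i)) c = 0}) \<and>
    (\<forall>i\<ge>d. K i = (0::nat))"
    by (elim exE)
  note KG = h[THEN conjunct1] h[THEN conjunct2, THEN conjunct1]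
    h[THEN conjunct2, THEN conjunct2, THEN conjunct1]
    h[THEN conjunct2, THEN conjunct2, THEN conjunct2, THEN conjunct1]
    h[THEN conjunct2, THEN conjunct2, THEN conjunct2, THEN conjunct2]
  have im: "lincomb (K 0) (G 0) ` rank_free R (K 0) = Z"
  proof
    show "lincomb (K 0) (G 0) ` rank_free R (K 0) \<subseteq> Z"
      using submodule_lincomb[OF Z] KG(1) by (auto simp: rank_free_def)
    show "Z \<subseteq> lincomb (K 0) (G 0) ` rank_free R (K 0)"
      using KG(2) by auto
  qed
  define K' where "K' = case_nat k K"
  define G' where "G' = case_nat g G"
  have [simp]: "K' 0 = k" "G' 0 = g" "K' (Suc i) = K i" "G' (Suc i) = G i" for i
    by (auto simp: K'_def G'_def)
  show ?case
  proof (rule exI[of _ K'], rule exI[of _ G'], intro conjI allI impI ballI)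
    show "G' 0 j \<in> N" if "j < K' 0" for j using g that by simp
    show "\<exists>c\<in>rank_free R (K' 0). y - lincomb (K' 0) (G' 0) c \<in> L" if "y \<in> N" for y
      using gen[OF that] by simp
    show "lincomb (K' 1) (G' 1) ` rank_free R (K' 1) = {c \<in> rank_free R (K' 0). lincomb (K' 0) (G' 0) c \<in> L}"
      using im by (simp add: Z_def)
    show "lincomb (K' (Suc (Suc i))) (G' (Suc (Suc i))) ` rank_free R (K' (Suc (Suc i))) =
      {c \<in> rank_free R (K' (Suc i)). lincomb (K' (Suc i)) (G' (Suc i)) c = 0}" for i
      using KG(3,4) by (cases i) auto
    show "K' i = 0" if "Suc d \<le> i" for i using KG(5) that by (cases i) auto
  qed
qed

end

text \<open>
  A free module on \<open>B\<close> is a retract of the free module on the family of unit vectors, which is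
  indexed by elements of the module itself as the definition of projectivity demands. Nontriviality
  of the ring keeps the unit vectors distinct.
\<close>

lemma projective_free_module:
  fixes R (structure) and B :: "'b set"
  assumes R: "cring R" and nontrivial: "\<one> \<noteq> \<zero>"
  shows "projective_module R (free_module R B)"
proof -
  interpret cring R by fact
  define \<delta> where "\<delta> b = (\<lambda>b'. if b' = b then \<one> else \<zero>)" for b :: 'b
  have inj: "inj \<delta>" using nontrivial by (auto simp: inj_def \<delta>_def fun_eq_iff split: if_splits)
  define i where "i f = (\<lambda>h. if h \<in> \<delta> ` B then f (inv_into UNIV \<delta> h) else \<zero>)" for f :: "'b \<Rightarrow> 'a"
  define p where "p h = (\<lambda>b. if b \<in> B then h (\<delta> b) else \<zero>)" for h :: "('b \<Rightarrow> 'a) \<Rightarrow> 'a"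
  have "{h. i f h \<noteq> \<zero>} \<subseteq> \<delta> ` {b. f b \<noteq> \<zero>}" for f
    using inv_f_f[OF inj] by (auto simp: i_def)
  then have fin_i: "finite {h. i f h \<noteq> \<zero>}" if "finite {b. f b \<noteq> \<zero>}" for f
    using finite_subset finite_imageI[OF that] by metis
  have i: "i \<in> linear_maps R (free_module R B) (free_module R (\<delta> ` B))"
    unfolding linear_maps_def
  proof (intro CollectI conjI ballI Pi_I)
    fix f assume f: "f \<in> carrier (free_module R B)"
    show "i f \<in> carrier (free_module R (\<delta> ` B))"
      using f fin_i[of f] inv_f_f[OF inj] by (auto simp: free_module_def i_def)
    show "i (f \<oplus>\<^bsub>free_module R B\<^esub> g) = i f \<oplus>\<^bsub>free_module R (\<delta> ` B)\<^esub> i g" for g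
      by (auto simp: free_module_def i_def fun_eq_iff)
    show "i (a \<odot>\<^bsub>free_module R B\<^esub> f) = a \<odot>\<^bsub>free_module R (\<delta> ` B)\<^esub> i f" if "a \<in> carrier R" for a
      using that by (auto simp: free_module_def i_def fun_eq_iff)
  qed
  have "{b. p h b \<noteq> \<zero>} \<subseteq> \<delta> -` {f. h f \<noteq> \<zero>}" for h
    by (auto simp: p_def)
  then have fin_p: "finite {b. p h b \<noteq> \<zero>}" if "finite {f. h f \<noteq> \<zero>}" for h
    using finite_subset finite_vimageI[OF that inj] by metis
  have p: "p \<in> linear_maps R (free_module R (\<delta> ` B)) (free_module R B)"
    unfolding linear_maps_def
  proof (intro CollectI conjI ballI Pi_I)
    fix h assume h: "h \<in> carrier (free_module R (\<delta> ` B))"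
    show "p h \<in> carrier (free_module R B)"
      using h fin_p[of h] by (auto simp: free_module_def p_def)
    show "p (h \<oplus>\<^bsub>free_module R (\<delta> ` B)\<^esub> h') = p h \<oplus>\<^bsub>free_module R B\<^esub> p h'" for h'
      by (auto simp: free_module_def p_def fun_eq_iff)
    show "p (a \<odot>\<^bsub>free_module R (\<delta> ` B)\<^esub> h) = a \<odot>\<^bsub>free_module R B\<^esub> p h" if "a \<in> carrier R" for a
      using that by (auto simp: free_module_def p_def fun_eq_iff)
  qed
  have "p (i f) = f" if "f \<in> carrier (free_module R B)" for f
    using that inv_f_f[OF inj] by (auto simp: p_def i_def free_module_def fun_eq_iff)
  then show ?thesis
    unfolding projective_module_def using i p free_module_module[OF R] by blast
qed

lemma mpoly_ring_sel: "\<zero>\<^bsub>mpoly_ring V\<^esub> = 0" "\<one>\<^bsub>mpoly_ring V\<^esub> = 1" "a \<oplus>\<^bsub>mpoly_ring V\<^esub> b = a + b"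
  "a \<otimes>\<^bsub>mpoly_ring V\<^esub> b = a * b"
  by (simp_all add: mpoly_ring_def)

lemma mpoly_ring_a_inv:
  assumes "b \<in> carrier (mpoly_ring V)"
  shows "\<ominus>\<^bsub>mpoly_ring V\<^esub> b = - (b :: ('v, 'k::comm_ring_1) mpoly)"
proof -
  interpret cring "mpoly_ring V :: ('v, 'k) mpoly ring" by (rule mpoly_ring_cring)
  show ?thesis using assms by (intro minus_equality) (auto simp: mpoly_ring_sel carrier_mpoly_ring)
qed

lemma mpoly_ring_minus:
  assumes "b \<in> carrier (mpoly_ring V)"
  shows "a \<ominus>\<^bsub>mpoly_ring V\<^esub> b = a - (b :: ('v, 'k::comm_ring_1) mpoly)"
  unfolding a_minus_def using assms by (simp add: mpoly_ring_a_inv mpoly_ring_sel)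

text \<open>
  The free modules of rank \<open>K i\<close> are re-indexed by the pairs \<open>(j, m)\<close> with \<open>j < K i\<close> and one fixed \<open>m\<close>,
  which places them on the type over which \<open>proj_dim\<close> ranges.
\<close>

lemma pd_less_projective_resolution:
  fixes V :: "'v set" and I :: "('v, 'k::field) mpoly set"
  assumes I: "ideal I (mpoly_ring V)"
    and pd: "pd_less (nonface_polys V {}) (Suc d) (const_seqs (nonface_polys V {})) (const_seqs I)"
    and sub: "fun_submodule (nonface_polys V {}) (const_seqs I)"
  shows "proj_dim (mpoly_ring V) (quot_algebra (mpoly_ring V) I) \<le> enat d"
proof -
  define S where "S = (mpoly_ring V :: ('v, 'k) mpoly ring)"
  define R where "R = (nonface_polys V {} :: ('v, 'k) mpoly set)"
  define M where "M = quot_algebra S I"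
  have R: "carrier S = R" by (simp add: S_def R_def carrier_mpoly_ring)
  have S_sel: "\<zero>\<^bsub>S\<^esub> = 0" "\<one>\<^bsub>S\<^esub> = 1" "a \<oplus>\<^bsub>S\<^esub> b = a + b" "a \<otimes>\<^bsub>S\<^esub> b = a * b" for a b
    by (simp_all add: S_def mpoly_ring_sel)
  interpret unital_subring R unfolding R_def by (rule unital_subring_polys)
  interpret S: cring S unfolding S_def by (rule mpoly_ring_cring)
  interpret I: ideal I S unfolding S_def by (rule I)
  have subR: "fun_submodule R (const_seqs R)"
    unfolding R_def by (rule const_seqs_submodule) (simp add: down_closed_def)
  have "const_seqs I \<subseteq> const_seqs R"
    using I.a_subset by (intro const_seqs_mono) (simp add: R)
  from pd_less_free_resolution[OF subR sub[folded R_def] this pd[folded R_def]] obtain K G where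
    h: "(\<forall>j<K 0. G 0 j \<in> const_seqs R) \<and>
    (\<forall>y\<in>const_seqs R. \<exists>c\<in>rank_free R (K 0). y - lincomb (K 0) (G 0) c \<in> const_seqs I) \<and>
    lincomb (K 1) (G 1) ` rank_free R (K 1) =
      {c \<in> rank_free R (K 0). lincomb (K 0) (G 0) c \<in> const_seqs I} \<and>
    (\<forall>i. lincomb (K (Suc (Suc i))) (G (Suc (Suc i))) ` rank_free R (K (Suc (Suc i))) =
      {c \<in> rank_free R (K (Suc i)). lincomb (K (Suc i)) (G (Suc i)) c = 0}) \<and>
    (\<forall>i\<ge>Suc d. K i = (0::nat))"
    by (elim exE)
  note gens = h[THEN conjunct1] and onto = h[THEN conjunct2, THEN conjunct1]
    and ex0 = h[THEN conjunct2, THEN conjunct2, THEN conjunct1]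
    and ex = h[THEN conjunct2, THEN conjunct2, THEN conjunct2, THEN conjunct1]
    and K0 = h[THEN conjunct2, THEN conjunct2, THEN conjunct2, THEN conjunct2]
  define m where "m = (undefined :: ('v, 'k) mpoly set)"
  define enc where "enc c = (\<lambda>(j, m'). if m' = m then c j else 0)" for c :: "nat \<Rightarrow> ('v, 'k) mpoly"
  define dec where "dec f = (\<lambda>j. f (j, m))" for f :: "nat \<times> ('v, 'k) mpoly set \<Rightarrow> ('v, 'k) mpoly"
  define P where "P i = free_module S ((\<lambda>j. (j, m)) ` {..<K i})" for i
  define D where "D i f = enc (lincomb (K (Suc i)) (G (Suc i)) (dec f))" for i f
  define e where "e f = I +>\<^bsub>S\<^esub> (lincomb (K 0) (G 0) (dec f) 0)" for f
  have dec_enc [simp]: "dec (enc c) = c" for c by (simp add: dec_def enc_def)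
  have inj_enc: "enc c = enc c' \<longleftrightarrow> c = c'" for c c' by (metis dec_enc)
  have memB: "(j, m') \<in> (\<lambda>j. (j, m)) ` {..<k} \<longleftrightarrow> j < k \<and> m' = m" for j m' and k :: nat by auto
  have carrier_P: "carrier (P i) = enc ` rank_free R (K i)" for i
  proof
    show "enc ` rank_free R (K i) \<subseteq> carrier (P i)"
    proof
      fix f assume "f \<in> enc ` rank_free R (K i)"
      then obtain c where c: "c \<in> rank_free R (K i)" "f = enc c" by blast
      have "{b. f b \<noteq> 0} \<subseteq> (\<lambda>j. (j, m)) ` {..<K i}"
        using c by (auto simp: enc_def rank_free_def intro!: image_eqI split: if_splits) (meson not_less)
      then have "finite {b. f b \<noteq> 0}" by (rule finite_subset) simp
      show "f \<in> carrier (P i)" using c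
          \<open>finite {b. f b \<noteq> 0}\<close> zero
        by (auto simp: P_def free_module_def S_sel R enc_def rank_free_def memB)
    qed
    show "carrier (P i) \<subseteq> enc ` rank_free R (K i)"
    proof
      fix f assume f: "f \<in> carrier (P i)"
      have "f (j, m) \<in> R" for j
        using f zero by (cases "j < K i") (auto simp: P_def free_module_def S_sel R memB)
      then have "dec f \<in> rank_free R (K i)"
        using f by (auto simp: dec_def rank_free_def P_def free_module_def S_sel memB)
      moreover have "f = enc (dec f)"
        using f by (auto simp: dec_def enc_def fun_eq_iff P_def free_module_def S_sel memB)
      ultimately show "f \<in> enc ` rank_free R (K i)" by blast
    qed
  qed
  have P_sel: "\<zero>\<^bsub>P i\<^esub> = enc 0" "enc c \<oplus>\<^bsub>P i\<^esub> enc c' = enc (c + c')" "a \<odot>\<^bsub>P i\<^esub> enc c = enc (fun_scale a c)"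
    for i c c' a
    by (auto simp: P_def free_module_def S_sel enc_def fun_scale_def fun_eq_iff)
  have lin: "lincomb k g (c + c') = lincomb k g c + lincomb k g c'"
    "lincomb k g (fun_scale a c) = fun_scale a (lincomb k g c)" for k a c c'
    and g :: "nat \<Rightarrow> nat \<Rightarrow> ('v, 'k) mpoly"
    using lincomb_linear[of k g] by (auto simp: fun_linear_def)
  have im: "lincomb (K (Suc i)) (G (Suc i)) c \<in> rank_free R (K i)" if "c \<in> rank_free R (K (Suc i))" for i c
  proof (cases i)
    case 0
    have "lincomb (K 1) (G 1) c \<in> lincomb (K 1) (G 1) ` rank_free R (K 1)" using that 0 by simp
    then show ?thesis unfolding ex0 by (simp add: 0)
  next
    case (Suc l)
    have "lincomb (K (Suc (Suc l))) (G (Suc (Suc l))) c \<in>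
        lincomb (K (Suc (Suc l))) (G (Suc (Suc l))) ` rank_free R (K (Suc (Suc l)))"
      using that Suc by simp
    then show ?thesis unfolding ex[rule_format] by (simp add: Suc)
  qed
  have D_lin: "D i \<in> linear_maps S (P (Suc i)) (P i)" for i
    unfolding linear_maps_def using im
    by (auto simp: carrier_P P_sel D_def lin)
  have val: "lincomb (K 0) (G 0) c \<in> const_seqs R" if "c \<in> rank_free R (K 0)" for c
    by (rule submodule_lincomb) (use gens that subR in \<open>auto simp: rank_free_def\<close>)
  have val0: "lincomb (K 0) (G 0) c 0 \<in> carrier S" if "c \<in> rank_free R (K 0)" for c
    using val[OF that] R by (auto elim!: const_seqsE)
  have hom: "(+>\<^bsub>S\<^esub>) I \<in> ring_hom S (S Quot I)" by (rule I.rcos_ring_hom)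
  have fun_scale_at: "fun_scale a f i = a * f i" for a i and f :: "nat \<Rightarrow> ('v, 'k) mpoly"
    by (simp add: fun_scale_def)
  have e_lin: "e \<in> linear_maps S (P 0) M"
    unfolding linear_maps_def using val0 ring_hom_closed[OF hom]
    by (auto simp: carrier_P P_sel e_def lin M_def quot_algebra_def fun_scale_at
        ring_hom_add[OF hom, symmetric] ring_hom_mult[OF hom, symmetric] S_sel)
  have coset: "I +>\<^bsub>S\<^esub> a = \<zero>\<^bsub>M\<^esub> \<longleftrightarrow> a \<in> I" if "a \<in> carrier S" for a
    using that S.a_rcos_zero[OF I.is_ideal] I.rcos_const_imp_mem
    by (auto simp: M_def quot_algebra_def FactRing_def)
  have ker_e: "e (enc c) = \<zero>\<^bsub>M\<^esub> \<longleftrightarrow> lincomb (K 0) (G 0) c \<in> const_seqs I"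
    if c: "c \<in> rank_free R (K 0)" for c
  proof -
    obtain a where a: "lincomb (K 0) (G 0) c = (\<lambda>_. a)" "a \<in> R" using val[OF c] by (rule const_seqsE)
    then show ?thesis using coset R by (simp add: e_def)
  qed
  have e_onto: "e ` carrier (P 0) = carrier M"
  proof
    show "e ` carrier (P 0) \<subseteq> carrier M" using e_lin by (auto simp: linear_maps_def)
    show "carrier M \<subseteq> e ` carrier (P 0)"
    proof
      fix X assume "X \<in> carrier M"
      then obtain a where a: "a \<in> carrier S" "X = I +>\<^bsub>S\<^esub> a"
        by (auto simp: M_def quot_algebra_def FactRing_def A_RCOSETS_def RCOSETS_def a_r_coset_def)
      have "(\<lambda>_. a) \<in> const_seqs R" using a(1) R by simp
      from onto[rule_format, OF this] obtain c where
        c: "c \<in> rank_free R (K 0)" "(\<lambda>_. a) - lincomb (K 0) (G 0) c \<in> const_seqs I" by blast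
      obtain a' where "lincomb (K 0) (G 0) c = (\<lambda>_. a')" using val[OF c(1)] by (rule const_seqsE)
      moreover from this have "(\<lambda>_. a - a') \<in> const_seqs I" using c(2) by (simp add: fun_diff_def)
      ultimately have "a - lincomb (K 0) (G 0) c 0 \<in> I" by simp
      then have "I +>\<^bsub>S\<^esub> a = I +>\<^bsub>S\<^esub> (lincomb (K 0) (G 0) c 0)"
        using S.quotient_eq_iff_same_a_r_cos[OF I.is_ideal a(1) val0[OF c(1)]] a(1) val0[OF c(1)]
        by (simp add: S_def mpoly_ring_minus)
      then have "X = e (enc c)" by (simp add: a(2) e_def)
      then show "X \<in> e ` carrier (P 0)" using c(1) unfolding carrier_P by blast
    qed
  qed
  have exact0: "D 0 ` carrier (P 1) = {x \<in> carrier (P 0). e x = \<zero>\<^bsub>M\<^esub>}"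
  proof -
    have "D 0 ` carrier (P 1) = enc ` (lincomb (K 1) (G 1) ` rank_free R (K 1))"
      by (auto simp: carrier_P D_def image_image)
    also have "\<dots> = {x \<in> carrier (P 0). e x = \<zero>\<^bsub>M\<^esub>}"
      unfolding ex0 carrier_P using ker_e by auto
    finally show ?thesis .
  qed
  have exact: "D (Suc i) ` carrier (P (Suc (Suc i))) = {x \<in> carrier (P (Suc i)). D i x = \<zero>\<^bsub>P i\<^esub>}" for i
  proof -
    have "D (Suc i) ` carrier (P (Suc (Suc i))) =
        enc ` (lincomb (K (Suc (Suc i))) (G (Suc (Suc i))) ` rank_free R (K (Suc (Suc i))))"
      by (auto simp: carrier_P D_def image_image)
    also have "\<dots> = {x \<in> carrier (P (Suc i)). D i x = \<zero>\<^bsub>P i\<^esub>}"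
      unfolding ex[rule_format] carrier_P D_def P_sel by (auto simp: inj_enc)
    finally show ?thesis .
  qed
  have "carrier (P i) = {\<zero>\<^bsub>P i\<^esub>}" if "i > d" for i
  proof -
    have "rank_free R (K i) = {0}" using K0 that zero by (auto simp: rank_free_def fun_eq_iff)
    then show ?thesis by (simp add: carrier_P P_sel)
  qed
  moreover have "projective_module S (P i)" for i
    unfolding P_def by (rule projective_free_module[OF S.is_cring]) (simp add: S_sel)
  ultimately have "projective_resolution S M d P D e"
    unfolding projective_resolution_def using D_lin e_lin e_onto exact0 exact by blast
  then show ?thesis
    unfolding proj_dim_def M_def S_def by (intro Inf_lower) blast
qed

section \<open>Koszul cohomology and the length of resolutions\<close>

text \<open>
  The differential of the Koszul cochain complex of \<open>M\<close> with respect to the elements \<open>x u\<close> for \<open>u\<close> in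
  the list: a cochain assigns an element of \<open>M\<close> to each set of indices. Splitting off the first index
  exhibits the complex as a mapping cone of the shorter one, which replaces the alternating signs by
  a recursion. Writing the sign as the scalar \<open>- 1\<close> lets it commute with linear maps.
\<close>

primrec koszul ::
    "('v \<Rightarrow> 'r) \<Rightarrow> ('r, 'x) ring_scheme \<Rightarrow> ('r, 'a, 'y) module_scheme \<Rightarrow> 'v list \<Rightarrow> ('v set \<Rightarrow> 'a) \<Rightarrow> 'v set \<Rightarrow> 'a"
where
  "koszul x R M [] c \<tau> = \<zero>\<^bsub>M\<^esub>"
| "koszul x R M (u # us) c \<tau> =
    (if u \<in> \<tau> then x u \<odot>\<^bsub>M\<^esub> c (\<tau> - {u}) \<oplus>\<^bsub>M\<^esub>
        (\<ominus>\<^bsub>R\<^esub> \<one>\<^bsub>R\<^esub>) \<odot>\<^bsub>M\<^esub> koszul x R M us (\<lambda>\<rho>. c (insert u \<rho>)) (\<tau> - {u})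
     else koszul x R M us c \<tau>)"

text \<open>
  Vanishing of the \<open>j\<close>-th cohomology. Cochains are total functions, and only their values at the
  \<open>j\<close>-element subsets of \<open>set us\<close> are compared.
\<close>

definition koszul_vanishes ::
    "('v \<Rightarrow> 'r) \<Rightarrow> ('r, 'x) ring_scheme \<Rightarrow> ('r, 'a, 'y) module_scheme \<Rightarrow> 'v list \<Rightarrow> nat \<Rightarrow> bool" where
  "koszul_vanishes x R M us j \<longleftrightarrow>
    (\<forall>c. (\<forall>\<tau>. c \<tau> \<in> carrier M) \<longrightarrow>
      (\<forall>\<tau>. \<tau> \<subseteq> set us \<longrightarrow> card \<tau> = Suc j \<longrightarrow> koszul x R M us c \<tau> = \<zero>\<^bsub>M\<^esub>) \<longrightarrow>
      (\<exists>b. (\<forall>\<tau>. b \<tau> \<in> carrier M) \<and>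
        (\<forall>\<tau>. \<tau> \<subseteq> set us \<longrightarrow> card \<tau> = j \<longrightarrow> c \<tau> = koszul x R M us b \<tau>)))"

lemma koszul_vanishesE:
  assumes "koszul_vanishes x R M us j" and "\<And>\<tau>. c \<tau> \<in> carrier M"
    and "\<And>\<tau>. \<tau> \<subseteq> set us \<Longrightarrow> card \<tau> = Suc j \<Longrightarrow> koszul x R M us c \<tau> = \<zero>\<^bsub>M\<^esub>"
  obtains b where "\<And>\<tau>. b \<tau> \<in> carrier M"
    "\<And>\<tau>. \<tau> \<subseteq> set us \<Longrightarrow> card \<tau> = j \<Longrightarrow> c \<tau> = koszul x R M us b \<tau>"
  using assms unfolding koszul_vanishes_def by metis

text \<open>
  The value of the differential at \<open>\<tau>\<close> depends only on the sets obtained from \<open>\<tau>\<close> by removing one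
  element; in particular it depends on the cochain in a single degree only.
\<close>

lemma koszul_cong:
  assumes "\<And>v. v \<in> \<tau> \<Longrightarrow> c (\<tau> - {v}) = c' (\<tau> - {v})"
  shows "koszul x R M us c \<tau> = koszul x R M us c' \<tau>"
  using assms
proof (induction us arbitrary: c c' \<tau>)
  case (Cons u us)
  have "koszul x R M us (\<lambda>\<rho>. c (insert u \<rho>)) (\<tau> - {u}) = koszul x R M us (\<lambda>\<rho>. c' (insert u \<rho>)) (\<tau> - {u})"
    if "u \<in> \<tau>"
  proof (rule Cons.IH)
    fix v assume "v \<in> \<tau> - {u}"
    moreover from this that have "insert u (\<tau> - {u} - {v}) = \<tau> - {v}" by auto
    ultimately show "c (insert u (\<tau> - {u} - {v})) = c' (insert u (\<tau> - {u} - {v}))"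
      using Cons.prems by simp
  qed
  then show ?case using Cons.IH[of \<tau> c c'] Cons.prems by simp
qed simp

lemma linear_mapsD:
  assumes "f \<in> linear_maps R M N"
  shows "x \<in> carrier M \<Longrightarrow> f x \<in> carrier N"
    and "x \<in> carrier M \<Longrightarrow> y \<in> carrier M \<Longrightarrow> f (x \<oplus>\<^bsub>M\<^esub> y) = f x \<oplus>\<^bsub>N\<^esub> f y"
    and "a \<in> carrier R \<Longrightarrow> x \<in> carrier M \<Longrightarrow> f (a \<odot>\<^bsub>M\<^esub> x) = a \<odot>\<^bsub>N\<^esub> f x"
  using assms by (auto simp: linear_maps_def)

lemma linear_maps_zero:
  assumes "Module.module R M" "Module.module R N" "f \<in> linear_maps R M N"
  shows "f \<zero>\<^bsub>M\<^esub> = \<zero>\<^bsub>N\<^esub>"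
proof -
  interpret M: Module.module R M by fact
  interpret N: Module.module R N by fact
  have "f (\<zero>\<^bsub>R\<^esub> \<odot>\<^bsub>M\<^esub> \<zero>\<^bsub>M\<^esub>) = \<zero>\<^bsub>R\<^esub> \<odot>\<^bsub>N\<^esub> f \<zero>\<^bsub>M\<^esub>"
    by (rule linear_mapsD(3)[OF assms(3)]) auto
  then show ?thesis using linear_mapsD(1)[OF assms(3) M.zero_closed] by simp
qed

context Module.module
begin

lemma koszul_closed:
  assumes x: "x \<in> set us \<rightarrow> carrier R" and c: "\<And>\<tau>. c \<tau> \<in> carrier M"
  shows "koszul x R M us c \<tau> \<in> carrier M"
  using assms by (induction us arbitrary: c \<tau>) (auto simp: Pi_iff)

lemma koszul_zero:
  assumes x: "x \<in> set us \<rightarrow> carrier R"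
  shows "koszul x R M us (\<lambda>_. \<zero>\<^bsub>M\<^esub>) \<tau> = \<zero>\<^bsub>M\<^esub>"
  using assms by (induction us arbitrary: \<tau>) (auto simp: Pi_iff)

lemma koszul_smult:
  assumes x: "x \<in> set us \<rightarrow> carrier R" and c: "\<And>\<tau>. c \<tau> \<in> carrier M" and a: "a \<in> carrier R"
  shows "koszul x R M us (\<lambda>\<rho>. a \<odot>\<^bsub>M\<^esub> c \<rho>) \<tau> = a \<odot>\<^bsub>M\<^esub> koszul x R M us c \<tau>"
  using x c
proof (induction us arbitrary: c \<tau>)
  case (Cons u us)
  have "koszul x R M us (\<lambda>\<rho>. c (insert u \<rho>)) (\<tau> - {u}) \<in> carrier M" using Cons.prems by (intro koszul_closed) (auto simp: Pi_iff)
  moreover have "b \<odot>\<^bsub>M\<^esub> (a \<odot>\<^bsub>M\<^esub> y) = a \<odot>\<^bsub>M\<^esub> (b \<odot>\<^bsub>M\<^esub> y)" if "b \<in> carrier R" "y \<in> carrier M" for b y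
    using that a by (metis smult_assoc1 R.m_comm)
  ultimately show ?case using Cons a by (simp add: smult_r_distr Pi_iff)
qed (use a in simp)

lemma koszul_add:
  assumes x: "x \<in> set us \<rightarrow> carrier R"
    and c: "\<And>\<tau>. c \<tau> \<in> carrier M" "\<And>\<tau>. c' \<tau> \<in> carrier M"
  shows "koszul x R M us (\<lambda>\<rho>. c \<rho> \<oplus>\<^bsub>M\<^esub> c' \<rho>) \<tau> = koszul x R M us c \<tau> \<oplus>\<^bsub>M\<^esub> koszul x R M us c' \<tau>"
  using assms
proof (induction us arbitrary: c c' \<tau>)
  case (Cons u us)
  have "koszul x R M us (\<lambda>\<rho>. c (insert u \<rho>)) (\<tau> - {u}) \<in> carrier M"
    "koszul x R M us (\<lambda>\<rho>. c' (insert u \<rho>)) (\<tau> - {u}) \<in> carrier M"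
    using Cons.prems by (auto intro!: koszul_closed simp: Pi_iff)
  moreover have "koszul x R M us (\<lambda>\<rho>. d \<rho> \<oplus>\<^bsub>M\<^esub> d' \<rho>) \<sigma> = koszul x R M us d \<sigma> \<oplus>\<^bsub>M\<^esub> koszul x R M us d' \<sigma>"
    if "\<And>\<tau>. d \<tau> \<in> carrier M" "\<And>\<tau>. d' \<tau> \<in> carrier M" for d d' \<sigma>
    using Cons.IH[of d d' \<sigma>] Cons.prems(1) that by (simp add: Pi_iff)
  ultimately have "koszul x R M (u # us) (\<lambda>\<rho>. c \<rho> \<oplus>\<^bsub>M\<^esub> c' \<rho>) \<tau> =
    (if u \<in> \<tau> then x u \<odot>\<^bsub>M\<^esub> c (\<tau> - {u}) \<oplus>\<^bsub>M\<^esub> x u \<odot>\<^bsub>M\<^esub> c' (\<tau> - {u}) \<oplus>\<^bsub>M\<^esub>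
      ((\<ominus> \<one>) \<odot>\<^bsub>M\<^esub> koszul x R M us (\<lambda>\<rho>. c (insert u \<rho>)) (\<tau> - {u}) \<oplus>\<^bsub>M\<^esub>
       (\<ominus> \<one>) \<odot>\<^bsub>M\<^esub> koszul x R M us (\<lambda>\<rho>. c' (insert u \<rho>)) (\<tau> - {u}))
     else koszul x R M us c \<tau> \<oplus>\<^bsub>M\<^esub> koszul x R M us c' \<tau>)"
    using Cons.prems by (simp add: smult_r_distr Pi_iff)
  then show ?case
    using \<open>koszul x R M us (\<lambda>\<rho>. c (insert u \<rho>)) (\<tau> - {u}) \<in> carrier M\<close>
      \<open>koszul x R M us (\<lambda>\<rho>. c' (insert u \<rho>)) (\<tau> - {u}) \<in> carrier M\<close> Cons.prems
    by (simp add: M.a_ac Pi_iff)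
qed simp

lemma smult_uminus_one: "y \<in> carrier M \<Longrightarrow> (\<ominus> \<one>) \<odot>\<^bsub>M\<^esub> y = \<ominus>\<^bsub>M\<^esub> y"
  by (simp add: smult_l_minus)

text \<open>
  The differential squares to zero. At a set containing the first index \<open>u\<close>, the two ways to remove \<open>u\<close>
  contribute \<open>x u\<close> times the shorter differential with opposite signs; what is left is the square of
  the shorter differential.
\<close>

lemma koszul_koszul:
  assumes x: "x \<in> set us \<rightarrow> carrier R" and c: "\<And>\<tau>. c \<tau> \<in> carrier M"
  shows "koszul x R M us (koszul x R M us c) \<tau> = \<zero>\<^bsub>M\<^esub>"
  using assms
proof (induction us arbitrary: c \<tau>)
  case (Cons u us)
  have x: "x u \<in> carrier R" "x \<in> set us \<rightarrow> carrier R" using Cons.prems by (auto simp: Pi_iff)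
  note c = Cons.prems(2)
  let ?K = "koszul x R M us"
  define cu where "cu = (\<lambda>\<rho>. c (insert u \<rho>))"
  have cu: "cu \<tau> \<in> carrier M" for \<tau> using c by (simp add: cu_def)
  have cl: "?K c \<tau> \<in> carrier M" "?K cu \<tau> \<in> carrier M" for \<tau>
    by (intro koszul_closed x c cu; assumption)+
  show ?case
  proof (cases "u \<in> \<tau>")
    case True
    have "?K (\<lambda>\<rho>. koszul x R M (u # us) c (insert u \<rho>)) (\<tau> - {u}) =
        ?K (\<lambda>\<rho>. x u \<odot>\<^bsub>M\<^esub> c \<rho> \<oplus>\<^bsub>M\<^esub> (\<ominus> \<one>) \<odot>\<^bsub>M\<^esub> ?K cu \<rho>) (\<tau> - {u})"
      by (rule koszul_cong) (simp add: cu_def)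
    also have "\<dots> = x u \<odot>\<^bsub>M\<^esub> ?K c (\<tau> - {u}) \<oplus>\<^bsub>M\<^esub> (\<ominus> \<one>) \<odot>\<^bsub>M\<^esub> ?K (?K cu) (\<tau> - {u})"
      using x c cu cl by (simp add: koszul_add koszul_smult)
    also have "?K (?K cu) (\<tau> - {u}) = \<zero>\<^bsub>M\<^esub>" by (rule Cons.IH) (use x cu in auto)
    finally have tail: "?K (\<lambda>\<rho>. koszul x R M (u # us) c (insert u \<rho>)) (\<tau> - {u}) =
        x u \<odot>\<^bsub>M\<^esub> ?K c (\<tau> - {u})"
      using x cl by simp
    have "koszul x R M (u # us) (koszul x R M (u # us) c) \<tau> =
        x u \<odot>\<^bsub>M\<^esub> koszul x R M (u # us) c (\<tau> - {u}) \<oplus>\<^bsub>M\<^esub> (\<ominus> \<one>) \<odot>\<^bsub>M\<^esub> (x u \<odot>\<^bsub>M\<^esub> ?K c (\<tau> - {u}))"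
      unfolding tail[symmetric] by (subst koszul.simps(2)) (simp only: True if_True)
    also have "\<dots> = \<zero>\<^bsub>M\<^esub>" using x cl by (simp add: smult_uminus_one M.r_neg)
    finally show ?thesis .
  next
    case False
    have "?K (koszul x R M (u # us) c) \<tau> = ?K (?K c) \<tau>"
      by (rule koszul_cong) (use False in simp)
    also have "\<dots> = \<zero>\<^bsub>M\<^esub>" by (rule Cons.IH) (use x c in auto)
    finally show ?thesis by (subst koszul.simps(2)) (simp only: False if_False)
  qed
qed simp

end

lemma koszul_linear:
  assumes MN: "Module.module R M" "Module.module R N" and f: "f \<in> linear_maps R M N"
    and x: "x \<in> set us \<rightarrow> carrier R" and c: "\<And>\<tau>. c \<tau> \<in> carrier M"
  shows "f (koszul x R M us c \<tau>) = koszul x R N us (\<lambda>\<rho>. f (c \<rho>)) \<tau>"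
  using x c
proof (induction us arbitrary: c \<tau>)
  case Nil
  then show ?case using linear_maps_zero[OF MN f] by simp
next
  case (Cons u us)
  interpret M: Module.module R M by fact
  interpret N: Module.module R N by fact
  have "koszul x R M us (\<lambda>\<rho>. c (insert u \<rho>)) (\<tau> - {u}) \<in> carrier M"
    using Cons.prems by (intro M.koszul_closed) (auto simp: Pi_iff)
  then show ?case using Cons by (simp add: linear_mapsD[OF f] Pi_iff)
qed

lemma koszul_vanishes_retract:
  assumes mods: "Module.module R M" "Module.module R N" and i: "i \<in> linear_maps R M N" and p: "p \<in> linear_maps R N M"
    and pi: "\<And>y. y \<in> carrier M \<Longrightarrow> p (i y) = y"
    and x: "x \<in> set us \<rightarrow> carrier R" and van: "koszul_vanishes x R N us j"
  shows "koszul_vanishes x R M us j"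
  unfolding koszul_vanishes_def
proof (intro allI impI)
  fix c assume c: "\<forall>\<tau>. c \<tau> \<in> carrier M"
    and cocycle: "\<forall>\<tau>. \<tau> \<subseteq> set us \<longrightarrow> card \<tau> = Suc j \<longrightarrow> koszul x R M us c \<tau> = \<zero>\<^bsub>M\<^esub>"
  have coc: "koszul x R N us (\<lambda>\<tau>. i (c \<tau>)) \<tau> = \<zero>\<^bsub>N\<^esub>" if "\<tau> \<subseteq> set us" "card \<tau> = Suc j" for \<tau>
    using koszul_linear[OF mods i x, of c \<tau>] c cocycle that linear_maps_zero[OF mods i] by simp
  have "i (c \<tau>) \<in> carrier N" for \<tau> using c linear_mapsD(1)[OF i] by blast
  from koszul_vanishesE[OF van this coc] obtain b where b: "\<And>\<tau>. b \<tau> \<in> carrier N"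
    "\<And>\<tau>. \<tau> \<subseteq> set us \<Longrightarrow> card \<tau> = j \<Longrightarrow> i (c \<tau>) = koszul x R N us b \<tau>"
    by blast
  have "c \<tau> = koszul x R M us (\<lambda>\<tau>. p (b \<tau>)) \<tau>" if "\<tau> \<subseteq> set us" "card \<tau> = j" for \<tau>
    using koszul_linear[OF mods(2,1) p x, of b \<tau>] b that pi[of "c \<tau>"] c by simp
  then show "\<exists>b. (\<forall>\<tau>. b \<tau> \<in> carrier M) \<and>
      (\<forall>\<tau>. \<tau> \<subseteq> set us \<longrightarrow> card \<tau> = j \<longrightarrow> c \<tau> = koszul x R M us b \<tau>)"
    using linear_mapsD(1)[OF p] b(1) by (intro exI[of _ "\<lambda>\<tau>. p (b \<tau>)"]) blast
qed

definition ring_module :: "('r, 'x) ring_scheme \<Rightarrow> ('r, 'r) module" where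
  "ring_module R = \<lparr>carrier = carrier R, mult = mult R, one = one R, zero = zero R, add = add R, smult = mult R\<rparr>"

lemma koszul_free_module:
  "koszul x R (free_module R B) us c \<tau> \<beta> = koszul x R (ring_module R) us (\<lambda>\<rho>. c \<rho> \<beta>) \<tau>"
  by (induction us arbitrary: c \<tau>) (auto simp: free_module_def ring_module_def)

lemma ring_module_module:
  fixes R (structure)
  assumes "cring R"
  shows "Module.module R (ring_module R)"
proof -
  interpret cring R by fact
  show ?thesis
  proof (rule moduleI)
    show "abelian_group (ring_module R)"
    proof (rule abelian_groupI)
      fix a assume "a \<in> carrier (ring_module R)"
      then show "\<exists>b\<in>carrier (ring_module R). b \<oplus>\<^bsub>ring_module R\<^esub> a = \<zero>\<^bsub>ring_module R\<^esub>"
        by (intro bexI[of _ "\<ominus> a"]) (auto simp: ring_module_def l_neg)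
    qed (auto simp: ring_module_def a_ac)
  qed (auto simp: ring_module_def l_distr r_distr m_assoc assms)
qed

text \<open>
  The differential acts on each coordinate separately. A cochain has finitely many values on subsets
  of \<open>set us\<close>, and choosing the primitive \<open>0\<close> in coordinates where all of them vanish keeps the support
  of the primitive finite.
\<close>

lemma koszul_vanishes_free:
  assumes R: "cring R" and x: "x \<in> set us \<rightarrow> carrier R"
    and van: "koszul_vanishes x R (ring_module R) us j"
  shows "koszul_vanishes x R (free_module R B) us j"
  unfolding koszul_vanishes_def
proof (intro allI impI)
  interpret cring R by fact
  interpret RM: Module.module R "ring_module R" by (rule ring_module_module[OF R])
  let ?F = "free_module R B" and ?N = "ring_module R"
  have N: "carrier ?N = carrier R" "\<zero>\<^bsub>?N\<^esub> = \<zero>\<^bsub>R\<^esub>" by (auto simp: ring_module_def)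
  fix c assume c: "\<forall>\<tau>. c \<tau> \<in> carrier ?F"
    and cocycle: "\<forall>\<tau>. \<tau> \<subseteq> set us \<longrightarrow> card \<tau> = Suc j \<longrightarrow> koszul x R ?F us c \<tau> = \<zero>\<^bsub>?F\<^esub>"
  have cR: "c \<tau> \<beta> \<in> carrier R" for \<tau> \<beta>
    using c zero_closed by (cases "\<beta> \<in> B") (auto simp: free_module_def)
  have "\<forall>\<beta>. \<exists>b. (\<forall>\<tau>. b \<tau> \<in> carrier R) \<and>
      (\<forall>\<tau>. \<tau> \<subseteq> set us \<longrightarrow> card \<tau> = j \<longrightarrow> c \<tau> \<beta> = koszul x R ?N us b \<tau>) \<and>
      ((\<forall>\<tau>. \<tau> \<subseteq> set us \<longrightarrow> c \<tau> \<beta> = \<zero>\<^bsub>R\<^esub>) \<longrightarrow> (\<forall>\<tau>. b \<tau> = \<zero>\<^bsub>R\<^esub>))"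
    (is "\<forall>\<beta>. ?E \<beta>")
  proof (rule allI)
    fix \<beta>
    show "?E \<beta>"
    proof (cases "\<forall>\<tau>. \<tau> \<subseteq> set us \<longrightarrow> c \<tau> \<beta> = \<zero>\<^bsub>R\<^esub>")
      case True
      have "koszul x R ?N us (\<lambda>_. \<zero>\<^bsub>R\<^esub>) \<tau> = \<zero>\<^bsub>R\<^esub>" for \<tau>
        using RM.koszul_zero[OF x, of \<tau>] by (simp add: N)
      then show ?thesis using True by (intro exI[of _ "\<lambda>_. \<zero>\<^bsub>R\<^esub>"]) auto
    next
      case False
      have coc: "koszul x R ?N us (\<lambda>\<tau>. c \<tau> \<beta>) \<tau> = \<zero>\<^bsub>?N\<^esub>" if "\<tau> \<subseteq> set us" "card \<tau> = Suc j" for \<tau>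
        using cocycle that koszul_free_module[of x R B us c \<tau> \<beta>] by (simp add: N free_module_def)
      have "c \<tau> \<beta> \<in> carrier ?N" for \<tau> using cR by (simp add: N)
      from koszul_vanishesE[OF van this coc] obtain b where "\<And>\<tau>. b \<tau> \<in> carrier R"
        "\<And>\<tau>. \<tau> \<subseteq> set us \<Longrightarrow> card \<tau> = j \<Longrightarrow> c \<tau> \<beta> = koszul x R ?N us b \<tau>"
        unfolding N by blast
      then show ?thesis using False by blast
    qed
  qed
  from choice[OF this] obtain b where b: "\<And>\<beta> \<tau>. b \<beta> \<tau> \<in> carrier R"
    "\<And>\<beta> \<tau>. \<tau> \<subseteq> set us \<Longrightarrow> card \<tau> = j \<Longrightarrow> c \<tau> \<beta> = koszul x R ?N us (b \<beta>) \<tau>"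
    "\<And>\<beta> \<tau>. (\<forall>\<tau>. \<tau> \<subseteq> set us \<longrightarrow> c \<tau> \<beta> = \<zero>\<^bsub>R\<^esub>) \<Longrightarrow> b \<beta> \<tau> = \<zero>\<^bsub>R\<^esub>"
    by blast
  have "(\<lambda>\<beta>. b \<beta> \<tau>) \<in> carrier ?F" for \<tau>
  proof -
    have "{\<beta>. b \<beta> \<tau> \<noteq> \<zero>\<^bsub>R\<^esub>} \<subseteq> (\<Union>\<tau>\<in>Pow (set us). {\<beta>. c \<tau> \<beta> \<noteq> \<zero>\<^bsub>R\<^esub>})"
      using b(3) by blast
    moreover have "finite (\<Union>\<tau>\<in>Pow (set us). {\<beta>. c \<tau> \<beta> \<noteq> \<zero>\<^bsub>R\<^esub>})"
      using c by (intro finite_UN_I) (auto simp: free_module_def)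
    ultimately have "finite {\<beta>. b \<beta> \<tau> \<noteq> \<zero>\<^bsub>R\<^esub>}" by (rule finite_subset)
    moreover have "b \<beta> \<tau> = \<zero>\<^bsub>R\<^esub>" if "\<beta> \<notin> B" for \<beta>
      using that c by (intro b(3)) (auto simp: free_module_def)
    ultimately show ?thesis using b(1) by (simp add: free_module_def)
  qed
  moreover have "c \<tau> = koszul x R ?F us (\<lambda>\<tau> \<beta>. b \<beta> \<tau>) \<tau>" if "\<tau> \<subseteq> set us" "card \<tau> = j" for \<tau>
    using b(2)[OF that] by (simp add: fun_eq_iff koszul_free_module)
  ultimately show "\<exists>b. (\<forall>\<tau>. b \<tau> \<in> carrier ?F) \<and>
      (\<forall>\<tau>. \<tau> \<subseteq> set us \<longrightarrow> card \<tau> = j \<longrightarrow> c \<tau> = koszul x R ?F us b \<tau>)"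
    by (intro exI[of _ "\<lambda>\<tau> \<beta>. b \<beta> \<tau>"] conjI allI impI)
qed

lemma koszul_vanishes_projective:
  fixes P :: "('r, 'b, 'y) module_scheme"
  assumes R: "cring R" and x: "x \<in> set us \<rightarrow> carrier R"
    and van: "koszul_vanishes x R (ring_module R) us j" and P: "projective_module R P"
  shows "koszul_vanishes x R P us j"
proof -
  from P obtain B :: "'b set" and i p where "Module.module R P" "i \<in> linear_maps R P (free_module R B)"
    "p \<in> linear_maps R (free_module R B) P" "\<forall>x\<in>carrier P. p (i x) = x"
    unfolding projective_module_def by blast
  then show ?thesis
    using koszul_vanishes_retract[OF _ free_module_module[OF R] _ _ _ x koszul_vanishes_free[OF R x van]]
    by blast
qed

text \<open>
  Dimension shifting along the resolution. The claim inside the proof is the vanishing of the \<open>j\<close>-th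
  cohomology of the cokernel of \<open>D i\<close> for \<open>j < s - (d - i)\<close>, phrased with cochains of \<open>P i\<close> modulo the
  image of \<open>D i\<close>; it is proved by descending induction on \<open>i\<close>.
\<close>

lemma koszul_vanishes_resolution:
  assumes R: "cring R" and M: "Module.module R M" and x: "x \<in> set us \<rightarrow> carrier R"
    and van: "\<And>j. j < s \<Longrightarrow> koszul_vanishes x R (ring_module R) us j"
    and res: "projective_resolution R M d P D e" and j: "j + d < s"
  shows "koszul_vanishes x R M us j"
proof -
  have res': "\<forall>i. projective_module R (P i)" "\<forall>i>d. carrier (P i) = {\<zero>\<^bsub>P i\<^esub>}"
    "\<forall>i. D i \<in> linear_maps R (P (Suc i)) (P i)" "e \<in> linear_maps R (P 0) M" "e ` carrier (P 0) = carrier M"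
    "D 0 ` carrier (P 1) = {x \<in> carrier (P 0). e x = \<zero>\<^bsub>M\<^esub>}"
    "\<forall>i. D (Suc i) ` carrier (P (Suc (Suc i))) = {x \<in> carrier (P (Suc i)). D i x = \<zero>\<^bsub>P i\<^esub>}"
    using res by (simp_all add: projective_resolution_def)
  note proj = res'(1)[rule_format] and trivial = res'(2)[rule_format] and D = res'(3)[rule_format]
    and e = res'(4) and onto = res'(5) and exact0 = res'(6) and exact = res'(7)[rule_format]
  have P: "Module.module R (P i)" for i using proj unfolding projective_module_def by blast
  have vanP: "koszul_vanishes x R (P i) us j" if "j < s" for i j
    by (rule koszul_vanishes_projective[OF R x van[OF that] proj])
  have fin: "finite \<tau>" if "\<tau> \<subseteq> set us" for \<tau> using that finite_subset by blast
  have claim: "\<forall>j c. j + d < s + i \<longrightarrow> (\<forall>\<tau>. c \<tau> \<in> carrier (P i)) \<longrightarrow>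
      (\<forall>\<tau>. \<tau> \<subseteq> set us \<longrightarrow> card \<tau> = Suc j \<longrightarrow> (\<exists>a\<in>carrier (P (Suc i)). koszul x R (P i) us c \<tau> = D i a)) \<longrightarrow>
      (\<exists>b. (\<forall>\<tau>. b \<tau> \<in> carrier (P i)) \<and> (\<forall>\<tau>. \<tau> \<subseteq> set us \<longrightarrow> card \<tau> = j \<longrightarrow>
        (\<exists>a\<in>carrier (P (Suc i)). c \<tau> = koszul x R (P i) us b \<tau> \<oplus>\<^bsub>P i\<^esub> D i a)))"
    if "i \<le> d" for i
    using that
  proof (induction rule: inc_induct)
    case base
    show ?case
    proof (intro allI impI)
      fix j c assume js: "j + d < s + d" and c: "\<forall>\<tau>. c \<tau> \<in> carrier (P d)"
        and cocycle: "\<forall>\<tau>. \<tau> \<subseteq> set us \<longrightarrow> card \<tau> = Suc j \<longrightarrow>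
          (\<exists>a\<in>carrier (P (Suc d)). koszul x R (P d) us c \<tau> = D d a)"
      interpret Pd: Module.module R "P d" by (rule P)
      have D0: "D d \<zero>\<^bsub>P (Suc d)\<^esub> = \<zero>\<^bsub>P d\<^esub>" by (rule linear_maps_zero[OF P P D])
      have "koszul x R (P d) us c \<tau> = \<zero>\<^bsub>P d\<^esub>" if "\<tau> \<subseteq> set us" "card \<tau> = Suc j" for \<tau>
        using cocycle that trivial[of "Suc d"] D0 by auto
      then obtain b where b: "\<forall>\<tau>. b \<tau> \<in> carrier (P d)"
        "\<And>\<tau>. \<tau> \<subseteq> set us \<Longrightarrow> card \<tau> = j \<Longrightarrow> c \<tau> = koszul x R (P d) us b \<tau>"
        using koszul_vanishesE[OF vanP[of j d], of c] js c by auto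
      have "koszul x R (P d) us b \<tau> \<in> carrier (P d)" for \<tau>
        by (rule Pd.koszul_closed) (use x b in auto)
      then have "\<exists>a\<in>carrier (P (Suc d)). c \<tau> = koszul x R (P d) us b \<tau> \<oplus>\<^bsub>P d\<^esub> D d a"
        if "\<tau> \<subseteq> set us" "card \<tau> = j" for \<tau>
        using b(2)[OF that] trivial[of "Suc d"] D0 by simp
      then show "\<exists>b. (\<forall>\<tau>. b \<tau> \<in> carrier (P d)) \<and> (\<forall>\<tau>. \<tau> \<subseteq> set us \<longrightarrow> card \<tau> = j \<longrightarrow>
        (\<exists>a\<in>carrier (P (Suc d)). c \<tau> = koszul x R (P d) us b \<tau> \<oplus>\<^bsub>P d\<^esub> D d a))"
        using b(1) by blast
    qed
  next
    case (step i)
    show ?case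
    proof (intro allI impI)
      fix j c assume js: "j + d < s + i" and c: "\<forall>\<tau>. c \<tau> \<in> carrier (P i)"
        and cocycle: "\<forall>\<tau>. \<tau> \<subseteq> set us \<longrightarrow> card \<tau> = Suc j \<longrightarrow>
          (\<exists>a\<in>carrier (P (Suc i)). koszul x R (P i) us c \<tau> = D i a)"
      interpret Pi: Module.module R "P i" by (rule P)
      interpret Pj: Module.module R "P (Suc i)" by (rule P)
      let ?K = "koszul x R (P i) us" and ?K' = "koszul x R (P (Suc i)) us"
      have "\<exists>a\<in>carrier (P (Suc i)). \<tau> \<subseteq> set us \<longrightarrow> card \<tau> = Suc j \<longrightarrow> ?K c \<tau> = D i a" for \<tau>
        using cocycle Pj.zero_closed by blast
      then obtain a where a: "\<And>\<tau>. a \<tau> \<in> carrier (P (Suc i))"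
        "\<And>\<tau>. \<tau> \<subseteq> set us \<Longrightarrow> card \<tau> = Suc j \<Longrightarrow> ?K c \<tau> = D i (a \<tau>)"
        by metis
      have "\<exists>a'\<in>carrier (P (Suc (Suc i))). ?K' a \<tau> = D (Suc i) a'"
        if \<tau>: "\<tau> \<subseteq> set us" "card \<tau> = Suc (Suc j)" for \<tau>
      proof -
        have "D i (?K' a \<tau>) = ?K (\<lambda>\<rho>. D i (a \<rho>)) \<tau>"
          by (rule koszul_linear[OF P P D x a(1)])
        also have "\<dots> = ?K (?K c) \<tau>"
          by (rule koszul_cong, rule a(2)[symmetric]) (use \<tau> fin[OF \<tau>(1)] in auto)
        also have "\<dots> = \<zero>\<^bsub>P i\<^esub>" by (rule Pi.koszul_koszul) (use x c in auto)
        finally have "?K' a \<tau> \<in> {y \<in> carrier (P (Suc i)). D i y = \<zero>\<^bsub>P i\<^esub>}"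
          using Pj.koszul_closed[OF x a(1)] by simp
        then show ?thesis unfolding exact[symmetric] by auto
      qed
      then obtain b where b: "\<And>\<tau>. b \<tau> \<in> carrier (P (Suc i))" and
        ab: "\<And>\<tau>. \<tau> \<subseteq> set us \<Longrightarrow> card \<tau> = Suc j \<Longrightarrow>
          \<exists>a'\<in>carrier (P (Suc (Suc i))). a \<tau> = ?K' b \<tau> \<oplus>\<^bsub>P (Suc i)\<^esub> D (Suc i) a'"
        using step.IH[rule_format, of "Suc j" a] js a(1) by auto
      \<comment> \<open>The cochains \<open>c\<close> and \<open>D i (b _)\<close> have the same coboundary, so their difference is a cocycle of \<open>P i\<close>.\<close>
      define c' where "c' = (\<lambda>\<tau>. c \<tau> \<oplus>\<^bsub>P i\<^esub> (\<ominus>\<^bsub>R\<^esub> \<one>\<^bsub>R\<^esub>) \<odot>\<^bsub>P i\<^esub> D i (b \<tau>))"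
      have Db: "D i (b \<tau>) \<in> carrier (P i)" for \<tau> by (rule linear_mapsD(1)[OF D b])
      have c': "c' \<tau> \<in> carrier (P i)" for \<tau> using c Db by (simp add: c'_def)
      have Kc': "?K c' \<tau> = \<zero>\<^bsub>P i\<^esub>" if \<tau>: "\<tau> \<subseteq> set us" "card \<tau> = Suc j" for \<tau>
      proof -
        obtain a' where a': "a' \<in> carrier (P (Suc (Suc i)))" "a \<tau> = ?K' b \<tau> \<oplus>\<^bsub>P (Suc i)\<^esub> D (Suc i) a'"
          using ab[OF \<tau>] by blast
        have "D (Suc i) a' \<in> {y \<in> carrier (P (Suc i)). D i y = \<zero>\<^bsub>P i\<^esub>}"
          unfolding exact[symmetric] using a'(1) by blast
        then have "D i (a \<tau>) = D i (?K' b \<tau>)"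
          using linear_mapsD(1,2)[OF D[of i]] Pj.koszul_closed[OF x b] by (simp add: a'(2))
        also have "\<dots> = ?K (\<lambda>\<rho>. D i (b \<rho>)) \<tau>" by (rule koszul_linear[OF P P D x b])
        finally have eq: "?K c \<tau> = ?K (\<lambda>\<rho>. D i (b \<rho>)) \<tau>" using a(2)[OF \<tau>] by simp
        have "?K c' \<tau> = ?K c \<tau> \<oplus>\<^bsub>P i\<^esub> (\<ominus>\<^bsub>R\<^esub> \<one>\<^bsub>R\<^esub>) \<odot>\<^bsub>P i\<^esub> ?K (\<lambda>\<rho>. D i (b \<rho>)) \<tau>"
          using x c Db by (simp add: c'_def Pi.koszul_add Pi.koszul_smult)
        then show ?thesis
          unfolding eq using Pi.koszul_closed[OF x Db] by (simp add: Pi.smult_uminus_one Pi.M.r_neg)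
      qed
      have "j < s" using js step.hyps by linarith
      then obtain b' where b': "\<And>\<tau>. b' \<tau> \<in> carrier (P i)"
        "\<And>\<tau>. \<tau> \<subseteq> set us \<Longrightarrow> card \<tau> = j \<Longrightarrow> c' \<tau> = ?K b' \<tau>"
        using koszul_vanishesE[OF vanP[of j i] c' Kc'] by blast
      have cb': "c \<tau> = ?K b' \<tau> \<oplus>\<^bsub>P i\<^esub> D i (b \<tau>)" if "\<tau> \<subseteq> set us" "card \<tau> = j" for \<tau>
        using b'(2)[OF that, symmetric] c Db
        by (simp add: c'_def Pi.smult_uminus_one Pi.M.a_assoc Pi.M.l_neg)
      show "\<exists>b. (\<forall>\<tau>. b \<tau> \<in> carrier (P i)) \<and> (\<forall>\<tau>. \<tau> \<subseteq> set us \<longrightarrow> card \<tau> = j \<longrightarrow>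
        (\<exists>a\<in>carrier (P (Suc i)). c \<tau> = ?K b \<tau> \<oplus>\<^bsub>P i\<^esub> D i a))"
      proof (rule exI[of _ b'], intro conjI allI impI)
        show "b' \<tau> \<in> carrier (P i)" for \<tau> by (rule b'(1))
        show "\<exists>a\<in>carrier (P (Suc i)). c \<tau> = ?K b' \<tau> \<oplus>\<^bsub>P i\<^esub> D i a"
          if "\<tau> \<subseteq> set us" "card \<tau> = j" for \<tau>
          by (rule bexI[of _ "b \<tau>"], rule cb'[OF that], rule b)
      qed
    qed
  qed
  show ?thesis
    unfolding koszul_vanishes_def
  proof (intro allI impI)
    interpret P0: Module.module R "P 0" by (rule P)
    interpret M: Module.module R M by (rule M)
    let ?K = "koszul x R (P 0) us"
    fix c assume c: "\<forall>\<tau>. c \<tau> \<in> carrier M"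
      and cocycle: "\<forall>\<tau>. \<tau> \<subseteq> set us \<longrightarrow> card \<tau> = Suc j \<longrightarrow> koszul x R M us c \<tau> = \<zero>\<^bsub>M\<^esub>"
    have "\<forall>\<tau>. \<exists>y. y \<in> carrier (P 0) \<and> c \<tau> = e y" using c onto by (metis imageE)
    from choice[OF this] obtain c0 where
      c0: "\<And>\<tau>. c0 \<tau> \<in> carrier (P 0)" "\<And>\<tau>. c \<tau> = e (c0 \<tau>)" by blast
    then have c_eq: "c = (\<lambda>\<tau>. e (c0 \<tau>))" by auto
    have "\<exists>a\<in>carrier (P (Suc 0)). ?K c0 \<tau> = D 0 a" if "\<tau> \<subseteq> set us" "card \<tau> = Suc j" for \<tau>
    proof -
      have "e (?K c0 \<tau>) = \<zero>\<^bsub>M\<^esub>"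
        using koszul_linear[OF P M e x, of c0 \<tau>, OF c0(1)] cocycle that by (simp add: c_eq)
      then have "?K c0 \<tau> \<in> D 0 ` carrier (P 1)"
        unfolding exact0 using P0.koszul_closed[OF x c0(1)] by simp
      then show ?thesis by auto
    qed
    then obtain b where b: "\<And>\<tau>. b \<tau> \<in> carrier (P 0)" and
      cb: "\<And>\<tau>. \<tau> \<subseteq> set us \<Longrightarrow> card \<tau> = j \<Longrightarrow> \<exists>a\<in>carrier (P (Suc 0)). c0 \<tau> = ?K b \<tau> \<oplus>\<^bsub>P 0\<^esub> D 0 a"
      using claim[of 0, rule_format, of j c0] j c0(1) by auto
    have ceb: "c \<tau> = koszul x R M us (\<lambda>\<tau>. e (b \<tau>)) \<tau>" if \<tau>: "\<tau> \<subseteq> set us" "card \<tau> = j" for \<tau>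
    proof -
      obtain a where a: "a \<in> carrier (P 1)" "c0 \<tau> = ?K b \<tau> \<oplus>\<^bsub>P 0\<^esub> D 0 a" using cb[OF \<tau>] by auto
      have "D 0 a \<in> {y \<in> carrier (P 0). e y = \<zero>\<^bsub>M\<^esub>}" unfolding exact0[symmetric] using a(1) by blast
      then have "e (c0 \<tau>) = e (?K b \<tau>)"
        using linear_mapsD(1,2)[OF e] P0.koszul_closed[OF x b] by (simp add: a(2))
      then show ?thesis by (simp add: c_eq koszul_linear[OF P M e x, of b, OF b])
    qed
    show "\<exists>b. (\<forall>\<tau>. b \<tau> \<in> carrier M) \<and>
        (\<forall>\<tau>. \<tau> \<subseteq> set us \<longrightarrow> card \<tau> = j \<longrightarrow> c \<tau> = koszul x R M us b \<tau>)"
      by (rule exI[of _ "\<lambda>\<tau>. e (b \<tau>)"], intro conjI allI impI linear_mapsD(1)[OF e b] ceb)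
  qed
qed

section \<open>Koszul cohomology of the polynomial ring\<close>

abbreviation poly_koszul ::
    "'v set \<Rightarrow> 'v list \<Rightarrow> ('v set \<Rightarrow> ('v, 'k::field) mpoly) \<Rightarrow> 'v set \<Rightarrow> ('v, 'k) mpoly" where
  "poly_koszul V \<equiv> koszul var (mpoly_ring V) (ring_module (mpoly_ring V))"

lemma poly_koszul_Nil: "poly_koszul V [] c \<tau> = 0"
  by (simp add: ring_module_def mpoly_ring_sel)

text \<open>
  The recursion in terms of the operations of the polynomial type; it replaces the defining equations
  in what follows.
\<close>

lemma poly_koszul_Cons:
  "poly_koszul V (u # us) c \<tau> =
    (if u \<in> \<tau> then var u * c (\<tau> - {u}) - poly_koszul V us (\<lambda>\<rho>. c (insert u \<rho>)) (\<tau> - {u})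
     else poly_koszul V us c \<tau>)"
proof -
  have "\<ominus>\<^bsub>mpoly_ring V\<^esub> (1 :: ('a, 'b) mpoly) = - 1"
    by (rule mpoly_ring_a_inv) (simp add: carrier_mpoly_ring)
  then show ?thesis by (simp add: ring_module_def mpoly_ring_sel)
qed

lemma poly_koszul_lin:
  "poly_koszul V us (\<lambda>\<rho>. a * c \<rho> + a' * c' \<rho>) \<tau> = a * poly_koszul V us c \<tau> + a' * poly_koszul V us c' \<tau>"
  by (induction us arbitrary: c c' \<tau>)
    (simp_all add: poly_koszul_Nil poly_koszul_Cons algebra_simps del: koszul.simps)

lemma poly_koszul_uminus: "poly_koszul V us (\<lambda>\<rho>. - c \<rho>) \<tau> = - poly_koszul V us c \<tau>"
  using poly_koszul_lin[of V us "- 1" c 0 c \<tau>] by simp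

text \<open>
  This lemma and the next one identify the top coboundaries, the values of the differential at
  \<open>set us\<close>, with the ideal generated by the variables in \<open>us\<close>.
\<close>

lemma poly_koszul_in_var_ideal:
  fixes c :: "'v set \<Rightarrow> ('v, 'k::field) mpoly"
  assumes "set us \<subseteq> V" and c: "\<And>\<tau>. c \<tau> \<in> nonface_polys V {}"
  shows "poly_koszul V us c \<tau> \<in> nonface_polys V {\<sigma>. \<sigma> \<inter> set us = {}}"
  using assms
proof (induction us arbitrary: c \<tau>)
  case Nil
  show ?case by (simp add: poly_koszul_Nil del: koszul.simps)
next
  case (Cons u us)
  let ?J = "nonface_polys V {\<sigma>. \<sigma> \<inter> set (u # us) = {}} :: ('v, 'k) mpoly set"
  have "nonface_polys V {\<sigma>. \<sigma> \<inter> set us = {}} \<subseteq> ?J"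
    by (rule nonface_polys_antimono) auto
  then have tail: "poly_koszul V us d \<sigma> \<in> ?J" if "\<And>\<tau>. d \<tau> \<in> nonface_polys V {}" for d \<sigma>
    using Cons.IH[of d \<sigma>] Cons.prems(1) that by auto
  have "var u * p \<in> ?J" if "p \<in> nonface_polys V {}" for p
    using Cons.prems that by (subst var_times_in_nonface_polys) (auto simp: nonface_polys_def)
  then have "var u * c (\<tau> - {u}) - poly_koszul V us (\<lambda>\<rho>. c (insert u \<rho>)) (\<tau> - {u}) \<in> ?J"
    by (rule nonface_polys_diff) (use Cons.prems tail in auto)
  then show ?case using tail Cons.prems(2) unfolding poly_koszul_Cons by (simp del: koszul.simps)
qed

lemma var_ideal_poly_koszul:
  assumes "distinct us" "p \<in> nonface_polys V {\<sigma>. \<sigma> \<inter> set us = {}}"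
  shows "\<exists>b. (\<forall>\<tau>. b \<tau> \<in> nonface_polys V {}) \<and> p = poly_koszul V us b (set us)"
  using assms
proof (induction us arbitrary: p)
  case Nil
  have "p = 0" by (subst keys_eq_empty[symmetric]) (use Nil in \<open>auto simp: nonface_polys_def\<close>)
  then show ?case by (intro exI[of _ "\<lambda>_. 0"]) (simp add: poly_koszul_Nil del: koszul.simps)
next
  case (Cons u us)
  obtain p1 p2 where split: "p = p1 + p2"
    "Poly_Mapping.keys p1 = {t \<in> Poly_Mapping.keys p. u \<in> Poly_Mapping.keys t}"
    "Poly_Mapping.keys p2 = {t \<in> Poly_Mapping.keys p. u \<notin> Poly_Mapping.keys t}"
    by (rule keys_restrict_split)
  obtain q where q: "p1 = var u * q" by (rule var_dvd[of p1 u]) (use split in auto)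
  have "var u * q \<in> nonface_polys V {}" using split(2) Cons.prems(2) q by (auto simp: nonface_polys_def)
  then have "q \<in> nonface_polys V {}" by (rule var_times_in_polysD)
  moreover have "p2 \<in> nonface_polys V {\<sigma>. \<sigma> \<inter> set us = {}}"
    using Cons.prems(2) split(3) by (auto simp: nonface_polys_def)
  then obtain b where b: "\<And>\<tau>. b \<tau> \<in> nonface_polys V {}" "p2 = poly_koszul V us b (set us)"
    using Cons.IH Cons.prems(1) by (metis distinct.simps(2))
  define b' where "b' = (\<lambda>\<tau>. if u \<in> \<tau> then - b (\<tau> - {u}) else q)"
  have u: "u \<notin> set us" using Cons.prems by simp
  have "poly_koszul V us (\<lambda>\<rho>. b' (insert u \<rho>)) (set us) = poly_koszul V us (\<lambda>\<rho>. - b \<rho>) (set us)"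
    by (rule koszul_cong) (use u in \<open>simp add: b'_def\<close>)
  then have "p = poly_koszul V (u # us) b' (set (u # us))"
    using u unfolding poly_koszul_Cons
    by (simp add: split(1) b(2) q poly_koszul_uminus b'_def del: koszul.simps)
  moreover have "b' \<tau> \<in> nonface_polys V {}" for \<tau> using b(1) calculation(1) by (simp add: b'_def)
  ultimately show ?case by blast
qed

text \<open>
  A variable is not a zero divisor modulo other variables: multiplying a monomial by \<open>u\<close> does not
  make it divisible by any further variable.
\<close>

lemma var_regular_mod_vars:
  assumes us: "distinct us" "set us \<subseteq> V" and u: "u \<in> V" "u \<notin> set us"
    and b: "\<And>\<tau>. b \<tau> \<in> nonface_polys V {}" and m: "m \<in> nonface_polys V {}"
    and eq: "var u * m = poly_koszul V us b (set us)"
  shows "\<exists>b'. (\<forall>\<tau>. b' \<tau> \<in> nonface_polys V {}) \<and> m = poly_koszul V us b' (set us)"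
proof (rule var_ideal_poly_koszul[OF us(1)])
  have "var u * m \<in> nonface_polys V {\<sigma>. \<sigma> \<inter> set us = {}}"
    unfolding eq by (rule poly_koszul_in_var_ideal[OF us(2) b])
  then show "m \<in> nonface_polys V {\<sigma>. \<sigma> \<inter> set us = {}}"
    unfolding var_times_in_nonface_polys[OF u(1)] using u(2) by (auto simp: nonface_polys_def)
qed

text \<open>
  Variables form a regular sequence. For a cocycle \<open>c\<close> and the first variable \<open>u\<close>, the restriction of \<open>c\<close>
  to sets without \<open>u\<close> is a cocycle for the shorter list, hence a coboundary of some \<open>b1\<close>; only in
  its top degree does this need that \<open>u\<close> is a nonzerodivisor modulo the other variables. After correction by \<open>b1\<close>, the part
  of \<open>c\<close> on sets containing \<open>u\<close> is a cocycle one degree lower, a coboundary of some \<open>b2\<close>.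
\<close>

lemma koszul_vanishes_mpoly_ring:
  assumes "distinct us" "set us \<subseteq> V" "j < length us"
  shows "koszul_vanishes var (mpoly_ring V :: ('v, 'k::field) mpoly ring) (ring_module (mpoly_ring V)) us j"
  using assms
proof (induction us arbitrary: j)
  case Nil
  then show ?case by simp
next
  case (Cons u us)
  let ?R = "nonface_polys V {} :: ('v, 'k) mpoly set"
  let ?K = "poly_koszul V us" and ?K' = "poly_koszul V (u # us)"
  have N: "carrier (ring_module (mpoly_ring V)) = ?R" "\<zero>\<^bsub>ring_module (mpoly_ring V)\<^esub> = (0 :: ('v, 'k) mpoly)"
    by (simp_all add: ring_module_def carrier_mpoly_ring mpoly_ring_sel)
  have u: "u \<notin> set us" "u \<in> V" and us: "distinct us" "set us \<subseteq> V" using Cons.prems by auto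
  have IH: "\<exists>b. (\<forall>\<tau>. b \<tau> \<in> ?R) \<and> (\<forall>\<tau>. \<tau> \<subseteq> set us \<longrightarrow> card \<tau> = i \<longrightarrow> c \<tau> = ?K b \<tau>)"
    if "i < length us" "\<And>\<tau>. c \<tau> \<in> ?R" "\<And>\<tau>. \<tau> \<subseteq> set us \<Longrightarrow> card \<tau> = Suc i \<Longrightarrow> ?K c \<tau> = 0" for i c
    using Cons.IH[OF us that(1)] that(2,3) unfolding koszul_vanishes_def N by blast
  have fin: "finite \<tau>" if "\<tau> \<subseteq> set us" for \<tau> using that finite_subset by blast
  show ?case
    unfolding koszul_vanishes_def N
  proof (intro allI impI)
    fix c :: "'v set \<Rightarrow> ('v, 'k) mpoly"
    assume c: "\<forall>\<tau>. c \<tau> \<in> ?R" and cocycle: "\<forall>\<tau>. \<tau> \<subseteq> set (u # us) \<longrightarrow> card \<tau> = Suc j \<longrightarrow> ?K' c \<tau> = 0"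
    define cu where "cu = (\<lambda>\<rho>. c (insert u \<rho>))"
    have cu: "cu \<tau> \<in> ?R" for \<tau> using c by (simp add: cu_def)
    have c1: "?K c \<tau> = 0" if "\<tau> \<subseteq> set us" "card \<tau> = Suc j" for \<tau>
    proof -
      have "u \<notin> \<tau>" using that u by auto
      moreover have "?K' c \<tau> = 0" using cocycle that by (auto simp del: koszul.simps)
      ultimately show ?thesis unfolding poly_koszul_Cons by (simp del: koszul.simps)
    qed
    have c2: "var u * c \<tau> = ?K cu \<tau>" if "\<tau> \<subseteq> set us" "card \<tau> = j" for \<tau>
    proof -
      have "u \<notin> \<tau>" using that u by auto
      moreover have "?K' c (insert u \<tau>) = 0"
        by (rule cocycle[rule_format]) (use that \<open>u \<notin> \<tau>\<close> fin[OF that(1)] in auto)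
      ultimately show ?thesis unfolding poly_koszul_Cons by (simp add: cu_def del: koszul.simps)
    qed
    have "\<exists>b. (\<forall>\<tau>. b \<tau> \<in> ?R) \<and> (\<forall>\<tau>. \<tau> \<subseteq> set us \<longrightarrow> card \<tau> = j \<longrightarrow> c \<tau> = ?K b \<tau>)"
    proof (cases "j < length us")
      case True
      show ?thesis by (rule IH[OF True]) (use c c1 in auto)
    next
      case False
      then have j: "j = card (set us)" using Cons.prems by (simp add: distinct_card)
      have "\<exists>b. (\<forall>\<tau>. b \<tau> \<in> ?R) \<and> c (set us) = ?K b (set us)"
        by (rule var_regular_mod_vars[OF us u(2,1) cu _ c2]) (use c j in auto)
      moreover have "\<tau> = set us" if "\<tau> \<subseteq> set us" "card \<tau> = j" for \<tau>
        using that card_subset_eq[of "set us" \<tau>] j by simp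
      ultimately show ?thesis by metis
    qed
    then obtain b1 where b1: "\<And>\<tau>. b1 \<tau> \<in> ?R" "\<And>\<tau>. \<tau> \<subseteq> set us \<Longrightarrow> card \<tau> = j \<Longrightarrow> c \<tau> = ?K b1 \<tau>"
      by blast
    \<comment> \<open>The part of \<open>c\<close> on sets containing \<open>u\<close>, corrected by the contribution of \<open>b1\<close>.\<close>
    define g where "g = (\<lambda>\<rho>. 1 * cu \<rho> + (- var u) * b1 \<rho>)"
    have varR: "var u * p \<in> ?R" if "p \<in> ?R" for p
      using that u(2) by (subst var_times_in_nonface_polys) (auto simp: nonface_polys_def)
    have gR: "g \<tau> \<in> ?R" for \<tau>
      using nonface_polys_diff[OF cu varR[OF b1(1)]] by (simp add: g_def)
    have Kg: "?K g \<tau> = 0" if "\<tau> \<subseteq> set us" "card \<tau> = j" for \<tau>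
    proof -
      have "?K g \<tau> = 1 * ?K cu \<tau> + (- var u) * ?K b1 \<tau>" unfolding g_def by (rule poly_koszul_lin)
      also have "?K b1 \<tau> = c \<tau>" using b1(2)[OF that] by simp
      also have "1 * ?K cu \<tau> + (- var u) * c \<tau> = 0" using c2[OF that] by (simp del: koszul.simps)
      finally show ?thesis .
    qed
    have "\<exists>b2. (\<forall>\<tau>. b2 \<tau> \<in> ?R) \<and> (\<forall>\<tau>. \<tau> \<subseteq> set us \<longrightarrow> Suc (card \<tau>) = j \<longrightarrow> g \<tau> = ?K b2 \<tau>)"
    proof (cases j)
      case 0
      then show ?thesis by (intro exI[of _ "\<lambda>_. 0"]) simp
    next
      case (Suc i)
      then have "i < length us" using Cons.prems by simp
      from IH[OF this gR] Kg Suc show ?thesis by (simp del: koszul.simps)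
    qed
    then obtain b2 where b2: "\<And>\<tau>. b2 \<tau> \<in> ?R"
      "\<And>\<tau>. \<tau> \<subseteq> set us \<Longrightarrow> Suc (card \<tau>) = j \<Longrightarrow> g \<tau> = ?K b2 \<tau>" by blast
    define b where "b = (\<lambda>\<tau>. if u \<in> \<tau> then - b2 (\<tau> - {u}) else b1 \<tau>)"
    have "c \<tau> = ?K' b \<tau>" if \<tau>: "\<tau> \<subseteq> set (u # us)" "card \<tau> = j" for \<tau>
    proof (cases "u \<in> \<tau>")
      case False
      have "?K b \<tau> = ?K b1 \<tau>" by (rule koszul_cong) (use False in \<open>simp add: b_def\<close>)
      then show ?thesis
        using False \<tau> b1(2)[of \<tau>] unfolding poly_koszul_Cons by (auto simp del: koszul.simps)
    next
      case True
      define \<rho> where "\<rho> = \<tau> - {u}"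
      have fin\<tau>: "finite \<tau>" using \<tau> finite_subset by blast
      have \<rho>: "\<rho> \<subseteq> set us" "Suc (card \<rho>) = j" "insert u \<rho> = \<tau>" "u \<notin> \<rho>"
        using True \<tau> card_Suc_Diff1[OF fin\<tau> True] by (auto simp: \<rho>_def)
      have "?K (\<lambda>\<rho>. b (insert u \<rho>)) \<rho> = ?K (\<lambda>\<rho>. - b2 \<rho>) \<rho>"
        by (rule koszul_cong) (use \<rho>(4) in \<open>simp add: b_def\<close>)
      also have "\<dots> = - g \<rho>" using b2(2)[OF \<rho>(1,2)] by (simp add: poly_koszul_uminus del: koszul.simps)
      finally have "?K' b \<tau> = var u * b1 \<rho> + g \<rho>"
        using True \<rho>(4) unfolding poly_koszul_Cons by (simp add: \<rho>_def[symmetric] b_def del: koszul.simps)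
      also have "\<dots> = c \<tau>" by (simp add: g_def cu_def \<rho>(3))
      finally show ?thesis by simp
    qed
    moreover have "b \<tau> \<in> ?R" for \<tau> using b1(1) b2(1) by (simp add: b_def)
    ultimately show "\<exists>b. (\<forall>\<tau>. b \<tau> \<in> ?R) \<and> (\<forall>\<tau>. \<tau> \<subseteq> set (u # us) \<longrightarrow> card \<tau> = j \<longrightarrow> c \<tau> = ?K' b \<tau>)"
      by blast
  qed
qed

section \<open>Squarefree monomial ideals and separated vertex sets\<close>

lemma nonface_polys_ideal:
  fixes \<Gamma> :: "'v set set"
  assumes "down_closed \<Gamma>"
  shows "ideal (nonface_polys V \<Gamma>) (mpoly_ring V :: ('v, 'k::field) mpoly ring)"
proof -
  let ?S = "mpoly_ring V :: ('v, 'k) mpoly ring"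
  interpret S: cring ?S by (rule mpoly_ring_cring)
  have sub: "nonface_polys V \<Gamma> \<subseteq> carrier ?S"
    unfolding carrier_mpoly_ring by (rule nonface_polys_antimono) simp
  have closed: "p * q \<in> nonface_polys V \<Gamma>" if "p \<in> carrier ?S" "q \<in> nonface_polys V \<Gamma>" for p q
    using nonface_polys_mult[OF down_closedD[OF assms]] that by (simp add: carrier_mpoly_ring)
  show ?thesis
  proof (rule idealI)
    show "subgroup (nonface_polys V \<Gamma>) (add_monoid ?S)"
    proof (rule S.add.subgroupI)
      show "\<ominus>\<^bsub>?S\<^esub> a \<in> nonface_polys V \<Gamma>" if "a \<in> nonface_polys V \<Gamma>" for a
        using that sub by (simp add: mpoly_ring_a_inv subsetD)
      show "a \<oplus>\<^bsub>?S\<^esub> b \<in> nonface_polys V \<Gamma>" if "a \<in> nonface_polys V \<Gamma>" "b \<in> nonface_polys V \<Gamma>" for a b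
        using that by (simp add: mpoly_ring_sel nonface_polys_add)
      show "nonface_polys V \<Gamma> \<noteq> {}" using nonface_polys_basic(1) by blast
    qed (use sub in auto)
    show "x \<otimes>\<^bsub>?S\<^esub> a \<in> nonface_polys V \<Gamma>" if "a \<in> nonface_polys V \<Gamma>" "x \<in> carrier ?S" for a x
      using closed that by (simp add: mpoly_ring_sel)
    then show "a \<otimes>\<^bsub>?S\<^esub> x \<in> nonface_polys V \<Gamma>" if "a \<in> nonface_polys V \<Gamma>" "x \<in> carrier ?S" for a x
      using that by (simp add: mpoly_ring_sel mult.commute)
  qed (rule S.ring_axioms)
qed

lemma keys_prod_var:
  assumes "finite \<sigma>" "t \<in> Poly_Mapping.keys (\<Prod>v\<in>\<sigma>. var v :: ('v, 'k::field) mpoly)"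
  shows "Poly_Mapping.keys t = \<sigma>"
  using assms
proof (induction \<sigma> arbitrary: t rule: finite_induct)
  case empty
  then show ?case by simp
next
  case (insert v \<sigma>)
  then obtain u where "t = Poly_Mapping.single v 1 + u" "Poly_Mapping.keys u = \<sigma>"
    by (auto simp: keys_var_times)
  then show ?case by (simp add: keys_single_plus del: One_nat_def)
qed

text \<open>
  The variables are distinct, so they can be split off one after the other.
\<close>

lemma prod_var_dvd:
  fixes p :: "('v, 'k::field) mpoly"
  assumes "finite \<sigma>" "p \<in> nonface_polys V {}" "\<And>t. t \<in> Poly_Mapping.keys p \<Longrightarrow> \<sigma> \<subseteq> Poly_Mapping.keys t"
  shows "\<exists>q\<in>nonface_polys V {}. p = q * (\<Prod>v\<in>\<sigma>. var v)"
  using assms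
proof (induction \<sigma> arbitrary: p rule: finite_induct)
  case empty
  then show ?case by auto
next
  case (insert v \<sigma>)
  obtain q where q: "p = var v * q" by (rule var_dvd[of p v]) (use insert.prems in auto)
  have "\<sigma> \<subseteq> Poly_Mapping.keys t" if "t \<in> Poly_Mapping.keys q" for t
  proof -
    have "Poly_Mapping.single v 1 + t \<in> Poly_Mapping.keys p" using that by (simp add: q keys_var_times)
    from insert.prems(2)[OF this] show ?thesis
      using insert.hyps by (auto simp: keys_single_plus simp del: One_nat_def)
  qed
  moreover have "q \<in> nonface_polys V {}"
    by (rule var_times_in_polysD[of v]) (use insert.prems(1) q in simp)
  ultimately obtain q' where "q' \<in> nonface_polys V {}" "q = q' * (\<Prod>v\<in>\<sigma>. var v)"
    using insert.IH[of q] by blast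
  then show ?case using insert.hyps by (intro bexI[of _ q']) (simp_all add: q mult_ac)
qed

text \<open>
  A polynomial lies in a monomial ideal iff each of its monomials is divisible by a generator, and a
  squarefree generator divides a monomial iff its support is contained in that of the monomial.
\<close>

lemma squarefree_monomial_ideal:
  fixes V :: "'v set"
  assumes V: "finite V" and \<A>: "\<And>\<sigma>. \<sigma> \<in> \<A> \<Longrightarrow> \<sigma> \<subseteq> V"
    and \<Gamma>: "\<And>\<tau>. \<tau> \<subseteq> V \<Longrightarrow> \<tau> \<in> \<Gamma> \<longleftrightarrow> (\<forall>\<sigma>\<in>\<A>. \<not> \<sigma> \<subseteq> \<tau>)"
  shows "Idl\<^bsub>mpoly_ring V\<^esub> {\<Prod>v\<in>\<sigma>. var v |\<sigma>. \<sigma> \<in> \<A>} = (nonface_polys V \<Gamma> :: ('v, 'k::field) mpoly set)"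
    (is "?I = _")
proof
  interpret S: cring "mpoly_ring V :: ('v, 'k) mpoly ring" by (rule mpoly_ring_cring)
  define \<Gamma>' where "\<Gamma>' = {\<tau>. \<forall>\<sigma>\<in>\<A>. \<not> \<sigma> \<subseteq> \<tau>}"
  have eq: "nonface_polys V \<Gamma> = (nonface_polys V \<Gamma>' :: ('v, 'k) mpoly set)"
    using \<Gamma> unfolding nonface_polys_def \<Gamma>'_def by blast
  have gens: "(\<Prod>v\<in>\<sigma>. var v) \<in> (nonface_polys V \<Gamma> :: ('v, 'k) mpoly set)" if "\<sigma> \<in> \<A>" for \<sigma>
    using \<A>[OF that] \<Gamma>[OF \<A>[OF that]] that keys_prod_var[OF finite_subset[OF \<A>[OF that] V]]
    unfolding nonface_polys_def by blast
  have "nonface_polys V \<Gamma> \<subseteq> carrier (mpoly_ring V :: ('v, 'k) mpoly ring)"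
    unfolding carrier_mpoly_ring by (rule nonface_polys_antimono) simp
  then have gens_carrier: "{\<Prod>v\<in>\<sigma>. var v |\<sigma>. \<sigma> \<in> \<A>} \<subseteq> carrier (mpoly_ring V :: ('v, 'k) mpoly ring)"
    using gens by blast
  have "down_closed \<Gamma>'" unfolding down_closed_def \<Gamma>'_def by blast
  then have "ideal (nonface_polys V \<Gamma>) (mpoly_ring V :: ('v, 'k) mpoly ring)"
    unfolding eq by (rule nonface_polys_ideal)
  then show "?I \<subseteq> nonface_polys V \<Gamma>" by (rule S.genideal_minimal) (use gens in auto)
  interpret I: ideal ?I "mpoly_ring V :: ('v, 'k) mpoly ring" by (rule S.genideal_ideal[OF gens_carrier])
  show "nonface_polys V \<Gamma> \<subseteq> ?I"
  proof
    fix p :: "('v, 'k) mpoly" assume p: "p \<in> nonface_polys V \<Gamma>"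
    show "p \<in> ?I"
    proof (induction p rule: mpoly_sum_induct)
      case zero
      show ?case using I.zero_closed by (simp add: mpoly_ring_sel)
    next
      case (monomial t c)
      have t: "Poly_Mapping.keys t \<subseteq> V" "Poly_Mapping.keys t \<notin> \<Gamma>"
        using p monomial by (auto simp: nonface_polys_def)
      then obtain \<sigma> where \<sigma>: "\<sigma> \<in> \<A>" "\<sigma> \<subseteq> Poly_Mapping.keys t" using \<Gamma> by blast
      have "Poly_Mapping.single t c \<in> nonface_polys V {}" using t by (simp add: nonface_polys_def)
      moreover have "\<sigma> \<subseteq> Poly_Mapping.keys u" if "u \<in> Poly_Mapping.keys (Poly_Mapping.single t c)" for u
        using that \<sigma>(2) by (simp split: if_splits)
      ultimately obtain q where q: "q \<in> nonface_polys V {}" "Poly_Mapping.single t c = q * (\<Prod>v\<in>\<sigma>. var v)"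
        using prod_var_dvd[OF finite_subset[OF \<A>[OF \<sigma>(1)] V], of "Poly_Mapping.single t c" V] by blast
      have "(\<Prod>v\<in>\<sigma>. var v) \<in> ?I" using S.genideal_self[OF gens_carrier] \<sigma>(1) by blast
      then show ?case using I.I_l_closed[of _ q] q by (simp add: carrier_mpoly_ring mpoly_ring_sel)
    next
      case (sum q q')
      then show ?case using I.a_closed by (simp add: mpoly_ring_sel)
    qed
  qed
qed

lemma stanley_reisner_ideal_eq:
  assumes "simplicial_complex V \<Delta>"
  shows "stanley_reisner_ideal V \<Delta> = (nonface_polys V \<Delta> :: ('v, 'k::field) mpoly set)"
proof -
  have "Idl\<^bsub>mpoly_ring V\<^esub> {\<Prod>v\<in>\<sigma>. var v |\<sigma>. \<sigma> \<in> {\<sigma>. \<sigma> \<subseteq> V \<and> \<sigma> \<notin> \<Delta>}} =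
      (nonface_polys V \<Delta> :: ('v, 'k) mpoly set)"
  proof (rule squarefree_monomial_ideal)
    fix \<tau> assume "\<tau> \<subseteq> V"
    moreover have "\<sigma> \<in> \<Delta>" if "\<tau> \<in> \<Delta>" "\<sigma> \<subseteq> \<tau>" for \<sigma>
      using assms that unfolding simplicial_complex_def by blast
    ultimately show "\<tau> \<in> \<Delta> \<longleftrightarrow> (\<forall>\<sigma>\<in>{\<sigma>. \<sigma> \<subseteq> V \<and> \<sigma> \<notin> \<Delta>}. \<not> \<sigma> \<subseteq> \<tau>)" by blast
  qed (use assms in \<open>simp_all add: simplicial_complex_def\<close>)
  then show ?thesis by (simp add: stanley_reisner_ideal_def)
qed

text \<open>
  Hypothesis \<open>flag\<close> says that \<open>E\<close> consists of non-faces among which are all minimal ones.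
\<close>

lemma edge_ideal_eq:
  assumes V: "finite V" and E: "\<And>e. e \<in> E \<Longrightarrow> e \<subseteq> V \<and> card e = 2"
    and flag: "\<And>\<tau>. \<tau> \<subseteq> V \<Longrightarrow> \<tau> \<in> \<Gamma> \<longleftrightarrow> (\<forall>e\<in>E. \<not> e \<subseteq> \<tau>)"
  shows "edge_ideal V E = (nonface_polys V \<Gamma> :: ('v, 'k::field) mpoly set)"
proof -
  have "{var i * var j |i j. {i, j} \<in> E} = ({\<Prod>v\<in>e. var v |e. e \<in> E} :: ('v, 'k) mpoly set)"
  proof safe
    fix i j assume e: "{i, j} \<in> E"
    then have "i \<noteq> j" using E[OF e] by auto
    then show "\<exists>e. var i * var j = (\<Prod>v\<in>e. var v) \<and> e \<in> E" using e by (intro exI[of _ "{i, j}"]) simp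
  next
    fix e assume e: "e \<in> E"
    then obtain i j where "e = {i, j}" "i \<noteq> j" using E[OF e] by (auto simp: card_2_iff)
    then show "\<exists>i j. (\<Prod>v\<in>e. var v) = var i * var j \<and> {i, j} \<in> E" using e by (intro exI[of _ i] exI[of _ j]) simp
  qed
  then show ?thesis
    unfolding edge_ideal_def using squarefree_monomial_ideal[OF V _ flag] E by simp
qed

lemma poly_koszul_singleton:
  assumes "distinct us" "v \<in> set us"
  shows "poly_koszul V us c {v} = var v * c {}"
  using assms
proof (induction us)
  case (Cons u us)
  have "poly_koszul V ws d {} = 0" for ws d
    by (induction ws) (simp_all add: poly_koszul_Nil poly_koszul_Cons del: koszul.simps)
  then show ?case using Cons unfolding poly_koszul_Cons by (auto simp del: koszul.simps)
qed simp

lemma poly_koszul_pair: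
  assumes "distinct us" "u \<in> set us" "v \<in> set us" "u \<noteq> v"
  shows "poly_koszul V us c {u, v} = var u * c {v} - var v * c {u} \<or>
    poly_koszul V us c {u, v} = var v * c {u} - var u * c {v}"
  using assms
proof (induction us)
  case (Cons w us)
  consider "w = u" | "w = v" | "w \<noteq> u" "w \<noteq> v" by blast
  then show ?case
  proof cases
    case 1
    then have "{u, v} - {w} = {v}" "v \<in> set us" using Cons.prems by auto
    then show ?thesis using 1 Cons.prems poly_koszul_singleton[of us v V "\<lambda>\<rho>. c (insert u \<rho>)"]
      unfolding poly_koszul_Cons by (simp del: koszul.simps)
  next
    case 2
    then have "{u, v} - {w} = {u}" "u \<in> set us" using Cons.prems by auto
    then show ?thesis using 2 Cons.prems poly_koszul_singleton[of us u V "\<lambda>\<rho>. c (insert v \<rho>)"]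
      unfolding poly_koszul_Cons by (simp del: koszul.simps)
  next
    case 3
    then show ?thesis using Cons unfolding poly_koszul_Cons by (simp del: koszul.simps)
  qed
qed simp

text \<open>
  In the face ring \<open>M\<close>, let \<open>c\<close> be the 1-cochain with value \<open>a\<close>, read as a variable, at \<open>a \<in> A\<close> and
  \<open>0\<close> on \<open>B\<close>. Products of variables from \<open>A\<close> and from \<open>B\<close> vanish in \<open>M\<close>, so \<open>c\<close> is a cocycle.
  If it were the coboundary of an element \<open>m\<close>, comparing the coefficients of the variables in
  \<open>A\<close> and \<open>B\<close>, all of which are nonzero in \<open>M\<close>, would give two different constant coefficients of \<open>m\<close>.
\<close>

lemma proj_dim_ge_separated:
  fixes V :: "'v set" and \<Delta> :: "'v set set"
  defines "S \<equiv> mpoly_ring V :: ('v, 'k::field) mpoly ring"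
  assumes V: "finite V" and \<Delta>: "down_closed \<Delta>" and verts: "\<And>v. v \<in> V \<Longrightarrow> {v} \<in> \<Delta>"
    and A: "A \<subseteq> V" "A \<noteq> {}" and B: "B \<subseteq> V" "B \<noteq> {}" and AB: "A \<inter> B = {}"
    and sep: "\<And>\<sigma>. \<sigma> \<in> \<Delta> \<Longrightarrow> \<sigma> \<inter> A = {} \<or> \<sigma> \<inter> B = {}"
  shows "enat (card (A \<union> B) - 1) \<le> proj_dim S (quot_algebra S (nonface_polys V \<Delta>))"
proof -
  define I where "I = (nonface_polys V \<Delta> :: ('v, 'k) mpoly set)"
  define M where "M = quot_algebra S I"
  have "card (A \<union> B) - 1 \<le> d"
    if res: "projective_resolution S M d P D e"
    for d and P :: "nat \<Rightarrow> (('v, 'k) mpoly, nat \<times> ('v, 'k) mpoly set \<Rightarrow> ('v, 'k) mpoly) module" and D e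
  proof (rule ccontr)
    assume d: "\<not> card (A \<union> B) - 1 \<le> d"
    interpret S: cring S unfolding S_def by (rule mpoly_ring_cring)
    have ideal: "ideal I S" unfolding I_def S_def by (rule nonface_polys_ideal[OF \<Delta>])
    interpret I: ideal I S by (rule ideal)
    have M: "Module.module S M" unfolding M_def by (rule quot_algebra_module[OF ideal S.is_cring])
    let ?N = "ring_module S"
    have N: "Module.module S ?N" by (rule ring_module_module[OF S.is_cring])
    obtain us where us: "distinct us" "set us = A \<union> B"
      using finite_distinct_list[of "A \<union> B"] A(1) B(1) V finite_subset by (metis finite_UnI)
    have len: "length us = card (A \<union> B)" using us distinct_card by fastforce
    have usV: "set us \<subseteq> V" using us A B by auto
    have carr: "carrier ?N = nonface_polys V {}" by (simp add: ring_module_def S_def carrier_mpoly_ring)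
    have var: "var v \<in> (nonface_polys V {} :: ('v, 'k) mpoly set)" if "v \<in> V" for v
      using that var_times_in_nonface_polys[of v V 1 "{}"] by simp
    have var_carrier: "var \<in> set us \<rightarrow> carrier S"
      using var usV by (auto simp: S_def carrier_mpoly_ring)
    have van: "koszul_vanishes var S M us 1"
    proof (rule koszul_vanishes_resolution[OF S.is_cring M var_carrier _ res])
      show "koszul_vanishes var S ?N us j" if "j < length us" for j
        unfolding S_def by (rule koszul_vanishes_mpoly_ring[OF us(1) usV that])
      show "1 + d < length us" using d len by linarith
    qed
    define q where "q p = I +>\<^bsub>S\<^esub> p" for p
    have hom: "q \<in> ring_hom S (S Quot I)"
      using I.rcos_ring_hom by (simp add: q_def[abs_def])
    have q: "q \<in> linear_maps S ?N M"
      using ring_hom_closed[OF hom] ring_hom_add[OF hom] ring_hom_mult[OF hom]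
      by (auto simp: linear_maps_def M_def quot_algebra_def ring_module_def q_def)
    have q_eq: "q a = q b \<longleftrightarrow> a - b \<in> I" if "a \<in> nonface_polys V {}" "b \<in> nonface_polys V {}" for a b
      using S.quotient_eq_iff_same_a_r_cos[OF ideal, of a b] that
      by (simp add: q_def S_def carrier_mpoly_ring mpoly_ring_minus)
    have q_zero: "q 0 = \<zero>\<^bsub>M\<^esub>" using linear_maps_zero[OF N M q] by (simp add: ring_module_def S_def mpoly_ring_sel)
    define f where "f v = (if v \<in> A then var v else 0 :: ('v, 'k) mpoly)" for v
    define c where "c \<tau> = (if \<exists>v\<in>V. \<tau> = {v} then f (THE v. \<tau> = {v}) else 0)" for \<tau>
    have f: "f v \<in> nonface_polys V {}" if "v \<in> V" for v using var[OF that] by (simp add: f_def)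
    have cv: "c {v} = f v" if "v \<in> V" for v using that by (simp add: c_def)
    have c: "c \<tau> \<in> carrier ?N" for \<tau>
      using f by (auto simp: c_def carr)
    have qc: "q (c \<tau>) \<in> carrier M" for \<tau> by (rule linear_mapsD(1)[OF q c])
    have kos: "q (poly_koszul V us b \<tau>) = koszul var S M us (\<lambda>\<rho>. q (b \<rho>)) \<tau>"
      if "\<And>\<tau>. b \<tau> \<in> carrier ?N" for b \<tau>
      using koszul_linear[OF N M q var_carrier, of b \<tau>, OF that] by (simp add: S_def)
    have "koszul var S M us (\<lambda>\<rho>. q (c \<rho>)) \<tau> = \<zero>\<^bsub>M\<^esub>" if \<tau>: "\<tau> \<subseteq> set us" "card \<tau> = Suc 1" for \<tau>
    proof -
      obtain u v where uv: "\<tau> = {u, v}" "u \<noteq> v" using \<tau>(2) by (auto simp: numeral_2_eq_2[symmetric] card_2_iff)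
      then have uv': "u \<in> set us" "v \<in> set us" using \<tau>(1) by auto
      have "var u * f v - var v * f u \<in> I"
      proof -
        have "var a * (var b :: ('v, 'k) mpoly) \<in> I" if "a \<in> A" "b \<in> B" for a b
        proof -
          have "{a, b} \<notin> \<Delta>" using sep[of "{a, b}"] that by auto
          moreover have "Poly_Mapping.keys t = {b}" if "t \<in> Poly_Mapping.keys (var b :: ('v, 'k) mpoly)" for t
            using keys_prod_var[of "{b}" t] that by simp
          moreover have "a \<in> V" "b \<in> V" using that A B by auto
          ultimately show ?thesis unfolding I_def by (subst var_times_in_nonface_polys) auto
        qed
        then have prods: "var a * (var b :: ('v, 'k) mpoly) \<in> I" "var b * (var a :: ('v, 'k) mpoly) \<in> I"
          if "a \<in> A" "b \<in> B" for a b using that by (simp_all add: mult.commute)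
        show ?thesis
        proof (cases "u \<in> A \<and> v \<in> A")
          case True
          then have "var u * f v - var v * f u = 0" by (simp add: f_def)
          then show ?thesis by (simp add: I_def)
        next
          case False
          then show ?thesis using uv' prods AB unfolding us(2) f_def by (auto simp: I_def)
        qed
      qed
      moreover from this have "var v * f u - var u * f v \<in> I"
        using nonface_polys_basic(3)[of "var u * f v - var v * f u" V \<Delta>] by (simp add: I_def)
      ultimately have "poly_koszul V us c \<tau> \<in> I"
        using poly_koszul_pair[OF us(1) uv' uv(2), of V c]
        unfolding uv(1) cv[OF subsetD[OF usV uv'(1)]] cv[OF subsetD[OF usV uv'(2)]] by auto
      then have "q (poly_koszul V us c \<tau>) = q 0"
        using I.a_subset by (subst q_eq) (auto simp: S_def carrier_mpoly_ring)
      then show ?thesis by (simp add: kos[OF c] q_zero)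
    qed
    from koszul_vanishesE[OF van, of "\<lambda>\<rho>. q (c \<rho>)", OF qc this] obtain b where b: "\<And>\<tau>. b \<tau> \<in> carrier M"
      "\<And>\<tau>. \<tau> \<subseteq> set us \<Longrightarrow> card \<tau> = 1 \<Longrightarrow> q (c \<tau>) = koszul var S M us b \<tau>" by blast
    have "\<forall>\<tau>. \<exists>p. p \<in> carrier ?N \<and> b \<tau> = q p"
      using b(1) by (auto simp: M_def quot_algebra_def FactRing_def A_RCOSETS_def RCOSETS_def a_r_coset_def
          q_def ring_module_def)
    from choice[OF this] obtain b' where b': "\<And>\<tau>. b' \<tau> \<in> carrier ?N" "\<And>\<tau>. b \<tau> = q (b' \<tau>)" by blast
    define m where "m = b' {}"
    have m: "m \<in> nonface_polys V {}" using b'(1) by (simp add: m_def carr)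
    have coeff: "Poly_Mapping.lookup (f v) (Poly_Mapping.single v 1) = Poly_Mapping.lookup m 0" if v: "v \<in> A \<union> B" for v
    proof -
      have vV: "v \<in> V" using v A B by auto
      have "q (f v) = q (poly_koszul V us b' {v})"
        using b(2)[of "{v}"] v us(2) cv[OF vV] by (simp add: kos[OF b'(1)] flip: b'(2))
      also have "poly_koszul V us b' {v} = var v * m"
        using poly_koszul_singleton[OF us(1)] v us(2) by (simp add: m_def del: koszul.simps)
      finally have "f v - var v * m \<in> I"
        using q_eq[of "f v" "var v * m"] f[OF vV] m nonface_polys_mult[of "{}" "var v" V m] var[OF vV] by simp
      then have "Poly_Mapping.single v 1 \<notin> Poly_Mapping.keys (f v - var v * m)"
        using verts[OF vV] by (auto simp: I_def nonface_polys_def)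
      then have "Poly_Mapping.lookup (f v) (Poly_Mapping.single v 1) =
          Poly_Mapping.lookup (var v * m) (Poly_Mapping.single v 1)"
        by (simp add: in_keys_iff lookup_minus)
      also have "\<dots> = Poly_Mapping.lookup m 0"
      proof -
        have "\<exists>u. Poly_Mapping.single v (1::nat) = Poly_Mapping.single v 1 + u"
          by (intro exI[of _ 0]) simp
        then show ?thesis unfolding var_def lookup_monomial_times by (simp del: One_nat_def)
      qed
      finally show ?thesis .
    qed
    obtain a0 b0 where ab: "a0 \<in> A" "b0 \<in> B" using A B by auto
    have "Poly_Mapping.lookup m 0 = 1" using coeff[of a0] ab by (simp add: f_def var_def)
    moreover have "b0 \<notin> A" using ab AB by blast
    then have "Poly_Mapping.lookup m 0 = 0" using coeff[of b0] ab by (simp add: f_def)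
    ultimately show False by simp
  qed
  then show ?thesis
    unfolding proj_dim_def M_def[symmetric] I_def[symmetric] by (intro Inf_greatest) auto
qed

section \<open>Simplices attached along simplices\<close>

lemma complex_dim_simplex:
  assumes "finite W"
  shows "complex_dim (simplex W) = int (card W) - 1"
  unfolding complex_dim_def
proof (rule Max_eqI)
  fix y assume "y \<in> (\<lambda>F. int (card F) - 1) ` Pow W"
  then obtain F where "y = int (card F) - 1" "F \<subseteq> W" by blast
  then show "y \<le> int (card W) - 1" using card_mono[OF assms, of F] by simp
qed (use assms in auto)

lemma down_closed_complex_of: "down_closed (complex_of \<F>)"
  unfolding down_closed_def complex_of_def by blast

lemma quasi_forest_seq_attach:
  assumes "quasi_forest_seq Fs"
  shows "(\<forall>F\<in>set Fs. finite F) \<and>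
    (\<forall>i. 1 \<le> i \<and> i < length Fs \<longrightarrow> is_simplex (complex_of (set (take i Fs)) \<inter> simplex (Fs ! i)))"
  using assms
proof (induction rule: quasi_forest_seq.induct)
  case (1 F)
  then show ?case by simp
next
  case (2 Fs F)
  have "is_simplex (complex_of (set (take i (Fs @ [F]))) \<inter> simplex ((Fs @ [F]) ! i))"
    if "1 \<le> i" "i < length (Fs @ [F])" for i
    using 2 that by (cases "i = length Fs") (auto simp: nth_append)
  then show ?case using 2 by auto
qed

text \<open>
  A quasi-forest with its facets in a witnessing order, where \<open>W i\<close> is the vertex set of the simplex
  along which the facet \<open>Fs ! i\<close> is attached.
\<close>

locale attached_simplices =
  fixes V :: "'v set" and Fs :: "'v set list" and W :: "nat \<Rightarrow> 'v set"
  assumes finite_V: "finite V" and two: "length Fs \<ge> 2"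
    and facet_sub: "i < length Fs \<Longrightarrow> Fs ! i \<subseteq> V"
    and antichain: "i < length Fs \<Longrightarrow> j < length Fs \<Longrightarrow> Fs ! i \<subseteq> Fs ! j \<Longrightarrow> i = j"
    and attach: "1 \<le> i \<Longrightarrow> i < length Fs \<Longrightarrow> complex_of (set (take i Fs)) \<inter> simplex (Fs ! i) = simplex (W i)"
begin

definition part :: "nat \<Rightarrow> 'v set set" where
  "part i = complex_of (set (take i Fs))"

lemma nonempty: "Fs \<noteq> []"
  using two by auto

lemma part_Suc: "i < length Fs \<Longrightarrow> part (Suc i) = part i \<union> Pow (Fs ! i)"
  by (auto simp: part_def complex_of_def take_Suc_conv_app_nth)

lemma part_1: "part 1 = Pow (Fs ! 0)"
proof -
  have "part 0 = {}" by (simp add: part_def complex_of_def)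
  then show ?thesis using part_Suc[of 0] nonempty by simp
qed

lemma part_iff: "i \<le> length Fs \<Longrightarrow> \<sigma> \<in> part i \<longleftrightarrow> (\<exists>j<i. \<sigma> \<subseteq> Fs ! j)"
proof (induction i)
  case 0
  then show ?case by (simp add: part_def complex_of_def)
next
  case (Suc i)
  then show ?case by (auto simp: part_Suc less_Suc_eq)
qed

lemma part_down: "\<sigma> \<in> part i \<Longrightarrow> \<tau> \<subseteq> \<sigma> \<Longrightarrow> \<tau> \<in> part i"
  using down_closedD[OF down_closed_complex_of] unfolding part_def by blast

lemma attach_part: "1 \<le> i \<Longrightarrow> i < length Fs \<Longrightarrow> part i \<inter> Pow (Fs ! i) = Pow (W i)"
  using attach by (simp add: part_def)

lemma W_part:
  assumes "1 \<le> i" "i < length Fs"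
  shows "W i \<in> part i" "W i \<subseteq> Fs ! i" "W i \<noteq> Fs ! i" "finite (W i)" "card (W i) < card (Fs ! i)"
proof -
  have mem: "W i \<in> part i \<inter> Pow (Fs ! i)" unfolding attach_part[OF assms] by simp
  then show 1: "W i \<in> part i" "W i \<subseteq> Fs ! i" by auto
  show ne: "W i \<noteq> Fs ! i"
  proof
    assume "W i = Fs ! i"
    then obtain j where "j < i" "Fs ! i \<subseteq> Fs ! j" using 1 part_iff[of i] assms by auto
    then show False using antichain[of i j] assms by simp
  qed
  have "finite (Fs ! i)" using facet_sub finite_V assms finite_subset by blast
  then show "finite (W i)" "card (W i) < card (Fs ! i)"
    using 1 ne finite_subset by (auto intro: psubset_card_mono)
qed

text \<open>
  If an earlier face contained \<open>v\<close>, then \<open>{v}\<close> would lie in the intersection \<open>simplex (W i)\<close>.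
\<close>

lemma new_vertex:
  assumes i: "1 \<le> i" "i < length Fs" and v: "v \<in> Fs ! i" "v \<notin> W i"
  shows "\<sigma> \<in> part i \<Longrightarrow> v \<notin> \<sigma>"
proof
  assume "\<sigma> \<in> part i" "v \<in> \<sigma>"
  then have "{v} \<in> part i \<inter> Pow (Fs ! i)" using v part_down[of \<sigma> i "{v}"] by auto
  then show False using v unfolding attach_part[OF i] by simp
qed

text \<open>
  A clique with a vertex in \<open>Fs ! k - W k\<close> lies in \<open>Fs ! k\<close>, as all edges at a new vertex do. Any other
  clique has all its edges in the previous complex.
\<close>

lemma flag:
  assumes "1 \<le> k" "k \<le> length Fs" "\<And>a b. a \<in> \<sigma> \<Longrightarrow> b \<in> \<sigma> \<Longrightarrow> {a, b} \<in> part k"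
  shows "\<sigma> \<in> part k"
  using assms
proof (induction k rule: dec_induct)
  case base
  then show ?case unfolding part_1 by fastforce
next
  case (step k)
  have k: "1 \<le> k" "k < length Fs" using step by auto
  show ?case
  proof (cases "\<exists>v\<in>\<sigma>. v \<in> Fs ! k \<and> v \<notin> W k")
    case True
    then obtain v where v: "v \<in> \<sigma>" "v \<in> Fs ! k" "v \<notin> W k" by blast
    have "b \<in> Fs ! k" if "b \<in> \<sigma>" for b
    proof -
      have "{v, b} \<in> part (Suc k)" using step.prems v that by blast
      moreover have "{v, b} \<notin> part k" using new_vertex[OF k v(2,3)] by auto
      ultimately show ?thesis using part_Suc[OF k(2)] by auto
    qed
    then show ?thesis using part_Suc[OF k(2)] by auto
  next
    case False
    have "{a, b} \<in> part k" if "a \<in> \<sigma>" "b \<in> \<sigma>" for a b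
    proof (rule ccontr)
      assume nin: "{a, b} \<notin> part k"
      have "{a, b} \<in> part (Suc k)" using step.prems that by blast
      then have "{a, b} \<subseteq> Fs ! k" using nin part_Suc[OF k(2)] by auto
      then have "{a, b} \<subseteq> W k" using False that by auto
      then show False using nin W_part(1)[OF k] part_down by blast
    qed
    then have "\<sigma> \<in> part k" using step by simp
    then show ?thesis using part_Suc[OF k(2)] by auto
  qed
qed

text \<open>
  Before anything else is attached, \<open>A = Fs ! i - W i\<close> and the earlier vertices outside \<open>W i\<close> are
  separated. A later facet is attached along a single face, which by induction misses \<open>A\<close> or \<open>B\<close>; so
  its new vertices can be added to the other side.
\<close>

lemma separation:
  assumes i: "1 \<le> i" "i < length Fs" and k: "Suc i \<le> k" "k \<le> length Fs"
  shows "\<exists>A B. A \<noteq> {} \<and> B \<noteq> {} \<and> A \<inter> B = {} \<and> A \<union> B = \<Union>(part k) - W i \<and>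
    (\<forall>\<sigma>\<in>part k. \<sigma> \<inter> A = {} \<or> \<sigma> \<inter> B = {})"
  using k
proof (induction k rule: dec_induct)
  case base
  define A where "A = Fs ! i - W i"
  define B where "B = \<Union>(part i) - W i"
  have "A \<noteq> {}" using W_part[OF i] by (auto simp: A_def)
  moreover have "B \<noteq> {}"
  proof
    assume "B = {}"
    moreover have "Fs ! 0 \<in> part i" using i part_iff[of i] by (auto intro!: exI[of _ 0])
    ultimately have "Fs ! 0 \<subseteq> W i" by (auto simp: B_def)
    then have "Fs ! 0 \<subseteq> Fs ! i" using W_part(2)[OF i] by blast
    then show False using antichain[of 0 i] i nonempty by auto
  qed
  moreover have "A \<inter> B = {}" using new_vertex[OF i] by (auto simp: A_def B_def)
  moreover have "A \<union> B = \<Union>(part (Suc i)) - W i"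
    using part_Suc[OF i(2)] by (auto simp: A_def B_def)
  moreover have "\<sigma> \<inter> A = {} \<or> \<sigma> \<inter> B = {}" if "\<sigma> \<in> part (Suc i)" for \<sigma>
  proof (cases "\<sigma> \<in> part i")
    case True
    then show ?thesis using new_vertex[OF i] by (auto simp: A_def)
  next
    case False
    then have \<sigma>: "\<sigma> \<subseteq> Fs ! i" using that part_Suc[OF i(2)] by auto
    have "b \<notin> B" if "b \<in> \<sigma>" for b
      using new_vertex[OF i, of b] that \<sigma> by (auto simp: B_def)
    then show ?thesis by auto
  qed
  ultimately show ?case by - (rule exI[of _ A], rule exI[of _ B], intro conjI ballI; blast)
next
  case (step k)
  have k: "1 \<le> k" "k < length Fs" using step i by auto
  from step obtain A B where AB: "A \<noteq> {}" "B \<noteq> {}" "A \<inter> B = {}" "A \<union> B = \<Union>(part k) - W i"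
    "\<forall>\<sigma>\<in>part k. \<sigma> \<inter> A = {} \<or> \<sigma> \<inter> B = {}" by auto
  have Wi: "W i \<subseteq> \<Union>(part k)"
  proof -
    obtain j where "j < i" "W i \<subseteq> Fs ! j" using W_part(1)[OF i] part_iff[of i] i by auto
    then have "W i \<in> part k" using part_iff[of k] step by auto
    then show ?thesis by blast
  qed
  have extend: "\<exists>A B. A \<noteq> {} \<and> B \<noteq> {} \<and> A \<inter> B = {} \<and> A \<union> B = \<Union>(part (Suc k)) - W i \<and>
      (\<forall>\<sigma>\<in>part (Suc k). \<sigma> \<inter> A = {} \<or> \<sigma> \<inter> B = {})"
    if AB: "A \<noteq> {}" "B \<noteq> {}" "A \<inter> B = {}" "A \<union> B = \<Union>(part k) - W i"
      "\<forall>\<sigma>\<in>part k. \<sigma> \<inter> A = {} \<or> \<sigma> \<inter> B = {}" and WB: "W k \<inter> B = {}" for A B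
  proof -
    define A' where "A' = A \<union> (Fs ! k - W k)"
    define U where "U = \<Union>(part k)"
    have new: "(Fs ! k - W k) \<inter> U = {}" using new_vertex[OF k] by (auto simp: U_def)
    have old: "W k \<subseteq> U" using W_part(1)[OF k] by (auto simp: U_def)
    have AB_U: "A \<union> B = U - W i" using AB(4) by (simp add: U_def)
    then have B: "B \<subseteq> U" by blast
    have "A' \<inter> B = {}" using AB(3) new B unfolding A'_def by blast
    moreover have "A' \<union> B = \<Union>(part (Suc k)) - W i"
    proof -
      have "\<Union>(part (Suc k)) = U \<union> Fs ! k" unfolding part_Suc[OF k(2)] U_def by auto
      also have "\<dots> = U \<union> (Fs ! k - W k)" using old by blast
      finally have "\<Union>(part (Suc k)) = U \<union> (Fs ! k - W k)" .
      moreover have "(Fs ! k - W k) \<inter> W i = {}" using new Wi by (auto simp: U_def)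
      ultimately show ?thesis using AB_U unfolding A'_def by blast
    qed
    moreover have "\<sigma> \<inter> A' = {} \<or> \<sigma> \<inter> B = {}" if "\<sigma> \<in> part (Suc k)" for \<sigma>
    proof (cases "\<sigma> \<in> part k")
      case True
      then have "\<sigma> \<subseteq> U" by (auto simp: U_def)
      then have "\<sigma> \<inter> (Fs ! k - W k) = {}" using new by blast
      then show ?thesis using AB(5) True by (auto simp: A'_def)
    next
      case False
      then have "\<sigma> \<subseteq> Fs ! k" using that part_Suc[OF k(2)] by auto
      then have "\<sigma> \<inter> B = {}" using WB new B by blast
      then show ?thesis by simp
    qed
    moreover have "A' \<noteq> {}" using AB(1) by (auto simp: A'_def)
    moreover note AB(2)
    ultimately show ?thesis by - (rule exI[of _ A'], rule exI[of _ B], intro conjI ballI; blast)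
  qed
  \<comment> \<open>The roles of \<open>A\<close> and \<open>B\<close> are symmetric.\<close>
  from AB(5) W_part(1)[OF k] consider "W k \<inter> B = {}" | "W k \<inter> A = {}" by blast
  then show ?case
  proof cases
    case 1
    show ?thesis by (rule extend[OF AB 1])
  next
    case 2
    have "B \<inter> A = {}" "B \<union> A = \<Union>(part k) - W i" "\<forall>\<sigma>\<in>part k. \<sigma> \<inter> B = {} \<or> \<sigma> \<inter> A = {}"
      using AB by blast+
    from extend[OF AB(2,1) this 2] show ?thesis .
  qed
qed

text \<open>
  The first facet meets the second one in \<open>W 1\<close>; any other facet \<open>Fs ! j\<close> meets an earlier one in \<open>W j\<close>.
\<close>

lemma facet_meets:
  assumes "j < length Fs"
  shows "\<exists>l i. l < length Fs \<and> l \<noteq> j \<and> 1 \<le> i \<and> i < length Fs \<and> W i \<subseteq> Fs ! j \<and> W i \<subseteq> Fs ! l"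
proof (cases "j = 0")
  case True
  have 1: "1 \<le> (1::nat)" "1 < length Fs" using two by auto
  have "W 1 \<subseteq> Fs ! 0" using W_part(1)[OF 1] unfolding part_1 by simp
  then show ?thesis using W_part(2)[OF 1] 1 True by (intro exI[of _ 1]) simp
next
  case False
  then have j: "1 \<le> j" "j < length Fs" using assms by auto
  obtain l where l: "l < j" "W j \<subseteq> Fs ! l" using W_part(1)[OF j] part_iff[of j] j by auto
  show ?thesis by (rule exI[of _ l], rule exI[of _ j]) (use l j W_part(2)[OF j] in auto)
qed

lemma pd_less_part:
  assumes d: "\<And>i. 1 \<le> i \<Longrightarrow> i < length Fs \<Longrightarrow> card V - card (W i) \<le> d" and k: "1 \<le> k" "k \<le> length Fs"
  shows "pd_less (nonface_polys V {}) d (const_seqs (nonface_polys V {}))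
    (const_seqs (nonface_polys V (part k) :: ('v, 'k::field) mpoly set))"
  using k
proof (induction k rule: dec_induct)
  case base
  interpret unital_subring "nonface_polys V {} :: ('v, 'k) mpoly set" by (rule unital_subring_polys)
  have 1: "1 \<le> (1::nat)" "1 < length Fs" "0 < length Fs" using two by auto
  have "W 1 \<subseteq> Fs ! 0" using W_part(1)[OF 1(1,2)] unfolding part_1 by simp
  moreover have "W 1 \<noteq> Fs ! 0" using W_part(2)[OF 1(1,2)] antichain[of 0 1] 1 by auto
  moreover have fin: "finite (Fs ! 0)" using facet_sub[OF 1(3)] finite_V finite_subset by blast
  ultimately have "card (W 1) < card (Fs ! 0)" by (intro psubset_card_mono) auto
  moreover have "card (Fs ! 0) \<le> card V" using facet_sub[OF 1(3)] finite_V by (simp add: card_mono)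
  ultimately have le: "Suc (card V - card (Fs ! 0)) \<le> d" using d[OF 1(1,2)] by linarith
  have "down_closed (Pow (Fs ! 0))" by (auto simp: down_closed_def)
  then show ?case
    unfolding part_1 by (rule pd_less_mono[OF const_seqs_submodule pd_less_simplex[OF finite_V facet_sub[OF 1(3)]] le])
next
  case (step k)
  have k: "1 \<le> k" "k < length Fs" using step by auto
  have "down_closed (part k)" unfolding part_def by (rule down_closed_complex_of)
  then show ?case
    unfolding part_Suc[OF k(2)]
    by (rule pd_less_attach_simplex[OF finite_V facet_sub[OF k(2)] _ attach_part[OF k] d[OF k]])
      (use step in auto)
qed

end

section \<open>Projective dimension and closed neighbourhoods\<close>

context attached_simplices
begin

definition min_attach :: nat where
  "min_attach = Min ((\<lambda>i. card (W i)) ` {1..<length Fs})"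

lemma min_attach_le: "1 \<le> i \<Longrightarrow> i < length Fs \<Longrightarrow> min_attach \<le> card (W i)"
  unfolding min_attach_def by (intro Min_le) auto

lemma min_attach_attained: "\<exists>i. 1 \<le> i \<and> i < length Fs \<and> card (W i) = min_attach"
proof -
  have "min_attach \<in> (\<lambda>i. card (W i)) ` {1..<length Fs}"
    unfolding min_attach_def by (rule Min_in) (use two in auto)
  then show ?thesis by auto
qed

lemma facet_subset_part: "j < length Fs \<Longrightarrow> Fs ! j \<in> part (length Fs)"
  using part_iff[of "length Fs"] by auto

text \<open>
  A facet contains some attaching simplex, and properly so because that simplex also lies in another
  facet.
\<close>

lemma min_attach_less_facet:
  assumes j: "j < length Fs"
  shows "min_attach < card (Fs ! j)"
proof -
  obtain l i where li: "l < length Fs" "l \<noteq> j" "1 \<le> i" "i < length Fs" "W i \<subseteq> Fs ! j" "W i \<subseteq> Fs ! l"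
    using facet_meets[OF j] by blast
  have "W i \<noteq> Fs ! j" using li antichain[of j l] j by auto
  moreover have "finite (Fs ! j)" using facet_sub[OF j] finite_V finite_subset by blast
  ultimately have "card (W i) < card (Fs ! j)" using li by (intro psubset_card_mono) auto
  then show ?thesis using min_attach_le[OF li(3,4)] by simp
qed

lemma min_attach_less: "min_attach < card V"
proof -
  have 0: "0 < length Fs" using nonempty by simp
  have "card (Fs ! 0) \<le> card V" using facet_sub[OF 0] finite_V by (simp add: card_mono)
  then show ?thesis using min_attach_less_facet[OF 0] by simp
qed

text \<open>
  The filtration by attached facets gives the upper bound. For the lower bound, the two sides
  separated by a smallest attaching simplex comprise all vertices outside it.
\<close>

theorem proj_dim_part:
  assumes cover: "\<Union>(part (length Fs)) = V"
  shows "proj_dim (mpoly_ring V)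
      (quot_algebra (mpoly_ring V) (nonface_polys V (part (length Fs)) :: ('v, 'k::field) mpoly set)) =
    enat (card V - min_attach - 1)"
proof (rule antisym)
  have dc: "down_closed (part (length Fs))" unfolding part_def by (rule down_closed_complex_of)
  have len: "1 \<le> length Fs" using two by simp
  have "pd_less (nonface_polys V {}) (card V - min_attach) (const_seqs (nonface_polys V {}))
    (const_seqs (nonface_polys V (part (length Fs)) :: ('v, 'k) mpoly set))"
    by (rule pd_less_part[OF _ len order_refl]) (use min_attach_le in \<open>simp add: diff_le_mono2\<close>)
  moreover have "card V - min_attach = Suc (card V - min_attach - 1)" using min_attach_less by simp
  ultimately show "proj_dim (mpoly_ring V)
      (quot_algebra (mpoly_ring V) (nonface_polys V (part (length Fs)) :: ('v, 'k) mpoly set)) \<le>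
    enat (card V - min_attach - 1)"
    using pd_less_projective_resolution[OF nonface_polys_ideal[OF dc] _ const_seqs_submodule[OF dc]] by metis
  obtain i where i: "1 \<le> i" "i < length Fs" "card (W i) = min_attach" using min_attach_attained by blast
  obtain A B where AB: "A \<noteq> {}" "B \<noteq> {}" "A \<inter> B = {}" "A \<union> B = V - W i"
    "\<forall>\<sigma>\<in>part (length Fs). \<sigma> \<inter> A = {} \<or> \<sigma> \<inter> B = {}"
    using separation[OF i(1,2), of "length Fs"] i cover by auto
  have "W i \<subseteq> V" using W_part(2)[OF i(1,2)] facet_sub[OF i(2)] by blast
  then have "card (A \<union> B) = card V - min_attach"
    unfolding AB(4) using card_Diff_subset[OF W_part(4)[OF i(1,2)]] i(3) by simp
  moreover have "{v} \<in> part (length Fs)" if "v \<in> V" for v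
    using that cover part_down by blast
  ultimately show "enat (card V - min_attach - 1) \<le> proj_dim (mpoly_ring V)
      (quot_algebra (mpoly_ring V) (nonface_polys V (part (length Fs)) :: ('v, 'k) mpoly set))"
    using proj_dim_ge_separated[OF finite_V dc _ _ AB(1) _ AB(2,3), where 'k = 'k] AB(4,5) by auto
qed

text \<open>
  Singletons are faces, so \<open>v\<close> itself belongs to this set when it is a vertex.
\<close>

definition closed_nbhd :: "'v \<Rightarrow> 'v set" where
  "closed_nbhd v = {u. {v, u} \<in> part (length Fs)}"

lemma closed_nbhd_eq: "closed_nbhd v = \<Union>{F \<in> set Fs. v \<in> F}"
  using part_iff[of "length Fs"] by (auto simp: closed_nbhd_def in_set_conv_nth)

lemma facets_part: "facets (part (length Fs)) = set Fs"
proof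
  show "facets (part (length Fs)) \<subseteq> set Fs"
  proof
    fix F assume F: "F \<in> facets (part (length Fs))"
    then obtain j where "j < length Fs" "F \<subseteq> Fs ! j"
      using part_iff[of "length Fs" F] by (auto simp: facets_def)
    then show "F \<in> set Fs" using F facet_subset_part[of j] unfolding facets_def
      by (metis (mono_tags, lifting) mem_Collect_eq nth_mem)
  qed
  show "set Fs \<subseteq> facets (part (length Fs))"
  proof
    fix F assume "F \<in> set Fs"
    then obtain j where j: "j < length Fs" "F = Fs ! j" by (auto simp: in_set_conv_nth)
    have "H = F" if "H \<in> part (length Fs)" "F \<subseteq> H" for H
    proof -
      obtain l where l: "l < length Fs" "H \<subseteq> Fs ! l" using \<open>H \<in> _\<close> part_iff[of "length Fs" H] by auto
      then have "j = l" using antichain[of j l] j \<open>F \<subseteq> H\<close> by auto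
      then show ?thesis using l j \<open>F \<subseteq> H\<close> by auto
    qed
    then show "F \<in> facets (part (length Fs))" using facet_subset_part j by (auto simp: facets_def)
  qed
qed

lemma closed_nbhd_card_gt:
  assumes "v \<in> \<Union>(part (length Fs))"
  shows "min_attach < card (closed_nbhd v)"
proof -
  obtain j where j: "j < length Fs" "v \<in> Fs ! j" using assms part_iff[of "length Fs"] by auto
  then have "Fs ! j \<subseteq> closed_nbhd v" unfolding closed_nbhd_eq using nth_mem[OF j(1)] by blast
  moreover have "closed_nbhd v \<subseteq> V" unfolding closed_nbhd_eq using facet_sub by (auto simp: in_set_conv_nth)
  then have "finite (closed_nbhd v)" using finite_V finite_subset by blast
  ultimately have "card (Fs ! j) \<le> card (closed_nbhd v)" by (intro card_mono)
  then show ?thesis using min_attach_less_facet[OF j(1)] by simp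
qed

text \<open>
  If the neighbourhood of \<open>v\<close> has the least possible size, it is the only facet \<open>F\<close> through \<open>v\<close>. Some
  attaching simplex is contained in both \<open>F\<close> and another facet, hence in \<open>F - {v}\<close>, and it is not
  smaller than \<open>F - {v}\<close>. Conversely, the neighbourhood of a free vertex is its facet.
\<close>

theorem minimal_nbhd_iff_leaf:
  fixes r :: int
  assumes r: "r = int min_attach - 1"
  defines "\<Delta> \<equiv> part (length Fs)"
  shows "(\<exists>v\<in>\<Union>\<Delta>. card (closed_nbhd v) = Suc min_attach) \<longleftrightarrow>
    (\<exists>F\<in>facets \<Delta>. complex_dim (simplex F) = r + 1 \<and> (\<exists>v\<in>F. free_vertex \<Delta> v) \<and>
      is_simplex (simplex F \<inter> complex_of (facets \<Delta> - {F})) \<and>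
      complex_dim (simplex F \<inter> complex_of (facets \<Delta> - {F})) = r)"
    (is "?L \<longleftrightarrow> ?R")
proof
  have fin: "finite (Fs ! j)" if "j < length Fs" for j
    using facet_sub[OF that] finite_V finite_subset by blast
  assume ?L
  then obtain v where v: "v \<in> \<Union>\<Delta>" "card (closed_nbhd v) = Suc min_attach" by blast
  obtain j where j: "j < length Fs" "v \<in> Fs ! j" using v(1) part_iff[of "length Fs"] by (auto simp: \<Delta>_def)
  have "closed_nbhd v \<subseteq> V" unfolding closed_nbhd_eq using facet_sub by (auto simp: in_set_conv_nth)
  then have fin_nbhd: "finite (closed_nbhd v)" using finite_V finite_subset by blast
  \<comment> \<open>Every facet has more than \<open>min_attach\<close> vertices, so a facet through \<open>v\<close> fills its neighbourhood.\<close>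
  have only: "Fs ! l = closed_nbhd v" if "l < length Fs" "v \<in> Fs ! l" for l
  proof (rule card_subset_eq[OF fin_nbhd])
    show sub: "Fs ! l \<subseteq> closed_nbhd v" unfolding closed_nbhd_eq using that nth_mem[OF that(1)] by blast
    show "card (Fs ! l) = card (closed_nbhd v)"
      using card_mono[OF fin_nbhd sub] min_attach_less_facet[OF that(1)] v(2) by simp
  qed
  define F where "F = Fs ! j"
  have F: "F \<in> facets \<Delta>" "v \<in> F" using j by (auto simp: F_def \<Delta>_def facets_part)
  have unique: "H = F" if "H \<in> facets \<Delta>" "v \<in> H" for H
    using that only j unfolding \<Delta>_def facets_part F_def by (metis in_set_conv_nth)
  have cardF: "card F = Suc min_attach" using only[OF j] v(2) by (simp add: F_def)
  have finF: "finite F" using fin j by (simp add: F_def)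
  have inter: "simplex F \<inter> complex_of (facets \<Delta> - {F}) = simplex (F - {v})"
  proof
    show "simplex F \<inter> complex_of (facets \<Delta> - {F}) \<subseteq> simplex (F - {v})"
    proof
      fix \<sigma> assume "\<sigma> \<in> simplex F \<inter> complex_of (facets \<Delta> - {F})"
      then obtain H where "\<sigma> \<subseteq> F" "H \<in> facets \<Delta>" "H \<noteq> F" "\<sigma> \<subseteq> H" by (auto simp: complex_of_def)
      then show "\<sigma> \<in> simplex (F - {v})" using unique by blast
    qed
    obtain l i where li: "l < length Fs" "l \<noteq> j" "1 \<le> i" "i < length Fs" "W i \<subseteq> Fs ! j" "W i \<subseteq> Fs ! l"
      using facet_meets[OF j(1)] by blast
    have ne: "Fs ! l \<noteq> F" using antichain[of l j] li j by (auto simp: F_def)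
    have l: "Fs ! l \<in> facets \<Delta>" using li(1) by (simp add: \<Delta>_def facets_part)
    then have "v \<notin> W i" using unique ne li(6) by blast
    then have "W i \<subseteq> F - {v}" using li(5) by (auto simp: F_def)
    then have "W i = F - {v}"
      using min_attach_le[OF li(3,4)] cardF F(2) finF by (intro card_seteq) auto
    then show "simplex (F - {v}) \<subseteq> simplex F \<inter> complex_of (facets \<Delta> - {F})"
      using li(6) l ne by (auto simp: complex_of_def)
  qed
  have "complex_dim (simplex F) = r + 1" using cardF finF r by (simp add: complex_dim_simplex)
  moreover have "free_vertex \<Delta> v" unfolding free_vertex_def using F unique by blast
  moreover have "is_simplex (simplex (F - {v}))" using finF by (auto simp: is_simplex_def)
  moreover have "complex_dim (simplex (F - {v})) = r"
    using cardF finF F(2) r by (simp add: complex_dim_simplex)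
  ultimately show ?R using F inter by auto
next
  assume ?R
  then obtain F v where F: "F \<in> facets \<Delta>" "complex_dim (simplex F) = r + 1" "v \<in> F" "free_vertex \<Delta> v"
    by blast
  have F': "F \<in> set Fs" using F(1) by (simp add: \<Delta>_def facets_part)
  then have "finite F" using facet_sub finite_V finite_subset by (metis in_set_conv_nth)
  then have "card F = Suc min_attach" using F(2) r by (simp add: complex_dim_simplex)
  moreover have "{H \<in> set Fs. v \<in> H} = {F}"
    using F(3,4) F' by (auto simp: free_vertex_def \<Delta>_def facets_part)
  then have "closed_nbhd v = F" unfolding closed_nbhd_eq by simp
  moreover have "v \<in> \<Union>\<Delta>" using F(1,3) by (auto simp: facets_def)
  ultimately show ?L by blast
qed

end

section \<open>Quasi-forests whose projective dimension is the maximal degree\<close>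

theorem theorem2:
  fixes n :: nat
    and \<Delta> :: "nat set set"
    and Fs :: "nat set list"
    and r :: int
    and G :: "nat set set"
    and S :: "(nat, 'k::field) mpoly ring"
    and k\<Delta> kG :: "((nat, 'k) mpoly, (nat, 'k) mpoly set) module"
  assumes complex: "simplicial_complex {1..n} \<Delta>"
    and quasi_forest: "quasi_forest \<Delta>"
    and order: "quasi_forest_order \<Delta> Fs"
    and two_facets: "length Fs \<ge> 2"
    and r: "r = Min (attach_dim Fs ` {1..<length Fs})"
    and G: "G = complement_edges {1..n} (skeleton_edges \<Delta>)"
    and S: "S = mpoly_ring {1..n}"
    and k\<Delta>: "k\<Delta> = stanley_reisner_ring {1..n} \<Delta>"
    and kG: "kG = edge_ring {1..n} G"
  shows "k\<Delta> = kG \<and>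
    (proj_dim S k\<Delta> = enat (Max (graph_degree G ` {1..n})) \<longleftrightarrow>
      (\<exists>F\<in>facets \<Delta>. complex_dim (simplex F) = r + 1 \<and>
        (\<exists>v\<in>F. free_vertex \<Delta> v) \<and>
        is_simplex (simplex F \<inter> complex_of (facets \<Delta> - {F})) \<and>
        complex_dim (simplex F \<inter> complex_of (facets \<Delta> - {F})) = r))"
proof
  let ?V = "{1..n}"
  have Fs: "quasi_forest_seq Fs" "\<Delta> = complex_of (set Fs)" "distinct Fs" "set Fs = facets \<Delta>"
    using order unfolding quasi_forest_order_def by blast+
  have sub: "\<sigma> \<subseteq> ?V" if "\<sigma> \<in> \<Delta>" for \<sigma> using complex that by (auto simp: simplicial_complex_def)
  have verts: "{v} \<in> \<Delta>" if "v \<in> ?V" for v using complex that by (simp add: simplicial_complex_def)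
  \<comment> \<open>A simplex \<open>Pow X\<close> has vertex set \<open>\<Union>(Pow X) = X\<close>.\<close>
  define W where "W i = \<Union>(complex_of (set (take i Fs)) \<inter> simplex (Fs ! i))" for i
  have W: "complex_of (set (take i Fs)) \<inter> simplex (Fs ! i) = simplex (W i)" if "1 \<le> i" "i < length Fs" for i
  proof -
    have "is_simplex (complex_of (set (take i Fs)) \<inter> simplex (Fs ! i))"
      using quasi_forest_seq_attach[OF Fs(1)] that by blast
    then obtain X where X: "complex_of (set (take i Fs)) \<inter> simplex (Fs ! i) = simplex X"
      unfolding is_simplex_def by blast
    then have "W i = X" by (simp add: W_def)
    then show ?thesis using X by simp
  qed
  have mem: "Fs ! i \<in> facets \<Delta>" if "i < length Fs" for i using Fs(4) that nth_mem by blast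
  interpret attached_simplices ?V Fs W
  proof
    show "Fs ! i \<subseteq> ?V" if "i < length Fs" for i using mem[OF that] sub by (auto simp: facets_def)
    show "i = j" if "i < length Fs" "j < length Fs" "Fs ! i \<subseteq> Fs ! j" for i j
    proof -
      have "Fs ! j = Fs ! i" using mem[OF that(1)] mem[OF that(2)] that(3) by (auto simp: facets_def)
      then show ?thesis using Fs(3) that nth_eq_iff_index_eq by metis
    qed
  qed (use W two_facets in auto)
  have \<Delta>: "part (length Fs) = \<Delta>" using Fs(2) by (simp add: part_def)
  have cover: "\<Union>\<Delta> = ?V" using sub verts by blast
  \<comment> \<open>The minimal non-faces are the edges of \<open>G\<close>, so both ideals are generated by them.\<close>
  have flag\<Delta>: "\<tau> \<in> \<Delta> \<longleftrightarrow> (\<forall>e\<in>G. \<not> e \<subseteq> \<tau>)" if \<tau>: "\<tau> \<subseteq> ?V" for \<tau>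
  proof
    assume "\<tau> \<in> \<Delta>"
    then have "e \<in> \<Delta>" if "e \<subseteq> \<tau>" for e using complex that unfolding simplicial_complex_def by blast
    then show "\<forall>e\<in>G. \<not> e \<subseteq> \<tau>" unfolding G complement_edges_def skeleton_edges_def by auto
  next
    assume no_edge: "\<forall>e\<in>G. \<not> e \<subseteq> \<tau>"
    have pairs: "{a, b} \<in> \<Delta>" if "a \<in> \<tau>" "b \<in> \<tau>" for a b
    proof (cases "a = b")
      case True
      then show ?thesis using verts that \<tau> by auto
    next
      case False
      have "{a, b} \<notin> G" using no_edge that by auto
      then show ?thesis using that \<tau> False unfolding G complement_edges_def skeleton_edges_def by blast
    qed
    have "1 \<le> length Fs" using two_facets by simp
    from flag[OF this order_refl pairs[folded \<Delta>]] show "\<tau> \<in> \<Delta>" unfolding \<Delta> .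
  qed
  have "edge_ideal ?V G = (nonface_polys ?V \<Delta> :: (nat, 'k) mpoly set)"
    by (rule edge_ideal_eq[OF _ _ flag\<Delta>]) (auto simp: G complement_edges_def)
  then show "k\<Delta> = kG"
    by (simp only: k\<Delta> kG stanley_reisner_ring_def edge_ring_def stanley_reisner_ideal_eq[OF complex])
  have pd: "proj_dim S k\<Delta> = enat (n - min_attach - 1)"
    using proj_dim_part[where 'k = 'k]
    by (simp only: \<Delta> cover S k\<Delta> stanley_reisner_ring_def stanley_reisner_ideal_eq[OF complex]
        card_atLeastAtMost simp_thms) simp
  have r_eq: "r = int min_attach - 1"
  proof -
    have "attach_dim Fs i = int (card (W i)) - 1" if "i \<in> {1..<length Fs}" for i
      using that W_part(4)[of i] by (simp add: attach_dim_def W complex_dim_simplex)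
    then have "attach_dim Fs ` {1..<length Fs} = (\<lambda>w. int w - 1) ` (\<lambda>i. card (W i)) ` {1..<length Fs}"
      by (simp add: image_image)
    moreover have "Min ((\<lambda>w. int w - 1) ` (\<lambda>i. card (W i)) ` {1..<length Fs}) = int min_attach - 1"
      unfolding min_attach_def
      by (rule mono_Min_commute[symmetric]) (use two_facets in \<open>auto simp: mono_def\<close>)
    ultimately show ?thesis using r by simp
  qed
  have nbhd_V: "closed_nbhd v \<subseteq> ?V" for v using sub unfolding closed_nbhd_def \<Delta> by blast
  have degree: "graph_degree G v = n - card (closed_nbhd v)" if v: "v \<in> ?V" for v
  proof -
    have "{w. {v, w} \<in> G} = ?V - closed_nbhd v"
    proof (intro subset_antisym subsetI)
      fix w assume "w \<in> {w. {v, w} \<in> G}"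
      then show "w \<in> ?V - closed_nbhd v"
        unfolding G complement_edges_def skeleton_edges_def closed_nbhd_def \<Delta>
        by (auto simp: doubleton_eq_iff insert_commute)
    next
      fix w assume w: "w \<in> ?V - closed_nbhd v"
      then have "{v, w} \<notin> \<Delta>" by (simp add: closed_nbhd_def \<Delta>)
      moreover from this have "v \<noteq> w" using verts[OF v] by auto
      ultimately show "w \<in> {w. {v, w} \<in> G}" using v w
        unfolding G complement_edges_def skeleton_edges_def by blast
    qed
    then show ?thesis
      using card_Diff_subset[OF finite_subset[OF nbhd_V] nbhd_V] by (simp add: graph_degree_def)
  qed
  have nbhd_card: "min_attach < card (closed_nbhd v)" "card (closed_nbhd v) \<le> n" if "v \<in> ?V" for v
    using closed_nbhd_card_gt[of v] that card_mono[OF _ nbhd_V[of v]] by (auto simp: \<Delta> cover)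
  have "min_attach < n" using min_attach_less by simp
  then have "?V \<noteq> {}" by auto
  have "n - min_attach - 1 = Max (graph_degree G ` ?V) \<longleftrightarrow>
      (\<exists>v\<in>?V. card (closed_nbhd v) = Suc min_attach)"
  proof
    assume eq: "n - min_attach - 1 = Max (graph_degree G ` ?V)"
    have "Max (graph_degree G ` ?V) \<in> graph_degree G ` ?V" by (rule Max_in) (use \<open>?V \<noteq> {}\<close> in auto)
    then obtain v where v: "v \<in> ?V" "graph_degree G v = n - min_attach - 1" unfolding eq[symmetric] by auto
    then have "card (closed_nbhd v) = Suc min_attach"
      using degree[OF v(1)] nbhd_card[OF v(1)] \<open>min_attach < n\<close> by linarith
    then show "\<exists>v\<in>?V. card (closed_nbhd v) = Suc min_attach" using v(1) by blast
  next
    assume "\<exists>v\<in>?V. card (closed_nbhd v) = Suc min_attach"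
    then obtain v where v: "v \<in> ?V" "card (closed_nbhd v) = Suc min_attach" by blast
    show "n - min_attach - 1 = Max (graph_degree G ` ?V)"
    proof (rule Max_eqI[symmetric])
      show "n - min_attach - 1 \<in> graph_degree G ` ?V"
        using v degree[OF v(1)] by (intro image_eqI[of _ _ v]) auto
      fix y assume "y \<in> graph_degree G ` ?V"
      then obtain u where "u \<in> ?V" "y = graph_degree G u" by blast
      then show "y \<le> n - min_attach - 1" using degree[of u] nbhd_card(1)[of u] by simp
    qed simp
  qed
  then show "proj_dim S k\<Delta> = enat (Max (graph_degree G ` ?V)) \<longleftrightarrow>
      (\<exists>F\<in>facets \<Delta>. complex_dim (simplex F) = r + 1 \<and>
        (\<exists>v\<in>F. free_vertex \<Delta> v) \<and>
        is_simplex (simplex F \<inter> complex_of (facets \<Delta> - {F})) \<and>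
        complex_dim (simplex F \<inter> complex_of (facets \<Delta> - {F})) = r)"
    using minimal_nbhd_iff_leaf[OF r_eq] by (simp add: pd \<Delta> cover)
qed

end
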